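(* Consider a purely kinetic Chaplygin system with symmetry group $G$, $m=\dim(Q/G)$. If $f\in C^\infty(Q/G)$ satisfies $$(A')^G\quad G_{bk}R^k_{ac}+G_{ak}R^k_{bc}+g_{bc}\frac{\partial f}{\partial q^a}+g_{ac}\frac{\partial f}{\partial q^b}-2g_{ab}\frac{\partial f}{\partial q^c}=0\quad\text{for all }a,b,c$$ (i.e. when the couple $(\overline g_{ai}=-G_{ai},F=f\circ\pi)$ is a projective geodesic extension), then $$e^{(m-1)f}(\omega_l-\gamma^G)^m=e^{(m-1)f}\omega_l^m$$ is an invariant volume form on $T(Q/G)$ for the reduced vector field $\Gamma^{red}$.
   Context: Setting: $Q$ is an $n$-dimensional manifold with Riemannian metric $g$, $\mathcal D\subset TQ$ is a distribution of rank $m$, $L(v)=\frac12g(v,v)$. The system $(L,\mathcal D)$ is a (purely kinetic) Chaplygin system: a Lie group $G$ acts freely and properly on $Q$, $\pi:Q\to Q/G$ is the principal bundle, $g$ and $\mathcal D$ are $G$-invariant, and $\mathcal D$ is the horizontal distribution of a principal connection on $\pi$ (so $TQ=\mathcal D\oplus V\pi$, with $V\pi=\ker T\pi$, and $\dim Q/G=m$). Indices $a,b,c,d,e=1,\dots,m$; $i,j,k=1,\dots,n-m$. Summation convention is used. Frames: $V_i$ are the infinitesimal generators of a basis of the Lie algebra of $G$; $X_a$ are the horizontal lifts of the coordinate fields $\partial/\partial q^a$ on $Q/G$. Set $G_{ab}=g(X_a,X_b)$ (inverse $G^{ab}$), $G_{ai}=g(X_a,V_i)$, $K^b_i=-G^{ab}G_{ai}$,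 $X_i=V_i+K^b_iX_b$ (so $\{X_i\}$ spans the $g$-orthogonal complement of $\mathcal D$). Write $[X_\alpha,X_\beta]=R^\gamma_{\alpha\beta}X_\gamma$ in the frame $\{X_a,X_i\}$ and $g_{ab}=G_{ab}$. The functions $g_{ab}$, $R^c_{ab}$ and $G_{ak}R^k_{bc}$ are $G$-invariant and are regarded as functions on $Q/G$; one has $g_{ad}R^d_{bc}=G_{ak}R^k_{bc}$. On $T(Q/G)$, with coordinates $(q^a,\dot q^a)$: $l=\frac12g_{ab}\dot q^a\dot q^b$, $\theta_l=g_{ab}\dot q^a dq^b$, $\omega_l=-d\theta_l$, $E_l=l$, $\alpha=-G_{ak}R^k_{bc}\dot q^a\dot q^b dq^c$, $\gamma^G=\frac16\left(-G_{bk}R^k_{ac}+G_{ck}R^k_{ab}-2G_{ak}R^k_{bc}\right)\dot q^a\,dq^b\wedge dq^c$. The reduced vector field $\Gamma^{red}$ (whose base integral curves are the projections to $Q/G$ of the nonholonomic trajectories) is the second-order vector field determined by $\iota_{\Gamma^{red}}\omega_l=dE_l+\alpha$, i.e. $\Gamma^{red}=\dot q^e\frac{\partial}{\partial q^e}+(-\Gamma^{e,red}_{ab}+g^{ce}g_{db}R^d_{ac})\dot q^a\dot q^b\frac{\partial}{\partial\dot q^e}$, with $\Gamma^{e,red}_{ab}$ the Christoffel symbols of the metric $(g_{ab})$ on $Q/G$. An invariant volume form is a nowhere-vanishing $2m$-form $\mu$ on $T(Q/G)$ with $\mathcal L_{\Gamma^{red}}\mu=0$. Powers are exterior powers. The parenthetical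 remark in the claim is terminology: for a symmetric $(0,2)$-tensor field $\overline g$ with $\overline g|_{\mathcal D\times\mathcal D}=g|_{\mathcal D\times\mathcal D}$ and $\overline g_{ai}=\overline g(X_a,X_i)$, the couple $(\overline g_{ai},F)$ is a projective geodesic extension if the nonholonomic trajectories are, up to a reparametrization, geodesics of a Riemannian metric $\hat g$ with $\hat g(X_a,X_b)=e^{2F}g_{ab}$, $\hat g(X_a,X_i)=e^{2F}\overline g_{ai}$; for $\overline g_{ai}=-G_{ai}$, $F=f\circ\pi$, this is characterized by $(A')^G$. *)

theory Defs
  imports "HOL-Analysis.Analysis" "HOL-Algebra.Group_Action"
begin

section \<open>Smooth manifolds\<close>

primrec Ck_on :: "nat \<Rightarrow> 'a::euclidean_space set \<Rightarrow> ('a \<Rightarrow> 'b::real_normed_vector) \<Rightarrow> bool" where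
  "Ck_on 0 S f \<longleftrightarrow> continuous_on S f"
| "Ck_on (Suc k) S f \<longleftrightarrow> (\<forall>x\<in>S. f differentiable (at x)) \<and>
     (\<forall>v. Ck_on k S (\<lambda>x. frechet_derivative f (at x) v))"

text \<open>Only meaningful for open \<open>S\<close>.\<close>
definition smooth_on :: "'a::euclidean_space set \<Rightarrow> ('a \<Rightarrow> 'b::real_normed_vector) \<Rightarrow> bool" where
  "smooth_on S f \<longleftrightarrow> (\<forall>k. Ck_on k S f)"

type_synonym ('a, 'e) chart = "'a set \<times> ('a \<Rightarrow> 'e)"

record ('a, 'e) mfd =
  mtop :: "'a topology"
  atlas :: "('a, 'e) chart set"

abbreviation pts :: "('a, 'e) mfd \<Rightarrow> 'a set" where
  "pts M \<equiv> topspace (mtop M)"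

text \<open>The atlas need not be maximal; the dimension is that of the model space \<open>'e\<close>.\<close>
definition smooth_manifold :: "('a, 'e::euclidean_space) mfd \<Rightarrow> bool" where
  "smooth_manifold M \<longleftrightarrow>
     Hausdorff_space (mtop M) \<and> second_countable (mtop M) \<and>
     \<Union>(fst ` atlas M) = pts M \<and>
     (\<forall>(U, \<kappa>)\<in>atlas M. openin (mtop M) U \<and> open (\<kappa> ` U) \<and>
        homeomorphic_map (subtopology (mtop M) U) (top_of_set (\<kappa> ` U)) \<kappa>) \<and>
     (\<forall>(U, \<kappa>)\<in>atlas M. \<forall>(V, \<psi>)\<in>atlas M. smooth_on (\<kappa> ` (U \<inter> V)) (\<psi> \<circ> inv_into U \<kappa>))"

definition prod_mfd :: "('a, 'e) mfd \<Rightarrow> ('b, 'f) mfd \<Rightarrow> ('a \<times> 'b, 'e \<times> 'f) mfd" where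
  "prod_mfd M N = \<lparr> mtop = prod_topology (mtop M) (mtop N),
     atlas = {(U \<times> V, map_prod \<kappa> \<psi>) | U \<kappa> V \<psi>. (U, \<kappa>) \<in> atlas M \<and> (V, \<psi>) \<in> atlas N} \<rparr>"

text \<open>Real functions and maps are total; only their restriction to the open set \<open>S\<close> matters.\<close>
definition smooth_fun :: "('a, 'e::euclidean_space) mfd \<Rightarrow> 'a set \<Rightarrow> ('a \<Rightarrow> real) \<Rightarrow> bool" where
  "smooth_fun M S f \<longleftrightarrow> (\<forall>(U, \<kappa>)\<in>atlas M. smooth_on (\<kappa> ` (U \<inter> S)) (f \<circ> inv_into U \<kappa>))"

definition smooth_map ::
  "('a, 'e::euclidean_space) mfd \<Rightarrow> ('b, 'f::euclidean_space) mfd \<Rightarrow> 'a set \<Rightarrow> ('a \<Rightarrow> 'b) \<Rightarrow> bool" where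
  "smooth_map M N S F \<longleftrightarrow> continuous_map (subtopology (mtop M) S) (mtop N) F \<and>
     (\<forall>(U, \<kappa>)\<in>atlas M. \<forall>(V, \<psi>)\<in>atlas N.
        smooth_on (\<kappa> ` {p \<in> U \<inter> S. F p \<in> V}) (\<psi> \<circ> F \<circ> inv_into U \<kappa>))"

definition diffeo ::
  "('a, 'e::euclidean_space) mfd \<Rightarrow> ('b, 'f::euclidean_space) mfd \<Rightarrow> 'a set \<Rightarrow> 'b set \<Rightarrow> ('a \<Rightarrow> 'b) \<Rightarrow> bool" where
  "diffeo M N S T F \<longleftrightarrow> openin (mtop M) S \<and> openin (mtop N) T \<and> bij_betw F S T \<and>
     smooth_map M N S F \<and> smooth_map N M T (inv_into S F)"

section \<open>Tangent vectors and vector fields\<close>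

definition smooth_at :: "('a, 'e::euclidean_space) mfd \<Rightarrow> 'a \<Rightarrow> ('a \<Rightarrow> real) \<Rightarrow> bool" where
  "smooth_at M p f \<longleftrightarrow> (\<exists>U. openin (mtop M) U \<and> p \<in> U \<and> smooth_fun M U f)"

type_synonym 'a tvec = "('a \<Rightarrow> real) \<Rightarrow> real"

definition lincomb :: "('i \<Rightarrow> 'a tvec) \<Rightarrow> ('i::finite \<Rightarrow> real) \<Rightarrow> 'a tvec" where
  "lincomb b c = (\<lambda>f. \<Sum>i\<in>UNIV. c i * b i f)"

definition is_basis :: "('i::finite \<Rightarrow> 'a tvec) \<Rightarrow> 'a tvec set \<Rightarrow> bool" where
  "is_basis b W \<longleftrightarrow> inj (lincomb b) \<and> range (lincomb b) = W"

text \<open>Derivations at \<open>p\<close> of the functions smooth near \<open>p\<close>. The Leibniz rule, applied to indicator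
  functions of neighbourhoods, makes them depend on germs only; the value \<open>0\<close> on
  functions not smooth near \<open>p\<close> makes equality of tangent vectors extensional.\<close>
definition tangent_space :: "('a, 'e::euclidean_space) mfd \<Rightarrow> 'a \<Rightarrow> 'a tvec set" where
  "tangent_space M p = {v.
     (\<forall>f h. smooth_at M p f \<longrightarrow> smooth_at M p h \<longrightarrow>
        v (\<lambda>x. f x + h x) = v f + v h \<and> v (\<lambda>x. f x * h x) = f p * v h + h p * v f) \<and>
     (\<forall>c f. smooth_at M p f \<longrightarrow> v (\<lambda>x. c * f x) = c * v f) \<and>
     (\<forall>f. \<not> smooth_at M p f \<longrightarrow> v f = 0)}"

definition tangent_map :: "('b, 'f::euclidean_space) mfd \<Rightarrow> ('a \<Rightarrow> 'b) \<Rightarrow> 'a \<Rightarrow> 'a tvec \<Rightarrow> 'b tvec" where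
  "tangent_map N F p v = (\<lambda>h. if smooth_at N (F p) h then v (h \<circ> F) else 0)"

definition vector_field_on :: "('a, 'e::euclidean_space) mfd \<Rightarrow> 'a set \<Rightarrow> ('a \<Rightarrow> 'a tvec) \<Rightarrow> bool" where
  "vector_field_on M S X \<longleftrightarrow> (\<forall>p\<in>S. X p \<in> tangent_space M p) \<and>
     (\<forall>W f. openin (mtop M) W \<longrightarrow> W \<subseteq> S \<longrightarrow> smooth_fun M W f \<longrightarrow> smooth_fun M W (\<lambda>p. X p f))"

definition bracket ::
  "('a, 'e::euclidean_space) mfd \<Rightarrow> ('a \<Rightarrow> 'a tvec) \<Rightarrow> ('a \<Rightarrow> 'a tvec) \<Rightarrow> 'a \<Rightarrow> 'a tvec" where
  "bracket M X Y p = (\<lambda>f. if smooth_at M p f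
     then X p (\<lambda>x. Y x f) - Y p (\<lambda>x. X x f) else 0)"

definition coord_field ::
  "('a, real^'m::finite) mfd \<Rightarrow> ('a, real^'m) chart \<Rightarrow> 'm \<Rightarrow> 'a \<Rightarrow> 'a tvec" where
  "coord_field M c a p = (\<lambda>f. if smooth_at M p f
     then frechet_derivative (f \<circ> inv_into (fst c) (snd c)) (at (snd c p)) (axis a 1) else 0)"

definition riemannian_metric ::
  "('a, 'e::euclidean_space) mfd \<Rightarrow> ('a \<Rightarrow> 'a tvec \<Rightarrow> 'a tvec \<Rightarrow> real) \<Rightarrow> bool" where
  "riemannian_metric M g \<longleftrightarrow>
     (\<forall>p\<in>pts M. \<forall>u\<in>tangent_space M p. \<forall>v\<in>tangent_space M p.
        g p u v = g p v u \<and> (u \<noteq> (\<lambda>_. 0) \<longrightarrow> g p u u > 0) \<and>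
        (\<forall>w\<in>tangent_space M p. \<forall>r s.
           g p (\<lambda>f. r * u f + s * v f) w = r * g p u w + s * g p v w)) \<and>
     (\<forall>W X Y. openin (mtop M) W \<longrightarrow> vector_field_on M W X \<longrightarrow> vector_field_on M W Y \<longrightarrow>
        smooth_fun M W (\<lambda>p. g p (X p) (Y p)))"

text \<open>A smooth distribution whose rank is the cardinality of \<open>'i\<close>.\<close>
definition distribution ::
  "('a, 'e::euclidean_space) mfd \<Rightarrow> 'i::finite itself \<Rightarrow> ('a \<Rightarrow> 'a tvec set) \<Rightarrow> bool" where
  "distribution M _ D \<longleftrightarrow> (\<forall>p\<in>pts M. \<exists>W. openin (mtop M) W \<and> p \<in> W \<and>
     (\<exists>Y :: 'i \<Rightarrow> 'a \<Rightarrow> 'a tvec. (\<forall>i. vector_field_on M W (Y i)) \<and>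
        (\<forall>x\<in>W. is_basis (\<lambda>i. Y i x) (D x))))"

section \<open>Chaplygin systems\<close>

definition lie_group :: "'g monoid \<Rightarrow> ('g, 'e::euclidean_space) mfd \<Rightarrow> bool" where
  "lie_group G M \<longleftrightarrow> group G \<and> smooth_manifold M \<and> pts M = carrier G \<and>
     smooth_map (prod_mfd M M) M (carrier G \<times> carrier G) (\<lambda>(a, b). a \<otimes>\<^bsub>G\<^esub> b) \<and>
     smooth_map M M (carrier G) (\<lambda>a. inv\<^bsub>G\<^esub> a)"

text \<open>Here \<open>dim Q = CARD('n)\<close>, \<open>dim G = CARD('k)\<close> and \<open>dim (Q/G) = CARD('m)\<close>. The points of the
  manifold \<open>Bman\<close> are the orbits. \<open>hor\<close> is the constraint distribution.\<close>
record ('q, 'g, 'n, 'k, 'm) chaplygin =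
  Qman :: "('q, real^'n::finite) mfd"
  grp :: "'g monoid"
  Gman :: "('g, real^'k::finite) mfd"
  act :: "'g \<Rightarrow> 'q \<Rightarrow> 'q"
  Bman :: "('q set, real^'m::finite) mfd"
  met :: "'q \<Rightarrow> 'q tvec \<Rightarrow> 'q tvec \<Rightarrow> real"
  hor :: "'q \<Rightarrow> 'q tvec set"

abbreviation proj where
  "proj S \<equiv> orbit (grp S) (act S)"

definition over :: "('q, 'g, 'n::finite, 'k::finite, 'm::finite) chaplygin \<Rightarrow> 'q set set \<Rightarrow> 'q set" where
  "over S U = {q \<in> pts (Qman S). proj S q \<in> U}"

definition vertical :: "('q, 'g, 'n::finite, 'k::finite, 'm::finite) chaplygin \<Rightarrow> 'q \<Rightarrow> 'q tvec set" where
  "vertical S q = {v \<in> tangent_space (Qman S) q. tangent_map (Bman S) (proj S) q v = (\<lambda>_. 0)}"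

text \<open>The smooth structure of \<open>Q/G\<close> is the one for which the orbit projection is a principal bundle,
  that is, admits equivariant local trivializations \<open>q \<mapsto> (proj q, \<tau> q)\<close>.\<close>
definition principal_bundle :: "('q, 'g, 'n::finite, 'k::finite, 'm::finite) chaplygin \<Rightarrow> bool" where
  "principal_bundle S \<longleftrightarrow> smooth_manifold (Bman S) \<and>
     pts (Bman S) = orbits (grp S) (pts (Qman S)) (act S) \<and>
     (\<forall>x\<in>pts (Bman S). \<exists>U \<tau>. openin (mtop (Bman S)) U \<and> x \<in> U \<and>
        diffeo (Qman S) (prod_mfd (Bman S) (Gman S)) (over S U) (U \<times> carrier (grp S))
          (\<lambda>q. (proj S q, \<tau> q)) \<and>
        (\<forall>h\<in>carrier (grp S). \<forall>q\<in>over S U. \<tau> (act S h q) = h \<otimes>\<^bsub>grp S\<^esub> \<tau> q))"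

definition chaplygin_system :: "('q, 'g, 'n::finite, 'k::finite, 'm::finite) chaplygin \<Rightarrow> bool" where
  "chaplygin_system S \<longleftrightarrow>
     CARD('n) = CARD('m) + CARD('k) \<and>
     smooth_manifold (Qman S) \<and>
     lie_group (grp S) (Gman S) \<and>
     group_action (grp S) (pts (Qman S)) (act S) \<and>
     smooth_map (prod_mfd (Gman S) (Qman S)) (Qman S) (carrier (grp S) \<times> pts (Qman S))
       (\<lambda>(h, q). act S h q) \<and>
     \<comment> \<open>the action is free and proper\<close>
     (\<forall>q\<in>pts (Qman S). stabilizer (grp S) (act S) q = {\<one>\<^bsub>grp S\<^esub>}) \<and>
     proper_map (prod_topology (mtop (Gman S)) (mtop (Qman S)))
       (prod_topology (mtop (Qman S)) (mtop (Qman S))) (\<lambda>(h, q). (act S h q, q)) \<and>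
     principal_bundle S \<and>
     riemannian_metric (Qman S) (met S) \<and>
     (\<forall>h\<in>carrier (grp S). \<forall>q\<in>pts (Qman S).
        \<forall>u\<in>tangent_space (Qman S) q. \<forall>v\<in>tangent_space (Qman S) q.
        met S (act S h q) (tangent_map (Qman S) (act S h) q u) (tangent_map (Qman S) (act S h) q v)
          = met S q u v) \<and>
     \<comment> \<open>the constraint distribution is the horizontal distribution of a principal connection\<close>
     distribution (Qman S) TYPE('m) (hor S) \<and>
     (\<forall>q\<in>pts (Qman S). hor S q \<subseteq> tangent_space (Qman S) q) \<and>
     (\<forall>h\<in>carrier (grp S). \<forall>q\<in>pts (Qman S).
        tangent_map (Qman S) (act S h) q ` hor S q = hor S (act S h q)) \<and>
     (\<forall>q\<in>pts (Qman S). \<forall>v\<in>tangent_space (Qman S) q.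
        \<exists>!(u, w). u \<in> hor S q \<and> w \<in> vertical S q \<and> v = (\<lambda>f. u f + w f))"

section \<open>Adapted frames\<close>

definition lie_algebra_basis ::
  "('q, 'g, 'n::finite, 'k::finite, 'm::finite) chaplygin \<Rightarrow> ('k \<Rightarrow> 'g tvec) \<Rightarrow> bool" where
  "lie_algebra_basis S \<xi> \<longleftrightarrow> is_basis \<xi> (tangent_space (Gman S) \<one>\<^bsub>grp S\<^esub>)"

definition generator ::
  "('q, 'g, 'n::finite, 'k::finite, 'm::finite) chaplygin \<Rightarrow> ('k \<Rightarrow> 'g tvec) \<Rightarrow> 'k \<Rightarrow> 'q \<Rightarrow> 'q tvec" where
  "generator S \<xi> i q = tangent_map (Qman S) (\<lambda>h. act S h q) \<one>\<^bsub>grp S\<^esub> (\<xi> i)"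

definition hlift ::
  "('q, 'g, 'n::finite, 'k::finite, 'm::finite) chaplygin \<Rightarrow> ('q set, real^'m) chart \<Rightarrow> 'm \<Rightarrow> 'q \<Rightarrow> 'q tvec" where
  "hlift S c a q = (THE v. v \<in> hor S q \<and>
     tangent_map (Bman S) (proj S) q v = coord_field (Bman S) c a (proj S q))"

definition Gaa ::
  "('q, 'g, 'n::finite, 'k::finite, 'm::finite) chaplygin \<Rightarrow> ('q set, real^'m) chart \<Rightarrow> 'm \<Rightarrow> 'm \<Rightarrow> 'q \<Rightarrow> real" where
  "Gaa S c a b q = met S q (hlift S c a q) (hlift S c b q)"

definition Gai ::
  "('q, 'g, 'n::finite, 'k::finite, 'm::finite) chaplygin \<Rightarrow> ('k \<Rightarrow> 'g tvec) \<Rightarrow> ('q set, real^'m) chart \<Rightarrow>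
     'm \<Rightarrow> 'k \<Rightarrow> 'q \<Rightarrow> real" where
  "Gai S \<xi> c a i q = met S q (hlift S c a q) (generator S \<xi> i q)"

definition Kcoef ::
  "('q, 'g, 'n::finite, 'k::finite, 'm::finite) chaplygin \<Rightarrow> ('k \<Rightarrow> 'g tvec) \<Rightarrow> ('q set, real^'m) chart \<Rightarrow>
     'm \<Rightarrow> 'k \<Rightarrow> 'q \<Rightarrow> real" where
  "Kcoef S \<xi> c b i q =
     - (\<Sum>a\<in>UNIV. matrix_inv (\<chi> a b. Gaa S c a b q) $ a $ b * Gai S \<xi> c a i q)"

text \<open>\<open>Inl a\<close> indexes \<open>X\<^sub>a\<close> and \<open>Inr i\<close> indexes \<open>X\<^sub>i\<close>.\<close>
definition frame ::
  "('q, 'g, 'n::finite, 'k::finite, 'm::finite) chaplygin \<Rightarrow> ('k \<Rightarrow> 'g tvec) \<Rightarrow> ('q set, real^'m) chart \<Rightarrow>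
     'm + 'k \<Rightarrow> 'q \<Rightarrow> 'q tvec" where
  "frame S \<xi> c \<alpha> q = (case \<alpha> of
       Inl a \<Rightarrow> hlift S c a q
     | Inr i \<Rightarrow> (\<lambda>f. generator S \<xi> i q f + (\<Sum>b\<in>UNIV. Kcoef S \<xi> c b i q * hlift S c b q f)))"

text \<open>\<open>R \<gamma> \<alpha> \<beta>\<close> is \<open>R\<^sup>\<gamma>\<close> with lower indices \<open>\<alpha>\<close>, \<open>\<beta>\<close>.\<close>
definition structure_functions ::
  "('q, 'g, 'n::finite, 'k::finite, 'm::finite) chaplygin \<Rightarrow> ('k \<Rightarrow> 'g tvec) \<Rightarrow> ('q set, real^'m) chart \<Rightarrow>
     ('m + 'k \<Rightarrow> 'm + 'k \<Rightarrow> 'm + 'k \<Rightarrow> 'q \<Rightarrow> real) \<Rightarrow> bool" where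
  "structure_functions S \<xi> c R \<longleftrightarrow> (\<forall>q\<in>over S (fst c). \<forall>\<alpha> \<beta>.
     bracket (Qman S) (frame S \<xi> c \<alpha>) (frame S \<xi> c \<beta>) q
       = lincomb (\<lambda>\<gamma>. frame S \<xi> c \<gamma> q) (\<lambda>\<gamma>. R \<gamma> \<alpha> \<beta> q))"

text \<open>A \<open>G\<close>-invariant function on \<open>Q\<close>, regarded as a function on \<open>Q/G\<close>.\<close>
definition on_quotient :: "('q \<Rightarrow> real) \<Rightarrow> 'q set \<Rightarrow> real" where
  "on_quotient h x = h (SOME q. q \<in> x)"

definition gred ::
  "('q, 'g, 'n::finite, 'k::finite, 'm::finite) chaplygin \<Rightarrow> ('q set, real^'m) chart \<Rightarrow> 'm \<Rightarrow> 'm \<Rightarrow> 'q set \<Rightarrow> real" where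
  "gred S c a b = on_quotient (Gaa S c a b)"

text \<open>\<open>G\<^sub>a\<^sub>k R\<^sup>k\<^sub>b\<^sub>d\<close> on \<open>Q/G\<close>.\<close>
definition GR ::
  "('q, 'g, 'n::finite, 'k::finite, 'm::finite) chaplygin \<Rightarrow> ('k \<Rightarrow> 'g tvec) \<Rightarrow> ('q set, real^'m) chart \<Rightarrow>
     ('m + 'k \<Rightarrow> 'm + 'k \<Rightarrow> 'm + 'k \<Rightarrow> 'q \<Rightarrow> real) \<Rightarrow> 'm \<Rightarrow> 'm \<Rightarrow> 'm \<Rightarrow> 'q set \<Rightarrow> real" where
  "GR S \<xi> c R a b d =
     on_quotient (\<lambda>q. \<Sum>k\<in>UNIV. Gai S \<xi> c a k q * R (Inr k) (Inl b) (Inl d) q)"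

section \<open>Differential forms on open subsets of Euclidean spaces\<close>

text \<open>A \<open>k\<close>-covector takes its arguments as a sequence of which only the first \<open>k\<close> entries matter.\<close>
type_synonym 'e covec = "(nat \<Rightarrow> 'e) \<Rightarrow> real"

definition alternating_form :: "nat \<Rightarrow> 'e::real_vector covec \<Rightarrow> bool" where
  "alternating_form k \<alpha> \<longleftrightarrow>
     (\<forall>v w. (\<forall>i<k. v i = w i) \<longrightarrow> \<alpha> v = \<alpha> w) \<and>
     (\<forall>v. \<forall>i<k. linear (\<lambda>u. \<alpha> (v(i := u)))) \<and>
     (\<forall>v. \<forall>i<k. \<forall>j<k. i \<noteq> j \<longrightarrow> v i = v j \<longrightarrow> \<alpha> v = 0)"

definition wedge :: "nat \<Rightarrow> nat \<Rightarrow> 'e covec \<Rightarrow> 'e covec \<Rightarrow> 'e covec" where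
  "wedge k l \<alpha> \<beta> = (\<lambda>v. (\<Sum>\<sigma> | \<sigma> permutes {..<k + l}.
     of_int (sign \<sigma>) * \<alpha> (\<lambda>i. v (\<sigma> i)) * \<beta> (\<lambda>i. v (\<sigma> (k + i)))) / (fact k * fact l))"

text \<open>Exterior powers of a \<open>2\<close>-covector.\<close>
primrec wedge_power :: "'e covec \<Rightarrow> nat \<Rightarrow> 'e covec" where
  "wedge_power \<omega> 0 = (\<lambda>v. 1)"
| "wedge_power \<omega> (Suc j) = wedge 2 (2 * j) \<omega> (wedge_power \<omega> j)"

definition ext_deriv :: "nat \<Rightarrow> ('e::euclidean_space \<Rightarrow> 'e covec) \<Rightarrow> 'e \<Rightarrow> 'e covec" where
  "ext_deriv k \<alpha> y v = (\<Sum>i\<le>k. (-1) ^ i *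
     frechet_derivative (\<lambda>z. \<alpha> z (\<lambda>j. if j < i then v j else v (Suc j))) (at y) (v i))"

definition interior_prod :: "('e \<Rightarrow> 'e) \<Rightarrow> ('e \<Rightarrow> 'e covec) \<Rightarrow> 'e \<Rightarrow> 'e covec" where
  "interior_prod X \<alpha> y v = \<alpha> y (case_nat (X y) v)"

text \<open>For constant vector fields \<open>v\<^sub>i\<close> one has \<open>[X, v\<^sub>i] = - DX v\<^sub>i\<close>.\<close>
definition lie_deriv :: "nat \<Rightarrow> ('e::euclidean_space \<Rightarrow> 'e) \<Rightarrow> ('e \<Rightarrow> 'e covec) \<Rightarrow> 'e \<Rightarrow> 'e covec" where
  "lie_deriv k X \<alpha> y v = frechet_derivative (\<lambda>z. \<alpha> z v) (at y) (X y) +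
     (\<Sum>i<k. \<alpha> y (v(i := frechet_derivative X (at y) (v i))))"

section \<open>Forms and vector fields on the tangent bundle\<close>

text \<open>Forms and vector fields on \<open>TM\<close> are given by their representatives in the natural coordinates
  of the charts of \<open>M\<close>, subject to the transformation laws.\<close>

definition tdom :: "('a, 'e) chart \<Rightarrow> ('e \<times> 'e) set" where
  "tdom c = (snd c ` fst c) \<times> UNIV"

definition base :: "('a, 'e) chart \<Rightarrow> 'e \<times> 'e \<Rightarrow> 'a" where
  "base c y = inv_into (fst c) (snd c) (fst y)"

definition toverlap :: "('a, 'e) chart \<Rightarrow> ('a, 'e) chart \<Rightarrow> ('e \<times> 'e) set" where
  "toverlap c d = (snd c ` (fst c \<inter> fst d)) \<times> UNIV"

definition ttrans :: "('a, 'e::euclidean_space) chart \<Rightarrow> ('a, 'e) chart \<Rightarrow> 'e \<times> 'e \<Rightarrow> 'e \<times> 'e" where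
  "ttrans c d = (\<lambda>(x, u). ((snd d \<circ> inv_into (fst c) (snd c)) x,
     frechet_derivative (snd d \<circ> inv_into (fst c) (snd c)) (at x) u))"

definition tb_form ::
  "('a, 'e::euclidean_space) mfd \<Rightarrow> nat \<Rightarrow> (('a, 'e) chart \<Rightarrow> 'e \<times> 'e \<Rightarrow> ('e \<times> 'e) covec) \<Rightarrow> bool" where
  "tb_form M k \<mu> \<longleftrightarrow>
     (\<forall>c\<in>atlas M. (\<forall>y\<in>tdom c. alternating_form k (\<mu> c y)) \<and>
        (\<forall>v. smooth_on (tdom c) (\<lambda>y. \<mu> c y v))) \<and>
     (\<forall>c\<in>atlas M. \<forall>d\<in>atlas M. \<forall>y\<in>toverlap c d. \<forall>v.
        \<mu> c y v = \<mu> d (ttrans c d y) (\<lambda>i. frechet_derivative (ttrans c d) (at y) (v i)))"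

definition tb_vector_field ::
  "('a, 'e::euclidean_space) mfd \<Rightarrow> (('a, 'e) chart \<Rightarrow> 'e \<times> 'e \<Rightarrow> 'e \<times> 'e) \<Rightarrow> bool" where
  "tb_vector_field M X \<longleftrightarrow>
     (\<forall>c\<in>atlas M. smooth_on (tdom c) (X c)) \<and>
     (\<forall>c\<in>atlas M. \<forall>d\<in>atlas M. \<forall>y\<in>toverlap c d.
        X d (ttrans c d y) = frechet_derivative (ttrans c d) (at y) (X c y))"

definition invariant_volume_form ::
  "('a, 'e::euclidean_space) mfd \<Rightarrow> (('a, 'e) chart \<Rightarrow> 'e \<times> 'e \<Rightarrow> 'e \<times> 'e) \<Rightarrow>
     (('a, 'e) chart \<Rightarrow> 'e \<times> 'e \<Rightarrow> ('e \<times> 'e) covec) \<Rightarrow> bool" where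
  "invariant_volume_form M X \<mu> \<longleftrightarrow>
     tb_form M (2 * DIM('e)) \<mu> \<and>
     (\<forall>c\<in>atlas M. \<forall>y\<in>tdom c. \<exists>v. \<mu> c y v \<noteq> 0) \<and>
     (\<forall>c\<in>atlas M. \<forall>y\<in>tdom c. \<forall>v. lie_deriv (2 * DIM('e)) (X c) (\<mu> c) y v = 0)"

section \<open>The reduced system\<close>

definition dq :: "'m \<Rightarrow> ((real^'m::finite) \<times> (real^'m)) covec" where
  "dq a = (\<lambda>v. fst (v 0) $ a)"

definition energy_l ::
  "('q, 'g, 'n::finite, 'k::finite, 'm::finite) chaplygin \<Rightarrow> ('q set, real^'m) chart \<Rightarrow>
     (real^'m) \<times> (real^'m) \<Rightarrow> real" where
  "energy_l S c y = (\<Sum>a\<in>UNIV. \<Sum>b\<in>UNIV. gred S c a b (base c y) * snd y $ a * snd y $ b) / 2"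

definition theta_l ::
  "('q, 'g, 'n::finite, 'k::finite, 'm::finite) chaplygin \<Rightarrow> ('q set, real^'m) chart \<Rightarrow>
     (real^'m) \<times> (real^'m) \<Rightarrow> ((real^'m) \<times> (real^'m)) covec" where
  "theta_l S c y v = (\<Sum>a\<in>UNIV. \<Sum>b\<in>UNIV. gred S c a b (base c y) * snd y $ a * dq b v)"

definition omega_l ::
  "('q, 'g, 'n::finite, 'k::finite, 'm::finite) chaplygin \<Rightarrow> ('q set, real^'m) chart \<Rightarrow>
     (real^'m) \<times> (real^'m) \<Rightarrow> ((real^'m) \<times> (real^'m)) covec" where
  "omega_l S c y v = - ext_deriv 1 (theta_l S c) y v"

definition alpha_red ::
  "('q, 'g, 'n::finite, 'k::finite, 'm::finite) chaplygin \<Rightarrow> ('k \<Rightarrow> 'g tvec) \<Rightarrow> ('q set, real^'m) chart \<Rightarrow>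
     ('m + 'k \<Rightarrow> 'm + 'k \<Rightarrow> 'm + 'k \<Rightarrow> 'q \<Rightarrow> real) \<Rightarrow>
     (real^'m) \<times> (real^'m) \<Rightarrow> ((real^'m) \<times> (real^'m)) covec" where
  "alpha_red S \<xi> c R y v = - (\<Sum>a\<in>UNIV. \<Sum>b\<in>UNIV. \<Sum>d\<in>UNIV.
     GR S \<xi> c R a b d (base c y) * snd y $ a * snd y $ b * dq d v)"

definition gammaG ::
  "('q, 'g, 'n::finite, 'k::finite, 'm::finite) chaplygin \<Rightarrow> ('k \<Rightarrow> 'g tvec) \<Rightarrow> ('q set, real^'m) chart \<Rightarrow>
     ('m + 'k \<Rightarrow> 'm + 'k \<Rightarrow> 'm + 'k \<Rightarrow> 'q \<Rightarrow> real) \<Rightarrow>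
     (real^'m) \<times> (real^'m) \<Rightarrow> ((real^'m) \<times> (real^'m)) covec" where
  "gammaG S \<xi> c R y v = (\<Sum>a\<in>UNIV. \<Sum>b\<in>UNIV. \<Sum>d\<in>UNIV.
     (- GR S \<xi> c R b a d (base c y) + GR S \<xi> c R d a b (base c y) - 2 * GR S \<xi> c R a b d (base c y))
       * snd y $ a * wedge 1 1 (dq b) (dq d) v) / 6"

definition reduced_vector_field ::
  "('q, 'g, 'n::finite, 'k::finite, 'm::finite) chaplygin \<Rightarrow> ('k \<Rightarrow> 'g tvec) \<Rightarrow>
     (('q set, real^'m) chart \<Rightarrow> 'm + 'k \<Rightarrow> 'm + 'k \<Rightarrow> 'm + 'k \<Rightarrow> 'q \<Rightarrow> real) \<Rightarrow>
     (('q set, real^'m) chart \<Rightarrow> (real^'m) \<times> (real^'m) \<Rightarrow> (real^'m) \<times> (real^'m)) \<Rightarrow> bool" where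
  "reduced_vector_field S \<xi> R \<Gamma> \<longleftrightarrow>
     tb_vector_field (Bman S) \<Gamma> \<and>
     (\<forall>c\<in>atlas (Bman S). \<forall>y\<in>tdom c. fst (\<Gamma> c y) = snd y \<and>
        (\<forall>v. interior_prod (\<Gamma> c) (omega_l S c) y v
           = ext_deriv 0 (\<lambda>z _. energy_l S c z) y v + alpha_red S \<xi> c (R c) y v))"

definition condA' ::
  "('q, 'g, 'n::finite, 'k::finite, 'm::finite) chaplygin \<Rightarrow> ('k \<Rightarrow> 'g tvec) \<Rightarrow> ('q set, real^'m) chart \<Rightarrow>
     ('m + 'k \<Rightarrow> 'm + 'k \<Rightarrow> 'm + 'k \<Rightarrow> 'q \<Rightarrow> real) \<Rightarrow> ('q set \<Rightarrow> real) \<Rightarrow> bool" where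
  "condA' S \<xi> c R f \<longleftrightarrow> (\<forall>x\<in>fst c. \<forall>a b d.
     GR S \<xi> c R b a d x + GR S \<xi> c R a b d x
       + gred S c b d x * coord_field (Bman S) c a x f
       + gred S c a d x * coord_field (Bman S) c b x f
       - 2 * gred S c a b x * coord_field (Bman S) c d x f = 0)"

end

theory Submission
  imports Defs
begin

text \<open>In natural coordinates \<open>(q, u)\<close> both \<open>\<omega>\<^sub>l\<close> and \<open>\<omega>\<^sub>l - \<gamma>\<^sup>G\<close> are pullbacks of the standard symplectic form
  \<open>\<omega>\<^sub>0\<close> along linear maps \<open>(h, k) \<mapsto> (h, g k + B h)\<close> with the same \<open>g\<close>, because \<open>\<gamma>\<^sup>G\<close> is semi-basic. Such a map has
  determinant \<open>det g\<close>, so both top powers equal \<open>det g\<close> times \<open>\<omega>\<^sub>0\<^sup>m\<close>. Invariance then says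
  \<open>\<Gamma>(ln \<rho>) + div \<Gamma> = 0\<close> for \<open>\<rho> = e\<^bsup>(m-1)f\<^esup> det g\<close>. By the equation of motion the divergence is
  \<open>- tr (g\<^sup>-\<^sup>1 dg(u))\<close> plus the contraction \<open>g\<^sup>a\<^sup>d (GR\<^sub>b\<^sub>a\<^sub>d + GR\<^sub>a\<^sub>b\<^sub>d) u\<^sup>b\<close>, which \<open>(A')\<^sup>G\<close> evaluates to
  \<open>(1 - m) df(u)\<close>; the first term cancels \<open>\<Gamma>(ln det g)\<close> by Jacobi's formula. Under a change of chart both
  \<open>det g\<close> and the Jacobian on the tangent bundle acquire the square of the Jacobian determinant on the
  base, so the local expressions glue.\<close>

section \<open>Smooth functions on open sets\<close>

text \<open>Two obstacles shape the proof. The metric on Q/G is known only through an arbitrary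
  representative of each orbit and through lifts given by \<open>THE\<close>, so its symmetry,
  positivity, tensor law and smoothness have to be secured before any calculus on the tangent bundle
  starts. Invariance makes the representative immaterial, and a local section of the bundle
  transports smoothness from Q to Q/G. Secondly, exterior powers are sums over permutations.
  Determinants and traces are never extracted from these sums: an alternating form of top degree is
  fixed by its value on one basis, so each such identity is checked there. The sum itself is needed
  to see that \<open>omega0\<close> has a nonzero top power, and this is done by a sign argument: on
  a symplectic basis no permutation contributes a negative term. The exponent \<open>m - 1\<close>
  comes from contracting \<open>condA'\<close> with the inverse metric: the metric terms contribute
  the differential of \<open>f\<close> with weights -1, -m and 2, so the divergence carries the
  factor \<open>1 - m\<close>, which the exponential compensates.\<close>

lemma Ck_on_lower: "Ck_on (Suc k) S f \<Longrightarrow> Ck_on k S f"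
proof (induction k arbitrary: f)
  case 0
  then show ?case
    by (auto intro!: continuous_at_imp_continuous_on differentiable_imp_continuous_within)
next
  case (Suc k)
  show ?case
    unfolding Ck_on.simps(2)[of k]
    using Suc.prems Suc.IH by (auto simp del: Ck_on.simps simp add: Ck_on.simps(2))
qed

lemma Ck_on_subset: "Ck_on k S f \<Longrightarrow> T \<subseteq> S \<Longrightarrow> Ck_on k T f"
  by (induction k arbitrary: f) (auto intro: continuous_on_subset)

text \<open>\<open>frechet_derivative\<close> is a choice among the derivatives of a function, and
  functions that agree near \<open>x\<close> have the same derivatives there; the equality therefore
  also covers functions that are not differentiable at \<open>x\<close>.\<close>

lemma frechet_derivative_cong_open:
  assumes "open S" "x \<in> S" "\<And>y. y \<in> S \<Longrightarrow> f y = g y"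
  shows "frechet_derivative f (at x) = frechet_derivative g (at x)"
proof -
  have "(f has_derivative D) (at x) \<longleftrightarrow> (g has_derivative D) (at x)" for D
    using assms by (auto intro: has_derivative_transform_within_open[of _ _ x UNIV S])
  then show ?thesis
    unfolding frechet_derivative_def by simp
qed

text \<open>Differentiation rules yield formulas valid only at points of \<open>S\<close>. This
  lemma carries regularity from such a formula to \<open>frechet_derivative\<close> in the
  inductions below.\<close>

lemma Ck_on_cong:
  assumes "open S" "\<And>x. x \<in> S \<Longrightarrow> f x = g x" "Ck_on k S f"
  shows "Ck_on k S g"
  using assms(2,3)
proof (induction k arbitrary: f g)
  case 0
  then show ?case by (simp cong: continuous_on_cong)
next
  case (Suc k)
  have "g differentiable (at x)" if "x \<in> S" for x
    using Suc.prems that assms(1) 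
    unfolding Ck_on.simps(2) differentiable_def
    by (metis has_derivative_transform_within_open)
  moreover have "Ck_on k S (\<lambda>x. frechet_derivative g (at x) v)" for v
    using Suc.IH[of "\<lambda>x. frechet_derivative f (at x) v" "\<lambda>x. frechet_derivative g (at x) v"]
      Suc.prems frechet_derivative_cong_open[OF assms(1), of _ f g] by simp
  ultimately show ?case by simp
qed

lemma Ck_on_local:
  assumes "\<And>x. x \<in> S \<Longrightarrow> \<exists>T. open T \<and> x \<in> T \<and> Ck_on k T f"
  shows "Ck_on k S f"
  using assms
proof (induction k arbitrary: f)
  case 0
  then show ?case
    unfolding Ck_on.simps(1)
    by (intro continuous_at_imp_continuous_on ballI) (metis continuous_on_eq_continuous_at)
next
  case (Suc k)
  have "f differentiable (at x)" if "x \<in> S" for x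
    using Suc.prems[OF that] by auto
  moreover have "Ck_on k S (\<lambda>x. frechet_derivative f (at x) v)" for v
    by (rule Suc.IH) (metis Ck_on.simps(2) Suc.prems)
  ultimately show ?case by simp
qed

lemma Ck_on_linear:
  assumes "bounded_linear L" "open S" "Ck_on k S f"
  shows "Ck_on k S (\<lambda>x. L (f x))"
  using assms(3)
proof (induction k arbitrary: f)
  case 0
  then show ?case using assms(1)
    by (simp add: bounded_linear.continuous_on)
next
  case (Suc k)
  have d: "((\<lambda>x. L (f x)) has_derivative (\<lambda>v. L (frechet_derivative f (at x) v))) (at x)"
    if "x \<in> S" for x
    using Suc.prems that frechet_derivative_works bounded_linear.has_derivative[OF assms(1)]
    by fastforce
  have "Ck_on k S (\<lambda>x. L (frechet_derivative f (at x) v))" for v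
    using Suc by simp
  then have "Ck_on k S (\<lambda>x. frechet_derivative (\<lambda>x. L (f x)) (at x) v)" for v
    by (rule Ck_on_cong[OF assms(2), rotated]) (simp add: frechet_derivative_at[OF d, symmetric])
  then show ?case
    using d by (auto simp: differentiable_def)
qed

lemma Ck_on_const: "Ck_on k S (\<lambda>x. c)"
  by (induction k arbitrary: c) (auto simp: frechet_derivative_const)

lemma Ck_on_id: "Ck_on k S (\<lambda>x. x)"
  by (cases k) (auto intro: Ck_on_const simp: frechet_derivative_ident)

lemma Ck_on_add:
  assumes "open S" "Ck_on k S f" "Ck_on k S g"
  shows "Ck_on k S (\<lambda>x. f x + g x)"
  using assms(2,3)
proof (induction k arbitrary: f g)
  case 0
  then show ?case by (simp add: continuous_on_add)
next
  case (Suc k)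
  have d: "((\<lambda>x. f x + g x) has_derivative
      (\<lambda>v. frechet_derivative f (at x) v + frechet_derivative g (at x) v)) (at x)"
    if "x \<in> S" for x
    using Suc.prems that by (intro has_derivative_add) (auto simp: frechet_derivative_works[symmetric])
  have "Ck_on k S (\<lambda>x. frechet_derivative f (at x) v + frechet_derivative g (at x) v)" for v
    using Suc by simp
  then have "Ck_on k S (\<lambda>x. frechet_derivative (\<lambda>x. f x + g x) (at x) v)" for v
    by (rule Ck_on_cong[OF assms(1), rotated]) (simp add: frechet_derivative_at[OF d, symmetric])
  then show ?case
    using d by (auto simp: differentiable_def)
qed

lemma Ck_on_scaleR:
  fixes f :: "'a::euclidean_space \<Rightarrow> real" and g :: "'a \<Rightarrow> 'b::real_normed_vector"
  assumes "open S" "Ck_on k S f" "Ck_on k S g"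
  shows "Ck_on k S (\<lambda>x. f x *\<^sub>R g x)"
  using assms(2,3)
proof (induction k arbitrary: f g)
  case 0
  then show ?case by (simp add: continuous_on_scaleR)
next
  case (Suc k)
  have d: "((\<lambda>x. f x *\<^sub>R g x) has_derivative
      (\<lambda>v. f x *\<^sub>R frechet_derivative g (at x) v + frechet_derivative f (at x) v *\<^sub>R g x)) (at x)"
    if "x \<in> S" for x
    using Suc.prems that by (intro has_derivative_scaleR) (auto simp: frechet_derivative_works[symmetric])
  have "Ck_on k S (\<lambda>x. f x *\<^sub>R frechet_derivative g (at x) v + frechet_derivative f (at x) v *\<^sub>R g x)" for v
    using Suc Ck_on_lower[OF Suc.prems(1)] Ck_on_lower[OF Suc.prems(2)]
    by (intro Ck_on_add assms(1)) simp_all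
  then have "Ck_on k S (\<lambda>x. frechet_derivative (\<lambda>x. f x *\<^sub>R g x) (at x) v)" for v
    by (rule Ck_on_cong[OF assms(1), rotated]) (simp add: frechet_derivative_at[OF d, symmetric])
  then show ?case
    using d by (auto simp: differentiable_def)
qed

lemma Ck_on_sum:
  assumes "open S" "\<And>i. i \<in> I \<Longrightarrow> Ck_on k S (f i)"
  shows "Ck_on k S (\<lambda>x. \<Sum>i\<in>I. f i x)"
  using assms(2)
  by (induction I rule: infinite_finite_induct) (auto intro: Ck_on_const Ck_on_add[OF assms(1)])

lemma Ck_on_compose:
  fixes f :: "'a::euclidean_space \<Rightarrow> 'b::euclidean_space" and g :: "'b \<Rightarrow> 'c::real_normed_vector"
  assumes "open S" "open T" "f ` S \<subseteq> T" "Ck_on k S f" "Ck_on k T g"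
  shows "Ck_on k S (\<lambda>x. g (f x))"
  using assms(4,5)
proof (induction k arbitrary: g)
  case 0
  then show ?case using assms(3)
    by (auto intro: continuous_on_compose2)
next
  case (Suc k)
  \<comment> \<open>The derivative of \<open>g\<close> at \<open>f x\<close> acts on a vector that
    itself varies with \<open>x\<close>. Expanding that vector in \<open>Basis\<close> leaves scalar
    functions times partial derivatives of \<open>g\<close> composed with \<open>f\<close>, and
    these fit the induction hypothesis.\<close>
  let ?D = "\<lambda>x v. \<Sum>b\<in>Basis. (frechet_derivative f (at x) v \<bullet> b) *\<^sub>R frechet_derivative g (at (f x)) b"
  have d: "((\<lambda>x. g (f x)) has_derivative ?D x) (at x)" if "x \<in> S" for x
  proof -
    have g: "(g has_derivative frechet_derivative g (at (f x))) (at (f x))"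
      using Suc.prems that assms(3) by (auto simp: frechet_derivative_works[symmetric])
    have f: "(f has_derivative frechet_derivative f (at x)) (at x)"
      using Suc.prems that by (auto simp: frechet_derivative_works[symmetric])
    have *: "frechet_derivative g (at (f x)) w = (\<Sum>b\<in>Basis. (w \<bullet> b) *\<^sub>R frechet_derivative g (at (f x)) b)" for w
    proof -
      interpret linear "frechet_derivative g (at (f x))"
        by (rule has_derivative_linear[OF g])
      have "frechet_derivative g (at (f x)) (\<Sum>b\<in>Basis. (w \<bullet> b) *\<^sub>R b) =
          (\<Sum>b\<in>Basis. (w \<bullet> b) *\<^sub>R frechet_derivative g (at (f x)) b)"
        by (simp only: sum scale)
      then show ?thesis by (simp only: euclidean_representation)
    qed
    have eq: "?D x = (\<lambda>v. frechet_derivative g (at (f x)) (frechet_derivative f (at x) v))"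
      by (rule ext) (rule *[symmetric])
    show ?thesis
      unfolding eq by (rule has_derivative_compose[OF f g])
  qed
  have "Ck_on k S (\<lambda>x. ?D x v)" for v
  proof (rule Ck_on_sum[OF assms(1)], rule Ck_on_scaleR[OF assms(1)])
    fix b :: 'b
    show "Ck_on k S (\<lambda>x. frechet_derivative f (at x) v \<bullet> b)"
      by (rule Ck_on_linear[OF bounded_linear_inner_left assms(1)]) (use Suc.prems(1) in simp)
    show "Ck_on k S (\<lambda>x. frechet_derivative g (at (f x)) b)"
      by (rule Suc.IH[OF Ck_on_lower[OF Suc.prems(1)]]) (use Suc.prems(2) in simp)
  qed
  then have "Ck_on k S (\<lambda>x. frechet_derivative (\<lambda>x. g (f x)) (at x) v)" for v
    by (rule Ck_on_cong[OF assms(1), rotated]) (simp add: frechet_derivative_at[OF d, symmetric])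
  then show ?case
    using d by (auto simp: differentiable_def)
qed

lemma smooth_on_subset: "smooth_on S f \<Longrightarrow> T \<subseteq> S \<Longrightarrow> smooth_on T f"
  unfolding smooth_on_def by (auto intro: Ck_on_subset)

lemma smooth_on_cong: "open S \<Longrightarrow> (\<And>x. x \<in> S \<Longrightarrow> f x = g x) \<Longrightarrow> smooth_on S f \<Longrightarrow> smooth_on S g"
  unfolding smooth_on_def using Ck_on_cong by blast

lemma smooth_on_local: "(\<And>x. x \<in> S \<Longrightarrow> \<exists>T. open T \<and> x \<in> T \<and> smooth_on T f) \<Longrightarrow> smooth_on S f"
proof -
  assume *: "\<And>x. x \<in> S \<Longrightarrow> \<exists>T. open T \<and> x \<in> T \<and> smooth_on T f"
  have "Ck_on k S f" for k
    by (rule Ck_on_local) (use * in \<open>auto simp: smooth_on_def\<close>)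
  then show ?thesis by (simp add: smooth_on_def)
qed

lemma smooth_on_linear: "bounded_linear L \<Longrightarrow> open S \<Longrightarrow> smooth_on S f \<Longrightarrow> smooth_on S (\<lambda>x. L (f x))"
  unfolding smooth_on_def by (auto intro: Ck_on_linear)

lemma smooth_on_const: "smooth_on S (\<lambda>x. c)"
  unfolding smooth_on_def by (auto intro: Ck_on_const)

lemma smooth_on_id: "smooth_on S (\<lambda>x. x)"
  unfolding smooth_on_def by (auto intro: Ck_on_id)

lemma smooth_on_add:
  "open S \<Longrightarrow> smooth_on S f \<Longrightarrow> smooth_on S g \<Longrightarrow> smooth_on S (\<lambda>x. f x + g x)"
  unfolding smooth_on_def by (auto intro: Ck_on_add)

lemma smooth_on_scaleR:
  "open S \<Longrightarrow> smooth_on S f \<Longrightarrow> smooth_on S g \<Longrightarrow> smooth_on S (\<lambda>x. f x *\<^sub>R g x)"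
  unfolding smooth_on_def by (auto intro: Ck_on_scaleR)

lemma smooth_on_mult:
  fixes f g :: "'a::euclidean_space \<Rightarrow> real"
  shows "open S \<Longrightarrow> smooth_on S f \<Longrightarrow> smooth_on S g \<Longrightarrow> smooth_on S (\<lambda>x. f x * g x)"
  using smooth_on_scaleR[of S f g] by simp

lemma smooth_on_sum:
  "open S \<Longrightarrow> (\<And>i. i \<in> I \<Longrightarrow> smooth_on S (f i)) \<Longrightarrow> smooth_on S (\<lambda>x. \<Sum>i\<in>I. f i x)"
  unfolding smooth_on_def by (auto intro: Ck_on_sum)

lemma smooth_on_prod:
  fixes f :: "'i \<Rightarrow> 'a::euclidean_space \<Rightarrow> real"
  assumes "open S" "\<And>i. i \<in> I \<Longrightarrow> smooth_on S (f i)"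
  shows "smooth_on S (\<lambda>x. \<Prod>i\<in>I. f i x)"
  using assms(2)
  by (induction I rule: infinite_finite_induct) (auto intro: smooth_on_const smooth_on_mult[OF assms(1)])

lemma smooth_on_compose:
  "open S \<Longrightarrow> open T \<Longrightarrow> f ` S \<subseteq> T \<Longrightarrow> smooth_on S f \<Longrightarrow> smooth_on T g \<Longrightarrow>
    smooth_on S (\<lambda>x. g (f x))"
  unfolding smooth_on_def by (auto intro: Ck_on_compose)

lemma smooth_on_differentiable: "smooth_on S f \<Longrightarrow> x \<in> S \<Longrightarrow> f differentiable (at x)"
  unfolding smooth_on_def using Ck_on.simps(2) by blast

lemma smooth_on_has_derivative:
  "smooth_on S f \<Longrightarrow> x \<in> S \<Longrightarrow> (f has_derivative frechet_derivative f (at x)) (at x)"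
  using smooth_on_differentiable frechet_derivative_works by blast

lemma smooth_on_frechet_derivative:
  "smooth_on S f \<Longrightarrow> smooth_on S (\<lambda>x. frechet_derivative f (at x) v)"
  unfolding smooth_on_def using Ck_on.simps(2) by blast

lemma smooth_on_exp: "smooth_on UNIV (exp :: real \<Rightarrow> real)"
proof -
  have "Ck_on k UNIV (exp :: real \<Rightarrow> real)" for k
  proof (induction k)
    case 0
    then show ?case by (simp add: continuous_on_exp)
  next
    case (Suc k)
    have d: "((exp :: real \<Rightarrow> real) has_derivative (\<lambda>v. exp x *\<^sub>R v)) (at x)" for x
      using DERIV_exp[of x] by (simp add: has_field_derivative_def)
    have "Ck_on k UNIV (\<lambda>x. exp x *\<^sub>R v)" for v :: real
      by (intro Ck_on_scaleR Suc Ck_on_const) simp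
    moreover have "(\<lambda>x. frechet_derivative (exp :: real \<Rightarrow> real) (at x) v) = (\<lambda>x. exp x *\<^sub>R v)" for v
      unfolding frechet_derivative_at[OF d, symmetric] ..
    moreover have "exp differentiable (at x)" for x :: real
      using d unfolding differentiable_def by blast
    ultimately show ?case
      unfolding Ck_on.simps(2) by simp
  qed
  then show ?thesis unfolding smooth_on_def by blast
qed

text \<open>The derivative is minus the square of the function, so closure of \<open>Ck_on\<close>
  under products lifts each order of differentiability to the next.\<close>

lemma smooth_on_inverse: "smooth_on (- {0}) (inverse :: real \<Rightarrow> real)"
proof -
  have "Ck_on k (- {0}) (inverse :: real \<Rightarrow> real)" for k
  proof (induction k)
    case 0
    have "continuous_on (- {0}) (\<lambda>x::real. inverse x)"
      by (intro continuous_on_inverse continuous_on_id) auto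
    then show ?case unfolding Ck_on.simps .
  next
    case (Suc k)
    have d: "((inverse :: real \<Rightarrow> real) has_derivative (\<lambda>v. (inverse x *\<^sub>R inverse x) *\<^sub>R (- v))) (at x)"
      if "x \<in> - {0}" for x
    proof -
      have "(\<lambda>v. - (inverse x * v * inverse x)) = (\<lambda>v. (inverse x *\<^sub>R inverse x) *\<^sub>R (- v))"
        by (rule ext) (simp only: real_scaleR_def, algebra)
      then show ?thesis
        using has_derivative_inverse'[of x UNIV] that by (metis ComplD singletonI)
    qed
    have C: "Ck_on k (- {0}) (\<lambda>x :: real. (inverse x *\<^sub>R inverse x) *\<^sub>R (- v))" for v :: real
      by (rule Ck_on_scaleR[OF _ Ck_on_scaleR[OF _ Suc Suc] Ck_on_const]) (rule open_Compl[OF closed_singleton])+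
    have D: "frechet_derivative inverse (at x) v = (inverse x *\<^sub>R inverse x) *\<^sub>R (- v)"
      if "x \<in> - {0}" for x v :: real
      unfolding frechet_derivative_at[OF d[OF that], symmetric] ..
    have "Ck_on k (- {0}) (\<lambda>x. frechet_derivative inverse (at x) v)" for v :: real
      by (rule Ck_on_cong[OF open_Compl[OF closed_singleton] D[symmetric] C])
    then show ?case
      using d unfolding Ck_on.simps(2) differentiable_def by auto
  qed
  then show ?thesis by (simp add: smooth_on_def)
qed

lemma smooth_on_divide:
  fixes f g :: "'a::euclidean_space \<Rightarrow> real"
  assumes "open S" "smooth_on S f" "smooth_on S g" "\<And>x. x \<in> S \<Longrightarrow> g x \<noteq> 0"
  shows "smooth_on S (\<lambda>x. f x / g x)"
  unfolding divide_inverse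
  by (rule smooth_on_mult[OF assms(1,2)], rule smooth_on_compose[OF assms(1) _ _ assms(3) smooth_on_inverse])
    (use assms(4) in \<open>auto intro: open_Compl\<close>)

lemma smooth_on_det:
  fixes F :: "'a::euclidean_space \<Rightarrow> real^'n^'n::finite"
  assumes "open S" "\<And>i j. smooth_on S (\<lambda>x. F x $ i $ j)"
  shows "smooth_on S (\<lambda>x. det (F x))"
  unfolding det_def using assms
  by (intro smooth_on_sum smooth_on_mult smooth_on_const smooth_on_prod) auto

section \<open>Alternating forms\<close>

lemma alternating_form_cong: "alternating_form k \<alpha> \<Longrightarrow> (\<And>i. i < k \<Longrightarrow> v i = w i) \<Longrightarrow> \<alpha> v = \<alpha> w"
  unfolding alternating_form_def by simp

lemma alternating_form_linear: "alternating_form k \<alpha> \<Longrightarrow> i < k \<Longrightarrow> linear (\<lambda>u. \<alpha> (v(i := u)))"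
  unfolding alternating_form_def by simp

lemma alternating_form_eq_0:
  "alternating_form k \<alpha> \<Longrightarrow> i < k \<Longrightarrow> j < k \<Longrightarrow> i \<noteq> j \<Longrightarrow> v i = v j \<Longrightarrow> \<alpha> v = 0"
  unfolding alternating_form_def by simp

lemma alternating_formI:
  assumes "\<And>v w. \<forall>i<k. v i = w i \<Longrightarrow> \<alpha> v = \<alpha> w"
    and "\<And>v i. i < k \<Longrightarrow> linear (\<lambda>u. \<alpha> (v(i := u)))"
    and "\<And>v i j. i < k \<Longrightarrow> j < k \<Longrightarrow> i \<noteq> j \<Longrightarrow> v i = v j \<Longrightarrow> \<alpha> v = 0"
  shows "alternating_form k \<alpha>"
  unfolding alternating_form_def using assms by auto

text \<open>Polarization: the form vanishes when both slots hold \<open>x + y\<close>, and bilinear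
  expansion leaves only the two mixed terms.\<close>

lemma alternating_form_swap:
  assumes "alternating_form k \<alpha>" "i < k" "j < k" "i \<noteq> j"
  shows "\<alpha> (\<lambda>l. v (Transposition.transpose i j l)) = - \<alpha> v"
proof -
  define F where "F x y = \<alpha> (v(i := x, j := y))" for x y
  have F0: "F x x = 0" for x
    unfolding F_def using alternating_form_eq_0[OF assms, of "v(i := x, j := x)"] assms(4) by simp
  have l1: "linear (F x)" for x
    using alternating_form_linear[OF assms(1,3), of "v(i := x)"] by (simp add: F_def[abs_def])
  have l2: "linear (\<lambda>x. F x y)" for y
    using alternating_form_linear[OF assms(1,2), of "v(j := y)"] assms(4)
    by (simp add: F_def fun_upd_twist)
  have "F (x + y) (x + y) = F x x + F x y + F y x + F y y" for x y
    by (simp add: linear_add[OF l1] linear_add[OF l2])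
  then have "F (v j) (v i) = - F (v i) (v j)"
    by (simp add: F0 eq_neg_iff_add_eq_0)
  moreover have "(\<lambda>l. v (Transposition.transpose i j l)) = v(i := v j, j := v i)"
    by (auto simp: fun_eq_iff Transposition.transpose_def)
  ultimately show ?thesis
    by (simp add: F_def)
qed

text \<open>The offset \<open>c\<close> is made for the second factor of \<open>wedge\<close>, whose
  arguments begin further along the permuted sequence. The induction builds the permutation from
  transpositions.\<close>

lemma alternating_form_permute_shift:
  assumes "alternating_form k \<alpha>" "p permutes {c..<c + k}"
  shows "\<alpha> (\<lambda>i. v (p (c + i))) = of_int (sign p) * \<alpha> (\<lambda>i. v (c + i))"
  using assms(2) finite_atLeastLessThan
proof (induction p arbitrary: v rule: permutes_induct)
  case id
  then show ?case by simp
next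
  case (swap a b p)
  let ?T = "Transposition.transpose a b"
  have p: "permutation p"
    using swap by (auto simp: permutation_permutes)
  have "\<alpha> (\<lambda>i. v ((?T \<circ> p) (c + i))) = of_int (sign p) * \<alpha> (\<lambda>i. v (?T (c + i)))"
    using swap.IH[of "\<lambda>i. v (?T i)"] by simp
  also have "(\<lambda>i. v (?T (c + i))) = (\<lambda>i. v (c + Transposition.transpose (a - c) (b - c) i))"
    using swap by (auto simp: fun_eq_iff Transposition.transpose_def)
  also have "\<alpha> \<dots> = - \<alpha> (\<lambda>i. v (c + i))"
    by (rule alternating_form_swap[OF assms(1), of _ _ "\<lambda>i. v (c + i)"]) (use swap in auto)
  also have "of_int (sign p) * - \<alpha> (\<lambda>i. v (c + i)) = of_int (sign (?T \<circ> p)) * \<alpha> (\<lambda>i. v (c + i))"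
    using swap p by (simp add: sign_compose permutation_swap_id sign_swap_id)
  finally show ?case .
qed

lemma alternating_form_permute:
  assumes "alternating_form k \<alpha>" "p permutes {..<k}"
  shows "\<alpha> (\<lambda>i. v (p i)) = of_int (sign p) * \<alpha> v"
  using alternating_form_permute_shift[of k \<alpha> p 0 v] assms by (simp add: lessThan_atLeast0)

lemma alternating_form_diff_scale:
  assumes "alternating_form k \<alpha>" "alternating_form k \<beta>"
  shows "alternating_form k (\<lambda>v. \<alpha> v - c * \<beta> v)"
proof -
  have "linear (\<lambda>u. \<alpha> (v(i := u)) - c * \<beta> (v(i := u)))" if "i < k" for v i
    using alternating_form_linear[OF assms(1) that, of v] alternating_form_linear[OF assms(2) that, of v]
    by (intro linear_compose_sub) (auto simp: linear_iff algebra_simps)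
  note L = this
  have C: "\<alpha> v - c * \<beta> v = \<alpha> w - c * \<beta> w" if "\<forall>i<k. v i = w i" for v w
    using that alternating_form_cong[OF assms(1), of v w] alternating_form_cong[OF assms(2), of v w] by simp
  have Z: "\<alpha> v - c * \<beta> v = 0" if "i < k" "j < k" "i \<noteq> j" "v i = v j" for v i j
    using alternating_form_eq_0[OF assms(1) that] alternating_form_eq_0[OF assms(2) that] by simp
  show ?thesis
    by (rule alternating_formI[OF C L Z])
qed

lemma alternating_form_pullback:
  assumes "alternating_form k \<alpha>" "linear A"
  shows "alternating_form k (\<lambda>v. \<alpha> (\<lambda>i. A (v i)))"
proof -
  have L: "linear (\<lambda>u. \<alpha> (\<lambda>l. A ((v(i := u)) l)))" if "i < k" for v i
  proof -
    have "(\<lambda>l. A ((v(i := u)) l)) = (\<lambda>l. A (v l))(i := A u)" for u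
      by auto
    then show ?thesis
      using linear_compose[OF assms(2) alternating_form_linear[OF assms(1) that, of "\<lambda>l. A (v l)"]]
      by (simp add: o_def)
  qed
  have C: "\<alpha> (\<lambda>l. A (v l)) = \<alpha> (\<lambda>l. A (w l))" if "\<forall>i<k. v i = w i" for v w
    by (rule alternating_form_cong[OF assms(1)]) (use that in simp)
  have Z: "\<alpha> (\<lambda>l. A (v l)) = 0" if "i < k" "j < k" "i \<noteq> j" "v i = v j" for v i j
    by (rule alternating_form_eq_0[OF assms(1) that(1-3)]) (use that in simp)
  show ?thesis
    by (rule alternating_formI[OF C L Z])
qed

lemma alternating_form_wedge:
  assumes \<alpha>: "alternating_form k \<alpha>" and \<beta>: "alternating_form l \<beta>"
  shows "alternating_form (k + l) (wedge k l \<alpha> \<beta>)"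
proof -
  define P where "P = {\<sigma>. \<sigma> permutes {..<k + l}}"
  define F where "F \<sigma> v = \<alpha> (\<lambda>i. v (\<sigma> i)) * \<beta> (\<lambda>i. v (\<sigma> (k + i)))" for \<sigma> and v :: "nat \<Rightarrow> 'a"
  have w: "wedge k l \<alpha> \<beta> v = (\<Sum>\<sigma>\<in>P. of_int (sign \<sigma>) * F \<sigma> v) / (fact k * fact l)" for v
    unfolding wedge_def P_def F_def by (simp add: mult.assoc)
  have lt: "\<sigma> i < k + l \<longleftrightarrow> i < k + l" if "\<sigma> \<in> P" for \<sigma> i
    using permutes_in_image[of \<sigma> "{..<k+l}" i] that by (simp add: P_def)
  have C: "wedge k l \<alpha> \<beta> v = wedge k l \<alpha> \<beta> w" if "\<forall>i<k + l. v i = w i" for v w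
  proof -
    have "F \<sigma> v = F \<sigma> w" if "\<sigma> \<in> P" for \<sigma>
      unfolding F_def
      by (intro arg_cong2[where f = "(*)"] alternating_form_cong[OF \<alpha>] alternating_form_cong[OF \<beta>])
        (use lt[OF that] \<open>\<forall>i<k + l. v i = w i\<close> in auto)
    then show ?thesis unfolding w by simp
  qed
  have L: "linear (\<lambda>u. wedge k l \<alpha> \<beta> (v(j := u)))" if j: "j < k + l" for v j
  proof -
    have "linear (\<lambda>u. F \<sigma> (v(j := u)))" if s: "\<sigma> \<in> P" for \<sigma>
    proof -
      have inj: "inj \<sigma>" using s by (simp add: P_def permutes_inj)
      \<comment> \<open>Each summand uses argument \<open>j\<close> exactly once, at the position
        \<open>i\<close> that \<open>\<sigma>\<close> sends to \<open>j\<close>; linearity is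
        inherited from the factor containing that position.\<close>
      obtain i where i: "\<sigma> i = j" "i < k + l"
        using s j lt[OF s] by (metis P_def mem_Collect_eq permutes_surj surjD)
      show ?thesis
      proof (cases "i < k")
        case True
        have 1: "(\<lambda>n. (v(j := u)) (\<sigma> n)) = (\<lambda>n. v (\<sigma> n))(i := u)" for u
          using i inj by (auto simp: fun_eq_iff inj_eq)
        have "k + n \<noteq> i" for n using True by simp
        then have "\<sigma> (k + n) \<noteq> j" for n
          using i inj by (metis injD)
        then have 2: "(\<lambda>n. (v(j := u)) (\<sigma> (k + n))) = (\<lambda>n. v (\<sigma> (k + n)))" for u
          by (auto simp: fun_eq_iff)
        show ?thesis
          unfolding F_def 1 2
          using alternating_form_linear[OF \<alpha> True, of "\<lambda>n. v (\<sigma> n)"]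
          by (auto simp: linear_iff algebra_simps)
      next
        case False
        have 1: "(\<lambda>n. (v(j := u)) (\<sigma> (k + n))) = (\<lambda>n. v (\<sigma> (k + n)))(i - k := u)" for u
          using i inj False by (auto simp: fun_eq_iff dest!: injD[OF inj])
        have "\<sigma> n \<noteq> j" if "n < k" for n
          using i inj that False by (metis injD)
        then have 2: "\<alpha> (\<lambda>n. (v(j := u)) (\<sigma> n)) = \<alpha> (\<lambda>n. v (\<sigma> n))" for u
          by (intro alternating_form_cong[OF \<alpha>]) auto
        show ?thesis
          unfolding F_def 1 2
          using alternating_form_linear[OF \<beta>, of "i - k" "\<lambda>n. v (\<sigma> (k + n))"] i False
          by (auto simp: linear_iff algebra_simps)
      qed
    qed
    then have "linear (\<lambda>u. \<Sum>\<sigma>\<in>P. of_int (sign \<sigma>) *\<^sub>R F \<sigma> (v(j := u)))"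
      by (intro linear_compose_sum linear_compose_scale_right ballI) auto
    then show ?thesis
      unfolding w by (auto simp: linear_iff add_divide_distrib)
  qed
  have Z: "wedge k l \<alpha> \<beta> v = 0" if "i < k + l" "j < k + l" "i \<noteq> j" "v i = v j" for v i j
  proof -
    let ?T = "Transposition.transpose i j"
    have T: "?T permutes {..<k + l}"
      using that by (intro permutes_swap_id) auto
    \<comment> \<open>Composition with the transposition permutes the index set, keeps every value
      because \<open>v i = v j\<close>, and reverses every sign: the sum equals its own
      negative.\<close>
    have "(\<Sum>\<sigma>\<in>P. of_int (sign \<sigma>) * F \<sigma> v) = (\<Sum>\<sigma>\<in>P. of_int (sign (?T \<circ> \<sigma>)) * F (?T \<circ> \<sigma>) v)"
      unfolding P_def by (rule setum_permutations_compose_left[OF T])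
    also have "\<dots> = (\<Sum>\<sigma>\<in>P. - (of_int (sign \<sigma>) * F \<sigma> v))"
    proof (rule sum.cong[OF refl])
      fix \<sigma> assume "\<sigma> \<in> P"
      then have "permutation \<sigma>" by (auto simp: P_def permutation_permutes)
      then have "sign (?T \<circ> \<sigma>) = - sign \<sigma>"
        using that(3) by (simp add: sign_compose permutation_swap_id sign_swap_id)
      moreover have "v (?T n) = v n" for n
        using that(4) by (simp add: Transposition.transpose_def)
      ultimately show "of_int (sign (?T \<circ> \<sigma>)) * F (?T \<circ> \<sigma>) v = - (of_int (sign \<sigma>) * F \<sigma> v)"
        by (simp add: F_def)
    qed
    finally show ?thesis
      unfolding w by (simp add: sum_negf)
  qed
  show ?thesis
    by (rule alternating_formI[OF C L Z])
qed

lemma alternating_form_wedge_power: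
  assumes "alternating_form 2 \<omega>"
  shows "alternating_form (2 * j) (wedge_power \<omega> j)"
proof (induction j)
  case 0
  then show ?case by (simp add: alternating_form_def)
next
  case (Suc j)
  then show ?case using alternating_form_wedge[OF assms Suc] by simp
qed

text \<open>\<open>wedge\<close> only rearranges its arguments, so a map applied to each argument
  passes through unchanged.\<close>

lemma wedge_power_pullback:
  "wedge_power (\<lambda>v. \<omega> (\<lambda>i. A (v i))) j = (\<lambda>v. wedge_power \<omega> j (\<lambda>i. A (v i)))"
  by (induction j) (simp_all add: wedge_def)

section \<open>Forms of top degree: uniqueness, traces and determinants\<close>

lemma top_form_eq_0:
  fixes \<alpha> :: "'e::euclidean_space covec"
  assumes \<alpha>: "alternating_form k \<alpha>" and b: "bij_betw b {..<k} Basis" and "\<alpha> b = 0"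
  shows "\<alpha> v = 0"
proof -
  have basis: "\<alpha> w = 0" if w: "\<forall>i<k. w i \<in> Basis" for w
  proof (cases "inj_on w {..<k}")
    case True
    \<comment> \<open>\<open>p\<close> reads the tuple \<open>w\<close> of basis vectors through the
      enumeration \<open>b\<close>; being the identity outside \<open>{..<k}\<close> makes it a
      permutation in the sense of \<open>permutes\<close>.\<close>
    define p where "p i = (if i < k then inv_into {..<k} b (w i) else i)" for i
    have wi: "w i \<in> b ` {..<k}" if "i < k" for i
      using w b that by (simp add: bij_betw_def)
    have bp: "b (p i) = w i" if "i < k" for i
      using f_inv_into_f[OF wi[OF that]] that by (simp add: p_def)
    have pk: "p i < k" if "i < k" for i
      using inv_into_into[OF wi[OF that]] that by (simp add: p_def)
    have "inj_on p {..<k}"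
      using True bp unfolding inj_on_def by (metis lessThan_iff)
    moreover from this have "p ` {..<k} = {..<k}"
      using pk by (intro endo_inj_surj) auto
    ultimately have "p permutes {..<k}"
      by (intro bij_imp_permutes) (simp_all add: bij_betw_def p_def)
    then have "\<alpha> (\<lambda>i. b (p i)) = 0"
      using alternating_form_permute[OF \<alpha>] \<open>\<alpha> b = 0\<close> by simp
    moreover have "\<alpha> (\<lambda>i. b (p i)) = \<alpha> w"
      by (rule alternating_form_cong[OF \<alpha>]) (rule bp)
    ultimately show ?thesis by simp
  next
    case False
    then obtain i j where "i < k" "j < k" "i \<noteq> j" "w i = w j"
      by (auto simp: inj_on_def)
    then show ?thesis
      by (rule alternating_form_eq_0[OF \<alpha>])
  qed
  \<comment> \<open>\<open>j\<close> counts the leading slots that still hold arbitrary vectors: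
    none at \<open>j = 0\<close>, where \<open>basis\<close> applies, and all of them at
    \<open>j = k\<close>.\<close>
  have "\<alpha> w = 0" if "j \<le> k" "\<forall>i. j \<le> i \<longrightarrow> i < k \<longrightarrow> w i \<in> Basis" for j w
    using that
  proof (induction j arbitrary: w)
    case 0
    then show ?case using basis by simp
  next
    case (Suc j)
    have j: "j < k" using Suc.prems by simp
    interpret linear "\<lambda>u. \<alpha> (w(j := u))"
      by (rule alternating_form_linear[OF \<alpha> j])
    have "\<alpha> w = \<alpha> (w(j := (\<Sum>u\<in>Basis. (w j \<bullet> u) *\<^sub>R u)))"
      by (simp add: euclidean_representation)
    also have "\<dots> = (\<Sum>u\<in>Basis. (w j \<bullet> u) *\<^sub>R \<alpha> (w(j := u)))"
      by (simp only: sum scale)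
    also have "\<dots> = 0"
    proof (intro sum.neutral ballI)
      fix u :: 'e assume "u \<in> Basis"
      then have "\<alpha> (w(j := u)) = 0"
        using Suc.prems by (intro Suc.IH) auto
      then show "(w j \<bullet> u) *\<^sub>R \<alpha> (w(j := u)) = 0" by simp
    qed
    finally show ?case .
  qed
  from this[of k v] show ?thesis by simp
qed

text \<open>Reduces proportionality of two forms of top degree to a single evaluation on an
  enumerated basis.\<close>

lemma top_form_eqI:
  fixes \<alpha> \<beta> :: "'e::euclidean_space covec"
  assumes "alternating_form k \<alpha>" "alternating_form k \<beta>" "bij_betw b {..<k} Basis" "\<alpha> b = c * \<beta> b"
  shows "\<alpha> v = c * \<beta> v"
  using top_form_eq_0[OF alternating_form_diff_scale[OF assms(1,2), of c] assms(3), of v] assms(4)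
  by simp

text \<open>This is the action of \<open>A\<close> on forms as a derivation. With \<open>A\<close>
  the derivative of a vector field it is the term that \<open>lie_deriv\<close> adds to the
  directional derivative.\<close>

lemma alternating_form_derivation:
  assumes \<alpha>: "alternating_form k \<alpha>" and A: "linear A"
  shows "alternating_form k (\<lambda>v. \<Sum>i<k. \<alpha> (v(i := A (v i))))"
proof -
  have C: "(\<Sum>i<k. \<alpha> (v(i := A (v i)))) = (\<Sum>i<k. \<alpha> (w(i := A (w i))))" if "\<forall>i<k. v i = w i" for v w
    by (intro sum.cong refl alternating_form_cong[OF \<alpha>]) (use that in auto)
  have L: "linear (\<lambda>u. \<Sum>i<k. \<alpha> ((v(j := u))(i := A ((v(j := u)) i))))" if j: "j < k" for v j
  proof (rule linear_compose_sum, rule ballI)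
    fix i assume "i \<in> {..<k}"
    show "linear (\<lambda>u. \<alpha> ((v(j := u))(i := A ((v(j := u)) i))))"
    proof (cases "i = j")
      case True
      then show ?thesis
        using linear_compose[OF A alternating_form_linear[OF \<alpha> j, of v]] by (simp add: o_def)
    next
      case False
      then have "(v(j := u))(i := A ((v(j := u)) i)) = (v(i := A (v i)))(j := u)" for u
        by auto
      then show ?thesis
        using alternating_form_linear[OF \<alpha> j, of "v(i := A (v i))"] by simp
    qed
  qed
  have Z: "(\<Sum>i<k. \<alpha> (v(i := A (v i)))) = 0"
    if ij: "i < k" "j < k" "i \<noteq> j" "v i = v j" for v i j
  proof -
    have "(\<lambda>l. (v(i := A (v i))) (Transposition.transpose i j l)) = v(j := A (v j))"
      using ij by (auto simp: fun_eq_iff Transposition.transpose_def)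
    then have "\<alpha> (v(j := A (v j))) = - \<alpha> (v(i := A (v i)))"
      using alternating_form_swap[OF \<alpha> ij(1-3), of "v(i := A (v i))"] by simp
    \<comment> \<open>Every other summand still has two equal arguments; the two that remain cancel
      by the swap.\<close>
    moreover have "(\<Sum>l<k. \<alpha> (v(l := A (v l)))) = (\<Sum>l\<in>{i,j}. \<alpha> (v(l := A (v l))))"
    proof (rule sum.mono_neutral_right)
      show "\<forall>l\<in>{..<k} - {i, j}. \<alpha> (v(l := A (v l))) = 0"
        using ij by (intro ballI alternating_form_eq_0[OF \<alpha> ij(1-3)]) auto
    qed (use ij in auto)
    ultimately show ?thesis
      using ij(3) by simp
  qed
  show ?thesis
    by (rule alternating_formI[OF C L Z])
qed

lemma ex_enum_Basis: "\<exists>b. bij_betw b {..<DIM('e::euclidean_space)} (Basis :: 'e set)"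
  using ex_bij_betw_nat_finite[OF finite_Basis] by (metis lessThan_atLeast0)

text \<open>On a basis only the component of \<open>A (b i)\<close> along \<open>b i\<close>
  survives, since any other component repeats an argument; the surviving diagonal entries add up to
  the trace. This turns the Lie derivative of a volume form into a divergence.\<close>

lemma top_form_trace:
  fixes \<alpha> :: "'e::euclidean_space covec"
  assumes \<alpha>: "alternating_form DIM('e) \<alpha>" and A: "linear A"
  shows "(\<Sum>i<DIM('e). \<alpha> (v(i := A (v i)))) = (\<Sum>u\<in>Basis. A u \<bullet> u) * \<alpha> v"
proof -
  obtain b :: "nat \<Rightarrow> 'e" where b: "bij_betw b {..<DIM('e)} Basis"
    using ex_enum_Basis by blast
  have "\<alpha> (b(i := A (b i))) = (A (b i) \<bullet> b i) * \<alpha> b" if i: "i < DIM('e)" for i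
  proof -
    interpret linear "\<lambda>u. \<alpha> (b(i := u))"
      by (rule alternating_form_linear[OF \<alpha> i])
    have "\<alpha> (b(i := A (b i))) = \<alpha> (b(i := (\<Sum>u\<in>Basis. (A (b i) \<bullet> u) *\<^sub>R u)))"
      by (simp add: euclidean_representation)
    also have "\<dots> = (\<Sum>u\<in>Basis. (A (b i) \<bullet> u) *\<^sub>R \<alpha> (b(i := u)))"
      by (simp only: sum scale)
    also have "\<dots> = (\<Sum>u\<in>{b i}. (A (b i) \<bullet> u) *\<^sub>R \<alpha> (b(i := u)))"
    proof (rule sum.mono_neutral_right)
      show "{b i} \<subseteq> Basis"
        using b i by (auto simp: bij_betw_def)
      show "\<forall>u\<in>Basis - {b i}. (A (b i) \<bullet> u) *\<^sub>R \<alpha> (b(i := u)) = 0"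
      proof
        fix u assume u: "u \<in> Basis - {b i}"
        then obtain j where j: "j < DIM('e)" "u = b j"
          using b by (metis DiffE bij_betw_def imageE lessThan_iff)
        then have "\<alpha> (b(i := u)) = 0"
          using u i by (intro alternating_form_eq_0[OF \<alpha> i j(1)]) auto
        then show "(A (b i) \<bullet> u) *\<^sub>R \<alpha> (b(i := u)) = 0" by simp
      qed
    qed simp
    finally show ?thesis by simp
  qed
  then have "(\<Sum>i<DIM('e). \<alpha> (b(i := A (b i)))) = (\<Sum>i<DIM('e). A (b i) \<bullet> b i) * \<alpha> b"
    by (simp add: sum_distrib_right)
  also have "(\<Sum>i<DIM('e). A (b i) \<bullet> b i) = (\<Sum>u\<in>Basis. A u \<bullet> u)"
    by (rule sum.reindex_bij_betw[OF b])
  finally show ?thesis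
    by (rule top_form_eqI[OF alternating_form_derivation[OF \<alpha> A] \<alpha> b])
qed

text \<open>Rows of a matrix are indexed by the type \<open>'m\<close>, arguments of a covector by
  natural numbers; \<open>en\<close> translates between the two.\<close>

lemma alternating_form_det:
  fixes en :: "nat \<Rightarrow> 'm::finite"
  assumes en: "bij_betw en {..<CARD('m)} UNIV"
  shows "alternating_form CARD('m) (\<lambda>v. det ((\<chi> r. v (inv_into {..<CARD('m)} en r)) :: real^'m^'m))"
proof -
  let ?I = "inv_into {..<CARD('m)} en"
  have I: "?I r < CARD('m)" "en (?I r) = r" for r
    using en f_inv_into_f[of r en "{..<CARD('m)}"] inv_into_into[of r en "{..<CARD('m)}"]
    by (simp_all add: bij_betw_def)
  have In: "?I (en i) = i" if "i < CARD('m)" for i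
    using en that by (simp add: bij_betw_def inv_into_f_f)
  have L: "linear (\<lambda>u::real^'m. det (\<chi> r. (v(i := u)) (?I r)))" if "i < CARD('m)" for v :: "nat \<Rightarrow> real^'m" and i
  proof -
    have "(\<chi> r. (v(i := u)) (?I r)) = (\<chi> r. if r = en i then u else v (?I r))" for u
      using I In that by (auto simp: vec_eq_iff)
    note upd = this
    show ?thesis
    proof (rule linearI)
      show "det (\<chi> r. (v(i := x + y)) (?I r)) = det (\<chi> r. (v(i := x)) (?I r)) + det (\<chi> r. (v(i := y)) (?I r))" for x y
        unfolding upd by (rule det_row_add)
      show "det (\<chi> r. (v(i := c *\<^sub>R x)) (?I r)) = c *\<^sub>R det (\<chi> r. (v(i := x)) (?I r))" for c x
        unfolding upd scalar_mult_eq_scaleR[symmetric] real_scaleR_def by (rule det_row_mul)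
    qed
  qed
  have Z: "det (\<chi> r. v (?I r)) = 0" if "i < CARD('m)" "j < CARD('m)" "i \<noteq> j" "v i = v j"
    for v :: "nat \<Rightarrow> real^'m" and i j
  proof (rule det_identical_rows)
    show "en i \<noteq> en j" using that In by metis
    show "row (en i) (\<chi> r. v (?I r)) = row (en j) (\<chi> r. v (?I r))"
      using that by (simp add: row_def In)
  qed
  have C: "det (\<chi> r. v (?I r)) = det (\<chi> r. w (?I r))"
    if "\<forall>i<CARD('m). v i = w i" for v w :: "nat \<Rightarrow> real^'m"
  proof -
    have "v (?I r) = w (?I r)" for r using that I(1) by blast
    then show ?thesis by (simp only:)
  qed
  show ?thesis
    by (rule alternating_formI[OF C L Z])
qed

lemma Basis_vec_axis: "(Basis :: (real^'m::finite) set) = range (\<lambda>i. axis i 1)"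
  by (auto simp: Basis_vec_def)

lemma bij_betw_axis:
  fixes en :: "nat \<Rightarrow> 'm::finite"
  assumes "bij_betw en {..<CARD('m)} UNIV"
  shows "bij_betw (\<lambda>i. axis (en i) (1::real)) {..<CARD('m)} Basis"
proof -
  have "bij_betw (\<lambda>i::'m. axis i (1::real)) UNIV Basis"
    by (auto simp: bij_betw_def Basis_vec_axis inj_on_def axis_eq_axis)
  from bij_betw_trans[OF assms this] show ?thesis by (simp add: o_def)
qed

text \<open>Every form of top degree is a multiple of the determinant of its arguments, so the claim
  is multiplicativity of \<open>det\<close>.\<close>

lemma top_form_det:
  fixes \<alpha> :: "(real^'m::finite) covec" and A :: "real^'m^'m"
  assumes \<alpha>: "alternating_form CARD('m) \<alpha>"
  shows "\<alpha> (\<lambda>i. A *v w i) = det A * \<alpha> w"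
proof -
  obtain en :: "nat \<Rightarrow> 'm" where en: "bij_betw en {..<CARD('m)} UNIV"
    using ex_bij_betw_nat_finite[of "UNIV :: 'm set"] by (auto simp: lessThan_atLeast0)
  let ?I = "inv_into {..<CARD('m)} en" and ?e = "\<lambda>i. axis (en i) (1::real)"
  have I: "en (?I r) = r" for r
    using en f_inv_into_f[of r en "{..<CARD('m)}"] by (simp add: bij_betw_def)
  have "(\<chi> r. ?e (?I r)) = mat 1"
    by (auto simp: vec_eq_iff I mat_def axis_def)
  then have "\<alpha> ?e = \<alpha> ?e * det (\<chi> r. ?e (?I r))"
    by (simp only: det_I mult_1_right)
  then have e: "\<alpha> v = \<alpha> ?e * det (\<chi> r. v (?I r))" for v
    by (rule top_form_eqI[OF \<alpha> alternating_form_det[OF en] bij_betw_axis[OF en]])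
  have "(\<chi> r. A *v w (?I r)) = (\<chi> r. w (?I r)) ** transpose A"
    by (simp add: vec_eq_iff matrix_matrix_mult_def matrix_vector_mult_def transpose_def mult.commute)
  then have "det (\<chi> r. A *v w (?I r)) = det (\<chi> r. w (?I r)) * det A"
    by (simp only: det_mul det_transpose)
  then show ?thesis
    unfolding e[of w] e[of "\<lambda>i. A *v w i"] by simp
qed

text \<open>Freezing one block of arguments and feeding the other through the inclusion of a factor
  leaves a form of top degree on that factor, to which \<open>top_form_det\<close> applies. The
  companion \<open>alternating_form_fix_first\<close> treats the other block.\<close>

lemma alternating_form_fix_last:
  assumes \<alpha>: "alternating_form (k + l) \<alpha>" and L: "linear L"
  shows "alternating_form k (\<lambda>z. \<alpha> (\<lambda>i. if i < k then L (z i) else c i))"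
proof -
  have L: "linear (\<lambda>u. \<alpha> (\<lambda>i. if i < k then L ((z(j := u)) i) else c i))" if "j < k" for z j
  proof -
    have "(\<lambda>i. if i < k then L ((z(j := u)) i) else c i) = (\<lambda>i. if i < k then L (z i) else c i)(j := L u)" for u
      using that by auto
    then show ?thesis
      using linear_compose[OF L alternating_form_linear[OF \<alpha>, of j "\<lambda>i. if i < k then L (z i) else c i"]] that
      by (simp add: o_def)
  qed
  have C: "\<alpha> (\<lambda>i. if i < k then L (z i) else c i) = \<alpha> (\<lambda>i. if i < k then L (w i) else c i)"
    if "\<forall>i<k. z i = w i" for z w
    by (rule alternating_form_cong[OF \<alpha>]) (use that in simp)
  have Z: "\<alpha> (\<lambda>i. if i < k then L (z i) else c i) = 0" if "i < k" "j < k" "i \<noteq> j" "z i = z j" for z i j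
    by (rule alternating_form_eq_0[OF \<alpha>, of i j]) (use that in auto)
  show ?thesis
    by (rule alternating_formI[OF C L Z])
qed

lemma alternating_form_fix_first:
  assumes \<alpha>: "alternating_form (k + l) \<alpha>" and L: "linear L"
  shows "alternating_form l (\<lambda>z. \<alpha> (\<lambda>i. if i < k then c i else L (z (i - k))))"
proof -
  have L: "linear (\<lambda>u. \<alpha> (\<lambda>i. if i < k then c i else L ((z(j := u)) (i - k))))" if "j < l" for z j
  proof -
    have "(\<lambda>i. if i < k then c i else L ((z(j := u)) (i - k)))
        = (\<lambda>i. if i < k then c i else L (z (i - k)))(k + j := L u)" for u
      by (rule ext) (auto simp: le_imp_diff_is_add)
    then show ?thesis
      using linear_compose[OF L alternating_form_linear[OF \<alpha>, of "k + j" "\<lambda>i. if i < k then c i else L (z (i - k))"]] that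
      by (simp add: o_def)
  qed
  have C: "\<alpha> (\<lambda>i. if i < k then c i else L (z (i - k))) = \<alpha> (\<lambda>i. if i < k then c i else L (w (i - k)))"
    if "\<forall>i<l. z i = w i" for z w
    by (rule alternating_form_cong[OF \<alpha>]) (use that in simp)
  have Z: "\<alpha> (\<lambda>i. if i < k then c i else L (z (i - k))) = 0"
    if "i < l" "j < l" "i \<noteq> j" "z i = z j" for z i j
    by (rule alternating_form_eq_0[OF \<alpha>, of "k + i" "k + j"]) (use that in auto)
  show ?thesis
    by (rule alternating_formI[OF C L Z])
qed

text \<open>A block triangular determinant obtained without a matrix for the product space. On the
  adapted basis the fibre block yields \<open>det S\<close>; the contributions of \<open>K\<close>
  are then absorbed by the fibre vectors that remain, and the base block yields
  \<open>det J\<close>.\<close>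

lemma top_form_block:
  fixes \<alpha> :: "((real^'m::finite) \<times> (real^'m)) covec" and J S :: "real^'m^'m"
  assumes \<alpha>: "alternating_form (2 * CARD('m)) \<alpha>" and K: "linear K"
  shows "\<alpha> (\<lambda>i. (J *v fst (w i), S *v snd (w i) + K (fst (w i)))) = det J * det S * \<alpha> w"
proof -
  let ?m = "CARD('m)"
  have \<alpha>': "alternating_form (?m + ?m) \<alpha>" using \<alpha> by (simp add: mult_2)
  obtain en :: "nat \<Rightarrow> 'm" where en: "bij_betw en {..<?m} UNIV"
    using ex_bij_betw_nat_finite[of "UNIV :: 'm set"] by (auto simp: lessThan_atLeast0)
  define e :: "nat \<Rightarrow> real^'m" where "e i = axis (en i) 1" for i
  have e: "bij_betw e {..<?m} Basis"
    using bij_betw_axis[OF en] by (simp add: e_def[abs_def])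
  define b :: "nat \<Rightarrow> (real^'m) \<times> (real^'m)" where "b i = (if i < ?m then (e i, 0) else (0, e (i - ?m)))" for i
  have b: "bij_betw b {..<?m + ?m} Basis"
  proof (rule bij_betw_imageI)
    have inj: "e i = e j \<longleftrightarrow> i = j" if "i < ?m" "j < ?m" for i j
      using e that by (auto simp: bij_betw_def inj_on_def)
    have nz: "e i \<noteq> 0" for i
      by (simp add: e_def axis_eq_0_iff)
    show "inj_on b {..<?m + ?m}"
      by (auto simp: inj_on_def b_def inj nz nz[symmetric] split: if_splits)
    have "b ` {..<?m} = (\<lambda>u. (u, 0)) ` Basis"
      using e unfolding bij_betw_def by (auto simp: b_def image_iff)
    moreover have "b ` {?m..<?m + ?m} = (\<lambda>u. (0, u)) ` Basis"
    proof -
      have "b ` {?m..<?m + ?m} = (\<lambda>i. (0, e i)) ` ((\<lambda>i. i - ?m) ` {?m..<?m + ?m})"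
        by (auto simp: b_def image_iff)
      also have "(\<lambda>i. i - ?m) ` {?m..<?m + ?m} = {..<?m}"
        by (auto simp: image_iff intro!: bexI[of _ "x + ?m" for x])
      also have "(\<lambda>i. (0, e i)) ` {..<?m} = (\<lambda>u. (0, u)) ` Basis"
        using e unfolding bij_betw_def by (auto simp: image_iff)
      finally show ?thesis .
    qed
    moreover have "{..<?m + ?m} = {..<?m} \<union> {?m..<?m + ?m}" by auto
    ultimately show "b ` {..<?m + ?m} = Basis"
      by (simp add: Basis_prod_def image_Un)
  qed
  \<comment> \<open>The last arguments contain the whole fibre basis, so a fibre component in an
    earlier slot only repeats them. The induction clears these components one slot at a
    time.\<close>
  have drop: "\<alpha> (\<lambda>i. if i < ?m then (x i, if i < j then 0 else y i) else (0, e (i - ?m)))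
      = \<alpha> (\<lambda>i. if i < ?m then (x i, y i) else (0, e (i - ?m)))" if "j \<le> ?m" for x y j
    using that
  proof (induction j)
    case 0
    then show ?case by (simp cong: if_cong)
  next
    case (Suc j)
    then have j: "j < ?m + ?m" by simp
    define V where "V i = (if i < ?m then (x i, if i < j then 0 else y i) else (0, e (i - ?m)))" for i
    interpret linear "\<lambda>u. \<alpha> (V(j := u))"
      by (rule alternating_form_linear[OF \<alpha>' j])
    have z: "\<alpha> (V(j := (0, u))) = 0" if "u \<in> Basis" for u
    proof -
      have "u \<in> e ` {..<?m}"
        using e that by (simp add: bij_betw_def)
      then obtain i where i: "i < ?m" "u = e i" by auto
      show ?thesis
        by (rule alternating_form_eq_0[OF \<alpha>' j, of "?m + i"]) (use i Suc.prems in \<open>auto simp: V_def\<close>)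
    qed
    have "(0, y j) = (\<Sum>u\<in>Basis. (y j \<bullet> u) *\<^sub>R (0::real^'m, u))"
      by (simp add: prod_eq_iff fst_sum snd_sum euclidean_representation)
    then have "\<alpha> (V(j := (0, y j))) = (\<Sum>u\<in>Basis. (y j \<bullet> u) *\<^sub>R \<alpha> (V(j := (0, u))))"
      by (simp only: sum scale)
    then have "\<alpha> (V(j := (0, y j))) = 0"
      using z by simp
    moreover have "V j = (x j, 0) + (0, y j)"
      using Suc.prems by (simp add: V_def)
    then have "\<alpha> V = \<alpha> (V(j := (x j, 0))) + \<alpha> (V(j := (0, y j)))"
      using add[of "(x j, 0)" "(0, y j)"] by (metis fun_upd_triv)
    ultimately have "\<alpha> V = \<alpha> (V(j := (x j, 0)))" by simp
    moreover have "V(j := (x j, 0)) = (\<lambda>i. if i < ?m then (x i, if i < Suc j then 0 else y i) else (0, e (i - ?m)))"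
      using Suc.prems by (auto simp: V_def fun_eq_iff less_Suc_eq)
    ultimately show ?case
      using Suc by (simp add: V_def[abs_def])
  qed
  have l1: "linear (\<lambda>u::real^'m. (u, 0::real^'m))" and l2: "linear (\<lambda>u::real^'m. (0::real^'m, u))"
    by (auto intro!: linearI)
  have "(\<lambda>i. (J *v fst (b i), S *v snd (b i) + K (fst (b i)))) =
      (\<lambda>i. if i < ?m then (J *v e i, K (e i)) else (0, S *v e (i - ?m)))"
    by (auto simp: b_def linear_0[OF K])
  then have "\<alpha> (\<lambda>i. (J *v fst (b i), S *v snd (b i) + K (fst (b i)))) =
      det S * \<alpha> (\<lambda>i. if i < ?m then (J *v e i, K (e i)) else (0, e (i - ?m)))"
    using top_form_det[OF alternating_form_fix_first[OF \<alpha>' l2, of "\<lambda>i. (J *v e i, K (e i))"], of S e] by simp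
  also have "\<alpha> (\<lambda>i. if i < ?m then (J *v e i, K (e i)) else (0, e (i - ?m)))
      = \<alpha> (\<lambda>i. if i < ?m then (J *v e i, 0) else (0, e (i - ?m)))"
    by (subst drop[of ?m, symmetric], simp, rule alternating_form_cong[OF \<alpha>']) auto
  also have "\<dots> = det J * \<alpha> b"
    using top_form_det[OF alternating_form_fix_last[OF \<alpha>' l1, of "\<lambda>i. (0, e (i - ?m))"], of J e]
    by (simp add: b_def[abs_def])
  finally have H: "\<alpha> (\<lambda>i. (J *v fst (b i), S *v snd (b i) + K (fst (b i)))) = det J * det S * \<alpha> b"
    by simp
  have lin: "linear (\<lambda>x. (J *v fst x, S *v snd x + K (fst x)))"
    using K by (auto simp: linear_iff matrix_vector_right_distrib scaleR_right_distrib matrix_vector_mult_scaleR)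
  show ?thesis
    by (rule top_form_eqI[OF alternating_form_pullback[OF \<alpha>' lin] \<alpha>' b H])
qed

text \<open>No permutation contributes a negative term: the factor \<open>\<omega>\<close> vanishes
  unless a conjugate pair stands in front, and then the sign of the permutation is compensated by
  the reordering of the remaining arguments. Asking for positivity instead of the exact value avoids
  counting the permutations that contribute. The induction is over arbitrary \<open>e\<close> and
  \<open>f\<close>, because the pairs left after removing one need not be an initial
  segment.\<close>

lemma wedge_power_symplectic_pos:
  fixes \<omega> :: "'e::real_vector covec" and e f :: "nat \<Rightarrow> 'e"
  defines "P \<equiv> \<lambda>x y. \<omega> (\<lambda>i. if i = 0 then x else y)"
  assumes \<omega>: "alternating_form 2 \<omega>"
    and "\<And>a c. a < j \<Longrightarrow> c < j \<Longrightarrow> P (e a) (f c) = (if a = c then 1 else 0)"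
    and "\<And>a c. a < j \<Longrightarrow> c < j \<Longrightarrow> P (e a) (e c) = 0"
    and "\<And>a c. a < j \<Longrightarrow> c < j \<Longrightarrow> P (f a) (f c) = 0"
  shows "wedge_power \<omega> j (\<lambda>i. if even i then e (i div 2) else f (i div 2)) > 0"
  using assms(3-5)
proof (induction j arbitrary: e f)
  case 0
  then show ?case by simp
next
  case (Suc j)
  define v where "v i = (if even i then e (i div 2) else f (i div 2))" for i
  define t where "t \<sigma> = of_int (sign \<sigma>) * \<omega> (\<lambda>i. v (\<sigma> i)) * wedge_power \<omega> j (\<lambda>i. v (\<sigma> (2 + i)))" for \<sigma>
  have fe: "P (f c) (e a) = (if a = c then - 1 else 0)" if "a < Suc j" "c < Suc j" for a c
  proof -
    have "P (f c) (e a) = \<omega> (\<lambda>l. (\<lambda>i. if i = 0 then e a else f c) (Transposition.transpose 0 1 l))"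
      unfolding P_def by (rule alternating_form_cong[OF \<omega>]) (auto simp: less_2_cases_iff)
    then show ?thesis
      using alternating_form_swap[OF \<omega>, of 0 1 "\<lambda>i. if i = 0 then e a else f c"] Suc.prems(1)[OF that]
      by (simp add: P_def)
  qed
  have \<omega>2: "\<omega> w = P (w 0) (w 1)" for w
    unfolding P_def by (rule alternating_form_cong[OF \<omega>]) (auto simp: less_2_cases_iff)
  have A1: "t \<sigma> > 0" if \<sigma>: "\<sigma> permutes {..<2 + 2 * j}" and c: "\<sigma> 0 = 2 * c" "\<sigma> 1 = 2 * c + 1" for \<sigma> c
  proof -
    have "2 * c < 2 + 2 * j"
      using permutes_in_image[OF \<sigma>, of 0] c by simp
    then have cj: "c < Suc j" by simp
    let ?T = "Transposition.transpose 0 c"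
    \<comment> \<open>\<open>\<pi>\<close> exchanges pair \<open>c\<close> with pair
      \<open>0\<close> as blocks. Its two transpositions have equal sign, so it is even, also when
      \<open>c = 0\<close> and both are the identity.\<close>
    define \<pi> where "\<pi> = Transposition.transpose 0 (2 * c) \<circ> Transposition.transpose 1 (2 * c + 1)"
    have \<pi>: "\<pi> i = 2 * ?T (i div 2) + i mod 2" for i
    proof -
      consider "i = 0" | "i = 1" | "i = 2 * c" | "i = 2 * c + 1"
        | "i \<noteq> 0" "i \<noteq> 1" "i \<noteq> 2 * c" "i \<noteq> 2 * c + 1" by blast
      then show ?thesis
      proof cases
        case 5
        then have "i div 2 \<noteq> 0" by presburger
        moreover have "i div 2 \<noteq> c" using 5 by presburger
        ultimately show ?thesis using 5 by (simp add: \<pi>_def Transposition.transpose_def)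
      qed (auto simp: \<pi>_def Transposition.transpose_def)
    qed
    have \<pi>\<pi>: "\<pi> (\<pi> i) = i" for i
      by (simp add: \<pi>)
    have s\<pi>: "sign \<pi> = 1"
      by (simp add: \<pi>_def sign_compose permutation_swap_id sign_swap_id)
    have p\<pi>: "\<pi> permutes {..<2 + 2 * j}"
      unfolding \<pi>_def using cj by (intro permutes_compose permutes_swap_id) auto
    \<comment> \<open>Once pair \<open>c\<close> is moved to the front, \<open>\<tau>\<close> fixes
      0 and 1 and permutes only the arguments of the lower power; since \<open>\<pi>\<close> is even
      it has the sign of \<open>\<sigma>\<close>, and the two signs multiply to 1.\<close>
    define \<tau> where "\<tau> = \<pi> \<circ> \<sigma>"
    have \<tau>: "\<tau> permutes {..<2 + 2 * j}"
      unfolding \<tau>_def by (intro permutes_compose \<sigma> p\<pi>)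
    have "\<tau> 0 = 0" "\<tau> 1 = 1"
      using c by (simp_all add: \<tau>_def \<pi>)
    then have \<tau>2: "\<tau> permutes {2..<2 + 2 * j}"
      using \<tau> by (rule_tac permutes_superset[OF \<tau>]) (auto simp: not_le less_2_cases_iff)
    have "sign \<tau> = sign \<sigma>"
      using \<sigma> p\<pi> s\<pi> unfolding \<tau>_def by (subst sign_compose) (auto simp: permutation_permutes)
    moreover have "v (\<sigma> i) = v (\<pi> (\<tau> i))" for i
      by (simp add: \<tau>_def \<pi>\<pi>)
    ultimately have "wedge_power \<omega> j (\<lambda>i. v (\<sigma> (2 + i))) =
        of_int (sign \<sigma>) * wedge_power \<omega> j (\<lambda>i. v (\<pi> (2 + i)))"
      using alternating_form_permute_shift[OF alternating_form_wedge_power[OF \<omega>] \<tau>2, of "\<lambda>i. v (\<pi> i)"]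
      by simp
    moreover have "wedge_power \<omega> j (\<lambda>i. v (\<pi> (2 + i))) > 0"
    proof -
      have b: "?T (Suc a) < Suc j" if "a < j" for a
        using that cj by (simp add: Transposition.transpose_def)
      have "?T (Suc a) = ?T (Suc a') \<longleftrightarrow> a = a'" for a a'
        by (metis Transposition.transpose_involutory nat.inject)
      \<comment> \<open>The values \<open>?T (Suc a)\<close> for \<open>a < j\<close> run through
        all pair numbers except \<open>c\<close>, so these are the remaining pairs.\<close>
      then have "wedge_power \<omega> j (\<lambda>i. if even i then e (?T (Suc (i div 2))) else f (?T (Suc (i div 2)))) > 0"
        using Suc.prems b by (intro Suc.IH) simp_all
      then show ?thesis
        by (simp add: v_def \<pi> cong: if_cong)
    qed
    moreover have "\<omega> (\<lambda>i. v (\<sigma> i)) = 1"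
      using c Suc.prems(1)[OF cj cj] by (subst \<omega>2) (simp add: v_def)
    moreover have "(of_int (sign \<sigma>) :: real) * of_int (sign \<sigma>) = 1"
      by (metis of_int_1 of_int_mult sign_idempotent)
    ultimately show ?thesis
      unfolding t_def by (simp add: mult.assoc[symmetric])
  qed
  \<comment> \<open>Exchanging the two front arguments reverses both the sign of the permutation and
    the value of \<open>\<omega>\<close>, so a reversed pair contributes the same term as an ordered
    one.\<close>
  have A2: "t \<sigma> > 0" if \<sigma>: "\<sigma> permutes {..<2 + 2 * j}" and c: "\<sigma> 0 = 2 * c + 1" "\<sigma> 1 = 2 * c" for \<sigma> c
  proof -
    let ?T = "Transposition.transpose (0::nat) 1"
    have "\<sigma> \<circ> ?T permutes {..<2 + 2 * j}"
      by (intro permutes_compose \<sigma> permutes_swap_id) auto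
    then have "t (\<sigma> \<circ> ?T) > 0"
      by (rule A1[of _ c]) (use c in auto)
    moreover have "sign (\<sigma> \<circ> ?T) = - sign \<sigma>"
    proof -
      have "permutation \<sigma>" using \<sigma> by (auto simp: permutation_permutes)
      then show ?thesis by (simp add: sign_compose permutation_swap_id sign_swap_id)
    qed
    moreover have "\<omega> (\<lambda>i. v ((\<sigma> \<circ> ?T) i)) = - \<omega> (\<lambda>i. v (\<sigma> i))"
      using alternating_form_swap[OF \<omega>, of 0 1 "\<lambda>i. v (\<sigma> i)"] by simp
    ultimately show ?thesis
      by (simp add: t_def Transposition.transpose_def)
  qed
  have A3: "t \<sigma> = 0 \<or> t \<sigma> > 0" if \<sigma>: "\<sigma> permutes {..<2 + 2 * j}" for \<sigma>
  proof -
    define a b where "a = \<sigma> 0 div 2" and "b = \<sigma> 1 div 2"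
    have "\<sigma> 0 < 2 + 2 * j" "\<sigma> 1 < 2 + 2 * j"
      using permutes_in_image[OF \<sigma>, of 0] permutes_in_image[OF \<sigma>, of 1] by simp_all
    then have ab: "a < Suc j" "b < Suc j" by (simp_all add: a_def b_def)
    have w: "\<omega> (\<lambda>i. v (\<sigma> i)) = P (v (\<sigma> 0)) (v (\<sigma> 1))" by (rule \<omega>2)
    show ?thesis
    proof (cases "\<omega> (\<lambda>i. v (\<sigma> i)) = 0")
      case True
      then show ?thesis by (simp add: t_def)
    next
      case False
      then have nz: "P (v (\<sigma> 0)) (v (\<sigma> 1)) \<noteq> 0"
        unfolding w .
      have v0: "v (\<sigma> 0) = (if even (\<sigma> 0) then e a else f a)"
        and v1: "v (\<sigma> 1) = (if even (\<sigma> 1) then e b else f b)"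
        by (simp_all add: v_def a_def b_def)
      have "a = b \<and> (even (\<sigma> 0) \<longleftrightarrow> odd (\<sigma> 1))"
        using nz Suc.prems(1)[OF ab] Suc.prems(2)[OF ab] Suc.prems(3)[OF ab] fe[OF ab(2,1)]
        unfolding v0 v1 by (auto split: if_splits)
      then consider "\<sigma> 0 = 2 * a" "\<sigma> 1 = 2 * a + 1" | "\<sigma> 0 = 2 * a + 1" "\<sigma> 1 = 2 * a"
        unfolding a_def b_def by (metis dvd_mult_div_cancel odd_two_times_div_two_succ)
      then show ?thesis
        using A1[OF \<sigma>] A2[OF \<sigma>] by cases auto
    qed
  qed
  have "0 < (\<Sum>\<sigma> | \<sigma> permutes {..<2 + 2 * j}. t \<sigma>)"
  \<comment> \<open>The identity has pair 0 in front in the right order, which supplies the one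
    strictly positive term.\<close>
  proof (rule sum_pos2[of _ id])
    show "0 < t id" by (rule A1[of _ 0]) (auto simp: permutes_id)
    show "0 \<le> t \<sigma>" if "\<sigma> \<in> {\<sigma>. \<sigma> permutes {..<2 + 2 * j}}" for \<sigma>
      using A3[of \<sigma>] that by auto
  qed (auto simp: permutes_id finite_permutations)
  then have "0 < wedge_power \<omega> (Suc j) v"
    by (simp add: wedge_def t_def)
  then show ?case
    by (simp add: v_def[abs_def])
qed

section \<open>Derivative of the determinant (Jacobi's formula)\<close>

lemma det_has_derivative_at_1:
  fixes N :: "'a::real_normed_vector \<Rightarrow> real^'n^'n::finite"
  assumes N: "\<And>i j. ((\<lambda>y. N y $ i $ j) has_derivative N' i j) (at x)" and 1: "N x = mat 1"
  shows "((\<lambda>y. det (N y)) has_derivative (\<lambda>h. \<Sum>i\<in>UNIV. N' i i h)) (at x)"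
proof -
  have "((\<lambda>y. det (N y)) has_derivative (\<lambda>h. \<Sum>p | p permutes (UNIV::'n set).
      of_int (sign p) * (\<Sum>i\<in>UNIV. N' i (p i) h * (\<Prod>l\<in>UNIV - {i}. N x $ l $ p l)))) (at x)"
    unfolding det_def
    by (intro has_derivative_sum has_derivative_mult_right has_derivative_prod N)
  moreover have "(\<Sum>p | p permutes (UNIV::'n set).
      of_int (sign p) * (\<Sum>i\<in>UNIV. N' i (p i) h * (\<Prod>l\<in>UNIV - {i}. N x $ l $ p l))) = (\<Sum>i\<in>UNIV. N' i i h)" for h
  proof -
    \<comment> \<open>A permutation other than the identity moves at least two indices. One of them
      differs from \<open>i\<close>, so an off-diagonal entry of the identity matrix remains after
      one factor has been differentiated.\<close>
    have "(\<Prod>l\<in>UNIV - {i}. N x $ l $ p l) = 0" if p: "p \<noteq> id" "p permutes (UNIV::'n set)" for p i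
    proof -
      obtain l where l: "p l \<noteq> l" using p by (auto simp: fun_eq_iff)
      have "p (p l) \<noteq> p l" using p(2) l by (meson injD permutes_inj)
      then obtain l' where l': "l' \<noteq> i" "p l' \<noteq> l'" using l by metis
      then have "N x $ l' $ p l' = 0"
        unfolding 1 by (simp add: mat_def)
      then show ?thesis
        using l'(1) by (intro prod_zero bexI[of _ l']) auto
    qed
    note z = this
    have "(\<Sum>p | p permutes (UNIV::'n set).
      of_int (sign p) * (\<Sum>i\<in>UNIV. N' i (p i) h * (\<Prod>l\<in>UNIV - {i}. N x $ l $ p l)))
      = (\<Sum>p\<in>{id}. of_int (sign p) * (\<Sum>i\<in>UNIV. N' i (p i) h * (\<Prod>l\<in>UNIV - {i}. N x $ l $ p l)))"
    proof (rule sum.mono_neutral_right)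
      show "\<forall>p\<in>{p. p permutes (UNIV::'n set)} - {id}.
          of_int (sign p) * (\<Sum>i\<in>UNIV. N' i (p i) h * (\<Prod>l\<in>UNIV - {i}. N x $ l $ p l)) = 0"
      proof
        fix p assume "p \<in> {p. p permutes (UNIV::'n set)} - {id}"
        then have "(\<Prod>l\<in>UNIV - {i}. N x $ l $ p l) = 0" for i
          by (intro z) auto
        then show "of_int (sign p) * (\<Sum>i\<in>UNIV. N' i (p i) h * (\<Prod>l\<in>UNIV - {i}. N x $ l $ p l)) = 0"
          by (simp only: mult_zero_right sum.neutral_const)
      qed
    qed (auto simp: finite_permutations permutes_id)
    then show ?thesis
      by (simp add: 1 mat_def)
  qed
  ultimately show ?thesis by simp
qed

text \<open>Multiplication by the inverse at \<open>x\<close> moves the base point to the identity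
  matrix, where the derivative of the determinant is the trace.\<close>

lemma det_has_derivative:
  fixes M :: "'a::real_normed_vector \<Rightarrow> real^'n^'n::finite"
  assumes M: "\<And>i j. ((\<lambda>y. M y $ i $ j) has_derivative M' i j) (at x)" and I: "M x ** I = mat 1"
  shows "((\<lambda>y. det (M y)) has_derivative (\<lambda>h. det (M x) * (\<Sum>i\<in>UNIV. \<Sum>j\<in>UNIV. I $ i $ j * M' j i h))) (at x)"
proof -
  have I': "I ** M x = mat 1" using I by (simp add: matrix_left_right_inverse)
  have "M y = M x ** (I ** M y)" for y
    by (simp add: matrix_mul_assoc I)
  then have det: "det (M y) = det (M x) * det (I ** M y)" for y
    by (metis det_mul)
  have "((\<lambda>y. (I ** M y) $ i $ k) has_derivative (\<lambda>h. \<Sum>j\<in>UNIV. I $ i $ j * M' j k h)) (at x)" for i k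
    unfolding matrix_matrix_mult_def vec_lambda_beta
    by (intro has_derivative_sum has_derivative_mult_right M)
  then have "((\<lambda>y. det (I ** M y)) has_derivative (\<lambda>h. \<Sum>i\<in>UNIV. \<Sum>j\<in>UNIV. I $ i $ j * M' j i h)) (at x)"
    by (rule det_has_derivative_at_1) (rule I')
  from has_derivative_mult_right[OF this, of "det (M x)"] show ?thesis
    unfolding det[symmetric] .
qed

section \<open>Manifolds and tangent vectors\<close>

text \<open>The part of \<open>smooth_manifold\<close> on which the calculus of functions rests.
  Transition maps are left out, so that \<open>prod_mfd\<close> has the property by a purely
  topological argument; products occur as targets of the local trivializations.\<close>

definition charted :: "('a, 'e::euclidean_space) mfd \<Rightarrow> bool" where
  "charted M \<longleftrightarrow> \<Union>(fst ` atlas M) = pts M \<and>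
     (\<forall>(U, \<kappa>)\<in>atlas M. openin (mtop M) U \<and> inj_on \<kappa> U \<and>
        (\<forall>W. openin (mtop M) W \<longrightarrow> W \<subseteq> U \<longrightarrow> open (\<kappa> ` W)))"

lemma chartedD:
  assumes "charted M" "(U, \<kappa>) \<in> atlas M"
  shows "openin (mtop M) U" "inj_on \<kappa> U" "\<And>W. openin (mtop M) W \<Longrightarrow> W \<subseteq> U \<Longrightarrow> open (\<kappa> ` W)"
  using assms unfolding charted_def by fastforce+

lemma charted_cover:
  assumes "charted M" "p \<in> pts M"
  obtains U \<kappa> where "(U, \<kappa>) \<in> atlas M" "p \<in> U"
proof -
  have "p \<in> \<Union>(fst ` atlas M)" using assms by (simp add: charted_def)
  then show ?thesis using that by auto
qed

lemma charted_open_image: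
  assumes "charted M" "(U, \<kappa>) \<in> atlas M" "openin (mtop M) S"
  shows "open (\<kappa> ` (U \<inter> S))"
  by (rule chartedD(3)[OF assms(1,2)]) (use chartedD(1)[OF assms(1,2)] assms(3) in auto)

lemma smooth_manifold_charted:
  assumes "smooth_manifold M"
  shows "charted M"
proof -
  have "inj_on \<kappa> U \<and> (\<forall>W. openin (mtop M) W \<longrightarrow> W \<subseteq> U \<longrightarrow> open (\<kappa> ` W))"
    if "(U, \<kappa>) \<in> atlas M" for U \<kappa>
  proof -
    have U: "openin (mtop M) U" "open (\<kappa> ` U)"
      and h: "homeomorphic_map (subtopology (mtop M) U) (top_of_set (\<kappa> ` U)) \<kappa>"
      using assms that unfolding smooth_manifold_def by auto
    have "topspace (subtopology (mtop M) U) = U"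
      using openin_subset[OF U(1)] by auto
    then have "inj_on \<kappa> U"
      using homeomorphic_imp_injective_map[OF h] by simp
    moreover have "open (\<kappa> ` W)" if W: "openin (mtop M) W" "W \<subseteq> U" for W
    proof -
      have "openin (subtopology (mtop M) U) W"
        using W by (simp add: openin_open_subtopology U(1))
      then have "openin (top_of_set (\<kappa> ` U)) (\<kappa> ` W)"
        using homeomorphic_imp_open_map[OF h] by (simp add: open_map_def)
      then show ?thesis
        using U(2) by (simp add: openin_open_eq)
    qed
    ultimately show ?thesis by blast
  qed
  then show ?thesis
    using assms unfolding charted_def smooth_manifold_def by auto
qed

lemma charted_prod:
  assumes M: "charted M" and N: "charted N"
  shows "charted (prod_mfd M N)"
proof -
  have "open (map_prod \<kappa> \<psi> ` W)"
    if c: "(U, \<kappa>) \<in> atlas M" "(V, \<psi>) \<in> atlas N"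
      and W: "openin (prod_topology (mtop M) (mtop N)) W" "W \<subseteq> U \<times> V" for U \<kappa> V \<psi> W
  proof (subst open_subopen, intro ballI)
    fix y assume "y \<in> map_prod \<kappa> \<psi> ` W"
    then obtain p q where pq: "(p, q) \<in> W" "y = (\<kappa> p, \<psi> q)" by auto
    then obtain A B where AB: "openin (mtop M) A" "openin (mtop N) B" "p \<in> A" "q \<in> B" "A \<times> B \<subseteq> W"
      using W(1) unfolding openin_prod_topology_alt by meson
    have "open (\<kappa> ` (U \<inter> A) \<times> \<psi> ` (V \<inter> B))"
      by (intro open_Times charted_open_image[OF M c(1) AB(1)] charted_open_image[OF N c(2) AB(2)])
    moreover have "y \<in> \<kappa> ` (U \<inter> A) \<times> \<psi> ` (V \<inter> B)"
      using pq AB W(2) by auto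
    moreover have "\<kappa> ` (U \<inter> A) \<times> \<psi> ` (V \<inter> B) \<subseteq> map_prod \<kappa> \<psi> ` W"
      using AB(5) by (auto simp: map_prod_def intro!: image_eqI[where x = "(a, b)" for a b])
    ultimately show "\<exists>T. open T \<and> y \<in> T \<and> T \<subseteq> map_prod \<kappa> \<psi> ` W" by blast
  qed
  moreover have "inj_on (map_prod \<kappa> \<psi>) (U \<times> V)" "openin (prod_topology (mtop M) (mtop N)) (U \<times> V)"
    if "(U, \<kappa>) \<in> atlas M" "(V, \<psi>) \<in> atlas N" for U \<kappa> V \<psi>
    using chartedD[OF M that(1)] chartedD[OF N that(2)]
    by (auto simp: openin_prod_Times_iff intro: map_prod_inj_on)
  moreover have "\<Union>(fst ` atlas (prod_mfd M N)) = pts (prod_mfd M N)"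
  proof -
    have "\<Union>(fst ` atlas (prod_mfd M N)) = \<Union>(fst ` atlas M) \<times> \<Union>(fst ` atlas N)"
      by (force simp: prod_mfd_def)
    then show ?thesis
      using M N by (simp add: charted_def prod_mfd_def)
  qed
  ultimately show ?thesis
    unfolding charted_def by (auto simp: prod_mfd_def)
qed

section \<open>Smooth functions and smooth maps\<close>

lemma smooth_funD:
  "smooth_fun M S f \<Longrightarrow> (U, \<kappa>) \<in> atlas M \<Longrightarrow> smooth_on (\<kappa> ` (U \<inter> S)) (f \<circ> inv_into U \<kappa>)"
  unfolding smooth_fun_def by fastforce

lemma smooth_funI:
  "(\<And>U \<kappa>. (U, \<kappa>) \<in> atlas M \<Longrightarrow> smooth_on (\<kappa> ` (U \<inter> S)) (\<lambda>y. f (inv_into U \<kappa> y))) \<Longrightarrow> smooth_fun M S f"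
  unfolding smooth_fun_def by (auto simp: o_def)

lemma smooth_fun_subset: "smooth_fun M S f \<Longrightarrow> T \<subseteq> S \<Longrightarrow> smooth_fun M T f"
  unfolding smooth_fun_def by (fastforce intro: smooth_on_subset)

lemma smooth_fun_cong:
  assumes "charted M" "openin (mtop M) S" "\<And>x. x \<in> S \<Longrightarrow> f x = g x" "smooth_fun M S f"
  shows "smooth_fun M S g"
proof (rule smooth_funI)
  fix U \<kappa> assume c: "(U, \<kappa>) \<in> atlas M"
  show "smooth_on (\<kappa> ` (U \<inter> S)) (\<lambda>y. g (inv_into U \<kappa> y))"
    by (rule smooth_on_cong[OF charted_open_image[OF assms(1) c assms(2)] _ smooth_funD[OF assms(4) c]])
      (use assms(3) chartedD(2)[OF assms(1) c] in \<open>auto simp: inv_into_f_f\<close>)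
qed

lemma smooth_fun_const: "smooth_fun M S (\<lambda>x. c)"
  by (rule smooth_funI) (rule smooth_on_const)

lemma smooth_fun_add:
  assumes "charted M" "openin (mtop M) S" "smooth_fun M S f" "smooth_fun M S g"
  shows "smooth_fun M S (\<lambda>x. f x + g x)"
  using smooth_on_add[OF charted_open_image[OF assms(1) _ assms(2)] smooth_funD[OF assms(3)] smooth_funD[OF assms(4)]]
  by (intro smooth_funI) (simp add: o_def)

lemma smooth_fun_mult:
  assumes "charted M" "openin (mtop M) S" "smooth_fun M S f" "smooth_fun M S g"
  shows "smooth_fun M S (\<lambda>x. f x * g x)"
  using smooth_on_mult[OF charted_open_image[OF assms(1) _ assms(2)] smooth_funD[OF assms(3)] smooth_funD[OF assms(4)]]
  by (intro smooth_funI) (simp add: o_def)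

lemma smooth_fun_sum:
  assumes "charted M" "openin (mtop M) S" "\<And>i. i \<in> I \<Longrightarrow> smooth_fun M S (f i)"
  shows "smooth_fun M S (\<lambda>x. \<Sum>i\<in>I. f i x)"
  using assms(3)
  by (induction I rule: infinite_finite_induct)
    (auto intro: smooth_fun_const smooth_fun_add[OF assms(1,2)])

lemma smooth_atI: "smooth_fun M U f \<Longrightarrow> openin (mtop M) U \<Longrightarrow> p \<in> U \<Longrightarrow> smooth_at M p f"
  unfolding smooth_at_def by auto

lemma smooth_atE:
  assumes "smooth_at M p f"
  obtains U where "openin (mtop M) U" "p \<in> U" "smooth_fun M U f"
  using assms unfolding smooth_at_def by auto

lemma smooth_at_cong:
  assumes "charted M" "openin (mtop M) W" "p \<in> W" "\<And>x. x \<in> W \<Longrightarrow> f x = g x" "smooth_at M p f"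
  shows "smooth_at M p g"
proof -
  obtain U where U: "openin (mtop M) U" "p \<in> U" "smooth_fun M U f"
    using assms(5) by (rule smooth_atE)
  have UW: "openin (mtop M) (U \<inter> W)" using U assms(2) by auto
  show ?thesis
    by (rule smooth_atI[OF smooth_fun_cong[OF assms(1) UW assms(4) smooth_fun_subset[OF U(3)]] UW])
      (use U assms(3) in auto)
qed

lemma smooth_at_add:
  assumes "charted M" "smooth_at M p f" "smooth_at M p g"
  shows "smooth_at M p (\<lambda>x. f x + g x)"
proof -
  obtain U V where U: "openin (mtop M) U" "p \<in> U" "smooth_fun M U f"
    and V: "openin (mtop M) V" "p \<in> V" "smooth_fun M V g"
    using assms(2,3) by (auto elim!: smooth_atE)
  have UV: "openin (mtop M) (U \<inter> V)" using U V by auto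
  show ?thesis
    by (rule smooth_atI[OF smooth_fun_add[OF assms(1) UV smooth_fun_subset[OF U(3)] smooth_fun_subset[OF V(3)]] UV])
      (use U V in auto)
qed

lemma smooth_at_mult:
  assumes "charted M" "smooth_at M p f" "smooth_at M p g"
  shows "smooth_at M p (\<lambda>x. f x * g x)"
proof -
  obtain U V where U: "openin (mtop M) U" "p \<in> U" "smooth_fun M U f"
    and V: "openin (mtop M) V" "p \<in> V" "smooth_fun M V g"
    using assms(2,3) by (auto elim!: smooth_atE)
  have UV: "openin (mtop M) (U \<inter> V)" using U V by auto
  show ?thesis
    by (rule smooth_atI[OF smooth_fun_mult[OF assms(1) UV smooth_fun_subset[OF U(3)] smooth_fun_subset[OF V(3)]] UV])
      (use U V in auto)
qed

lemma smooth_at_const: "p \<in> pts M \<Longrightarrow> smooth_at M p (\<lambda>x. c)"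
  using smooth_atI[OF smooth_fun_const openin_topspace] .

text \<open>Smoothness expressed by the effect on open sets and on functions. In this form maps
  compose and push derivations forward without a chart of the intermediate manifold;
  \<open>smooth_map_pullback\<close> is the bridge from the definition by charts.\<close>

definition smooth_pullback ::
  "('a, 'e::euclidean_space) mfd \<Rightarrow> ('b, 'f::euclidean_space) mfd \<Rightarrow> 'a set \<Rightarrow> ('a \<Rightarrow> 'b) \<Rightarrow> bool" where
  "smooth_pullback M N S F \<longleftrightarrow> F ` S \<subseteq> pts N \<and>
     (\<forall>T. openin (mtop N) T \<longrightarrow> openin (mtop M) {p \<in> S. F p \<in> T} \<and>
        (\<forall>h. smooth_fun N T h \<longrightarrow> smooth_fun M {p \<in> S. F p \<in> T} (\<lambda>p. h (F p))))"

lemma smooth_pullbackD: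
  assumes "smooth_pullback M N S F"
  shows "p \<in> S \<Longrightarrow> F p \<in> pts N"
    "openin (mtop N) T \<Longrightarrow> openin (mtop M) {p \<in> S. F p \<in> T}"
    "openin (mtop N) T \<Longrightarrow> smooth_fun N T h \<Longrightarrow> smooth_fun M {p \<in> S. F p \<in> T} (\<lambda>p. h (F p))"
  using assms unfolding smooth_pullback_def by (simp_all add: image_subset_iff)

lemma smooth_pullback_compose:
  assumes F: "smooth_pullback M N S F" and G: "smooth_pullback N P T G"
  shows "smooth_pullback M P {p \<in> S. F p \<in> T} (\<lambda>p. G (F p))"
  unfolding smooth_pullback_def
proof (intro conjI allI impI)
  show "(\<lambda>p. G (F p)) ` {p \<in> S. F p \<in> T} \<subseteq> pts P"
    using smooth_pullbackD(1)[OF G] by auto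
  fix V assume V: "openin (mtop P) V"
  have eq: "{p \<in> {p \<in> S. F p \<in> T}. G (F p) \<in> V} = {p \<in> S. F p \<in> {q \<in> T. G q \<in> V}}" by auto
  show "openin (mtop M) {p \<in> {p \<in> S. F p \<in> T}. G (F p) \<in> V}"
    unfolding eq by (intro smooth_pullbackD(2)[OF F] smooth_pullbackD(2)[OF G] V)
  show "smooth_fun M {p \<in> {p \<in> S. F p \<in> T}. G (F p) \<in> V} (\<lambda>p. h (G (F p)))" if "smooth_fun P V h" for h
    unfolding eq by (intro smooth_pullbackD(3)[OF F] smooth_pullbackD(2,3)[OF G] V that)
qed

lemma smooth_pullback_at:
  assumes "smooth_pullback M N S F" "p \<in> S" "smooth_at N (F p) h"
  shows "smooth_at M p (\<lambda>p. h (F p))"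
proof -
  obtain T where "openin (mtop N) T" "F p \<in> T" "smooth_fun N T h"
    using assms(3) by (rule smooth_atE)
  then show ?thesis
    using smooth_atI[OF smooth_pullbackD(3)[OF assms(1)] smooth_pullbackD(2)[OF assms(1)]] assms(2) by simp
qed

lemma smooth_map_pullback:
  assumes M: "charted M" and N: "charted N" and S: "openin (mtop M) S" and F: "smooth_map M N S F"
  shows "smooth_pullback M N S F"
  unfolding smooth_pullback_def
proof (intro conjI allI impI)
  have top: "topspace (subtopology (mtop M) S) = S"
    using openin_subset[OF S] by auto
  have cont: "continuous_map (subtopology (mtop M) S) (mtop N) F"
    using F by (simp add: smooth_map_def)
  show sub: "F ` S \<subseteq> pts N"
    using continuous_map_image_subset_topspace[OF cont] top by simp
  have op: "openin (mtop M) {p \<in> S. F p \<in> T}" if "openin (mtop N) T" for T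
    using openin_continuous_map_preimage[OF cont that] S unfolding top
    by (simp add: openin_open_subtopology)
  fix T assume T: "openin (mtop N) T"
  show "openin (mtop M) {p \<in> S. F p \<in> T}" by (rule op[OF T])
  fix h assume h: "smooth_fun N T h"
  show "smooth_fun M {p \<in> S. F p \<in> T} (\<lambda>p. h (F p))"
  proof (intro smooth_funI smooth_on_local)
    fix U \<kappa> x assume c: "(U, \<kappa>) \<in> atlas M" and x: "x \<in> \<kappa> ` (U \<inter> {p \<in> S. F p \<in> T})"
    then obtain p where p: "p \<in> U" "p \<in> S" "F p \<in> T" "x = \<kappa> p" by auto
    obtain V \<psi> where d: "(V, \<psi>) \<in> atlas N" "F p \<in> V"
      by (rule charted_cover[OF N, of "F p"]) (use p sub in auto)
    \<comment> \<open>\<open>F\<close> sends \<open>W\<close> into a single chart of the target, so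
      on \<open>W\<close> the function \<open>h \<circ> F\<close> is the composition of the local
      representatives of \<open>F\<close> and of \<open>h\<close>.\<close>
    define W where "W = {p \<in> S. F p \<in> V \<inter> T}"
    have VT: "openin (mtop N) (V \<inter> T)" using chartedD(1)[OF N d(1)] T by auto
    have W: "open (\<kappa> ` (U \<inter> W))"
      unfolding W_def by (rule charted_open_image[OF M c op[OF VT]])
    have inj: "inj_on \<kappa> U" "inj_on \<psi> V" using chartedD(2) M N c d(1) by auto
    have "smooth_on (\<kappa> ` {p \<in> U \<inter> S. F p \<in> V}) (\<psi> \<circ> F \<circ> inv_into U \<kappa>)"
      using F c d(1) unfolding smooth_map_def by fastforce
    then have 1: "smooth_on (\<kappa> ` (U \<inter> W)) (\<psi> \<circ> F \<circ> inv_into U \<kappa>)"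
      by (rule smooth_on_subset) (auto simp: W_def)
    have 2: "(\<psi> \<circ> F \<circ> inv_into U \<kappa>) ` \<kappa> ` (U \<inter> W) \<subseteq> \<psi> ` (V \<inter> T)"
      using inj by (auto simp: W_def inv_into_f_f)
    have "smooth_on (\<kappa> ` (U \<inter> W)) (\<lambda>y. (h \<circ> inv_into V \<psi>) ((\<psi> \<circ> F \<circ> inv_into U \<kappa>) y))"
      by (rule smooth_on_compose[OF W charted_open_image[OF N d(1) T] 2 1 smooth_funD[OF h d(1)]])
    then have "smooth_on (\<kappa> ` (U \<inter> W)) (\<lambda>y. h (F (inv_into U \<kappa> y)))"
      by (rule smooth_on_cong[OF W, rotated]) (use inj in \<open>auto simp: W_def inv_into_f_f\<close>)
    moreover have "x \<in> \<kappa> ` (U \<inter> W)" using p d by (auto simp: W_def)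
    ultimately show "\<exists>T. open T \<and> x \<in> T \<and> smooth_on T (\<lambda>y. h (F (inv_into U \<kappa> y)))"
      using W by auto
  qed
qed

lemma inv_into_map_prod:
  assumes "inj_on \<kappa> U" "inj_on \<psi> V" "p \<in> U" "q \<in> V"
  shows "inv_into (U \<times> V) (map_prod \<kappa> \<psi>) (\<kappa> p, \<psi> q) = (p, q)"
  using inv_into_f_f[OF map_prod_inj_on[OF assms(1,2)], of "(p, q)"] assms(3,4) by simp

lemma smooth_pullback_fst:
  assumes M: "charted M" and N: "charted N"
  shows "smooth_pullback (prod_mfd M N) M (pts M \<times> pts N) fst"
  unfolding smooth_pullback_def
proof (intro conjI allI impI)
  show "fst ` (pts M \<times> pts N) \<subseteq> pts M" by auto
  fix T assume T: "openin (mtop M) T"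
  have eq: "{p \<in> pts M \<times> pts N. fst p \<in> T} = T \<times> pts N"
    using openin_subset[OF T] by auto
  show "openin (mtop (prod_mfd M N)) {p \<in> pts M \<times> pts N. fst p \<in> T}"
    using T unfolding eq prod_mfd_def by (simp add: openin_prod_Times_iff)
  fix h assume h: "smooth_fun M T h"
  show "smooth_fun (prod_mfd M N) {p \<in> pts M \<times> pts N. fst p \<in> T} (\<lambda>p. h (fst p))"
    unfolding eq
  proof (rule smooth_funI)
    fix W \<rho> assume "(W, \<rho>) \<in> atlas (prod_mfd M N)"
    then obtain U \<kappa> V \<psi> where c: "(U, \<kappa>) \<in> atlas M" "(V, \<psi>) \<in> atlas N"
      and W: "W = U \<times> V" "\<rho> = map_prod \<kappa> \<psi>"
      by (auto simp: prod_mfd_def)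
    have inj: "inj_on \<kappa> U" "inj_on \<psi> V" using chartedD(2) M N c by auto
    have V: "openin (mtop N) V" by (rule chartedD(1)[OF N c(2)])
    have img: "\<rho> ` (W \<inter> T \<times> pts N) = \<kappa> ` (U \<inter> T) \<times> \<psi> ` (V \<inter> V)"
      using openin_subset[OF V] unfolding W by (force simp: map_prod_def)
    have op: "open (\<rho> ` (W \<inter> T \<times> pts N))"
      unfolding img by (intro open_Times charted_open_image[OF M c(1) T] charted_open_image[OF N c(2) V])
    have "smooth_on (\<rho> ` (W \<inter> T \<times> pts N)) (\<lambda>y. (h \<circ> inv_into U \<kappa>) (fst y))"
      by (rule smooth_on_compose[OF op charted_open_image[OF M c(1) T] _
            smooth_on_linear[OF bounded_linear_fst op smooth_on_id] smooth_funD[OF h c(1)]])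
        (auto simp: img)
    then show "smooth_on (\<rho> ` (W \<inter> T \<times> pts N)) (\<lambda>y. h (fst (inv_into W \<rho> y)))"
      by (rule smooth_on_cong[OF op, rotated])
        (use inj in \<open>auto simp: img W inv_into_map_prod inv_into_f_f\<close>)
  qed
qed

text \<open>The inclusion of \<open>M\<close> at height \<open>t\<close>. Followed by the inverse of
  a trivialization it becomes a local section of the bundle.\<close>

lemma smooth_pullback_pair:
  assumes M: "charted M" and N: "charted N" and t: "t \<in> pts N"
  shows "smooth_pullback M (prod_mfd M N) (pts M) (\<lambda>x. (x, t))"
  unfolding smooth_pullback_def
proof (intro conjI allI impI)
  show "(\<lambda>x. (x, t)) ` pts M \<subseteq> pts (prod_mfd M N)"
    using t by (auto simp: prod_mfd_def)
  fix T assume T: "openin (mtop (prod_mfd M N)) T"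
  have "continuous_map (mtop M) (mtop (prod_mfd M N)) (\<lambda>x. (x, t))"
    unfolding prod_mfd_def using t by (simp add: continuous_map_pairedI)
  then show op: "openin (mtop M) {x \<in> pts M. (x, t) \<in> T}"
    using T by (rule openin_continuous_map_preimage)
  fix h assume h: "smooth_fun (prod_mfd M N) T h"
  show "smooth_fun M {x \<in> pts M. (x, t) \<in> T} (\<lambda>x. h (x, t))"
  proof (rule smooth_funI)
    fix U \<kappa> assume c: "(U, \<kappa>) \<in> atlas M"
    obtain V \<psi> where d: "(V, \<psi>) \<in> atlas N" "t \<in> V"
      by (rule charted_cover[OF N t])
    have inj: "inj_on \<kappa> U" "inj_on \<psi> V" using chartedD(2) M N c d by auto
    have cd: "(U \<times> V, map_prod \<kappa> \<psi>) \<in> atlas (prod_mfd M N)"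
      using c d(1) by (auto simp: prod_mfd_def)
    let ?A = "\<kappa> ` (U \<inter> {x \<in> pts M. (x, t) \<in> T})"
    have op': "open ?A" by (rule charted_open_image[OF M c op])
    have "smooth_on ?A (\<lambda>y. (y, 0) + (0, \<psi> t))"
      by (intro smooth_on_add op' smooth_on_const)
        (rule smooth_on_linear[OF bounded_linear_Pair[OF bounded_linear_ident bounded_linear_zero] op' smooth_on_id])
    then have 1: "smooth_on ?A (\<lambda>y. (y, \<psi> t))" by simp
    have "smooth_on ?A (\<lambda>y. (h \<circ> inv_into (U \<times> V) (map_prod \<kappa> \<psi>)) (y, \<psi> t))"
      by (rule smooth_on_compose[OF op' charted_open_image[OF charted_prod[OF M N] cd T] _ 1 smooth_funD[OF h cd]])
        (use d in \<open>auto intro!: image_eqI[where x = "(a, t)" for a]\<close>)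
    then show "smooth_on ?A (\<lambda>y. h (inv_into U \<kappa> y, t))"
      by (rule smooth_on_cong[OF op', rotated])
        (use inj d in \<open>auto simp: inv_into_map_prod inv_into_f_f\<close>)
  qed
qed

section \<open>Tangent vectors as derivations, tangent maps and coordinate fields\<close>

lemma tangent_spaceD:
  assumes "v \<in> tangent_space M p"
  shows "smooth_at M p f \<Longrightarrow> smooth_at M p h \<Longrightarrow> v (\<lambda>x. f x + h x) = v f + v h"
    "smooth_at M p f \<Longrightarrow> smooth_at M p h \<Longrightarrow> v (\<lambda>x. f x * h x) = f p * v h + h p * v f"
    "smooth_at M p f \<Longrightarrow> v (\<lambda>x. c * f x) = c * v f"
    "\<not> smooth_at M p f \<Longrightarrow> v f = 0"
  using assms unfolding tangent_space_def by simp_all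

lemma tangent_spaceI:
  assumes "\<And>f h. smooth_at M p f \<Longrightarrow> smooth_at M p h \<Longrightarrow> v (\<lambda>x. f x + h x) = v f + v h"
    "\<And>f h. smooth_at M p f \<Longrightarrow> smooth_at M p h \<Longrightarrow> v (\<lambda>x. f x * h x) = f p * v h + h p * v f"
    "\<And>f c. smooth_at M p f \<Longrightarrow> v (\<lambda>x. c * f x) = c * v f"
    "\<And>f. \<not> smooth_at M p f \<Longrightarrow> v f = 0"
  shows "v \<in> tangent_space M p"
  using assms unfolding tangent_space_def by simp

text \<open>Multiplying by the indicator function of \<open>W\<close> does not change the value of a derivation.\<close>
lemma tangent_space_local:
  assumes M: "charted M" and v: "v \<in> tangent_space M p" and W: "openin (mtop M) W" "p \<in> W"
    and eq: "\<And>x. x \<in> W \<Longrightarrow> f x = g x"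
  shows "v f = v g"
proof (cases "smooth_at M p f")
  case True
  then have g: "smooth_at M p g" by (rule smooth_at_cong[OF M W eq, rotated])
  define i where "i x = (if x \<in> W then 1 else 0 :: real)" for x
  have i: "smooth_at M p i"
    using W smooth_at_cong[OF M W, of "\<lambda>_. 1" i] smooth_at_const[of p M 1] openin_subset[OF W(1)]
    by (auto simp: i_def)
  have "v (\<lambda>x. i x * i x) = i p * v i + i p * v i"
    by (rule tangent_spaceD(2)[OF v i i])
  moreover have "(\<lambda>x. i x * i x) = i" by (auto simp: i_def)
  ultimately have "v i = 0" using W(2) by (simp add: i_def)
  then have "v (\<lambda>x. i x * f x) = v f" "v (\<lambda>x. i x * g x) = v g"
    using tangent_spaceD(2)[OF v i True] tangent_spaceD(2)[OF v i g] W(2) by (simp_all add: i_def)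
  moreover have "(\<lambda>x. i x * f x) = (\<lambda>x. i x * g x)"
    using eq by (auto simp: i_def)
  ultimately show ?thesis by simp
next
  case False
  then have "\<not> smooth_at M p g"
    using smooth_at_cong[OF M W, of g f] eq by auto
  then show ?thesis
    using False tangent_spaceD(4)[OF v] by simp
qed

lemma tangent_space_0: "(\<lambda>_. 0) \<in> tangent_space M p"
  by (rule tangent_spaceI) simp_all

lemma tangent_space_add:
  assumes "v \<in> tangent_space M p" "w \<in> tangent_space M p"
  shows "(\<lambda>f. r * v f + s * w f) \<in> tangent_space M p"
  by (rule tangent_spaceI)
    (simp_all add: tangent_spaceD[OF assms(1)] tangent_spaceD[OF assms(2)] algebra_simps)

lemma tangent_space_lincomb:
  assumes "\<And>i. b i \<in> tangent_space M p"
  shows "lincomb b c \<in> tangent_space M p"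
  by (rule tangent_spaceI)
    (simp_all add: lincomb_def tangent_spaceD[OF assms] sum.distrib sum_distrib_left algebra_simps)

lemma tangent_map_in:
  assumes N: "charted N" and F: "smooth_pullback M N S F" and p: "p \<in> S" and v: "v \<in> tangent_space M p"
  shows "tangent_map N F p v \<in> tangent_space N (F p)"
proof -
  have Fp: "F p \<in> pts N" by (rule smooth_pullbackD(1)[OF F p])
  show ?thesis
    by (rule tangent_spaceI)
      (simp_all add: tangent_map_def o_def smooth_at_add[OF N] smooth_at_mult[OF N] smooth_at_const[OF Fp]
        tangent_spaceD(1-3)[OF v] smooth_pullback_at[OF F p])
qed

lemma tangent_map_apply: "smooth_at N (F p) h \<Longrightarrow> tangent_map N F p v h = v (\<lambda>x. h (F x))"
  by (simp add: tangent_map_def o_def)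

lemma tangent_map_lincomb:
  "tangent_map N F p (lincomb b c) = lincomb (\<lambda>i. tangent_map N F p (b i)) c"
  by (auto simp: tangent_map_def lincomb_def fun_eq_iff)

lemma tangent_map_add:
  "tangent_map N F p (\<lambda>f. r * v f + s * w f) = (\<lambda>f. r * tangent_map N F p v f + s * tangent_map N F p w f)"
  by (auto simp: tangent_map_def fun_eq_iff)

lemma smooth_at_chart:
  assumes "charted M" "(U, \<kappa>) \<in> atlas M" "p \<in> U" "smooth_at M p f"
  obtains W where "open W" "\<kappa> p \<in> W" "W \<subseteq> \<kappa> ` U" "smooth_on W (\<lambda>y. f (inv_into U \<kappa> y))"
proof -
  obtain V where V: "openin (mtop M) V" "p \<in> V" "smooth_fun M V f"
    using assms(4) by (rule smooth_atE)
  show ?thesis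
    by (rule that[of "\<kappa> ` (U \<inter> V)"])
      (use V assms charted_open_image[OF assms(1,2) V(1)] smooth_funD[OF V(3) assms(2)] in \<open>auto simp: o_def\<close>)
qed

lemma smooth_at_has_derivative:
  assumes "charted M" "(U, \<kappa>) \<in> atlas M" "p \<in> U" "smooth_at M p f"
  shows "((\<lambda>y. f (inv_into U \<kappa> y)) has_derivative
    frechet_derivative (\<lambda>y. f (inv_into U \<kappa> y)) (at (\<kappa> p))) (at (\<kappa> p))"
  by (rule smooth_at_chart[OF assms]) (rule smooth_on_has_derivative)

lemma coord_field_apply:
  "smooth_at M p f \<Longrightarrow> coord_field M (U, \<kappa>) a p f
    = frechet_derivative (\<lambda>y. f (inv_into U \<kappa> y)) (at (\<kappa> p)) (axis a 1)"
  by (simp add: coord_field_def o_def)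

lemma coord_field_in:
  assumes M: "charted M" and c: "(U, \<kappa>) \<in> atlas M" and p: "p \<in> U"
  shows "coord_field M (U, \<kappa>) a p \<in> tangent_space M p"
proof (rule tangent_spaceI)
  note d = smooth_at_has_derivative[OF M c p]
  have pp: "p \<in> pts M" using openin_subset[OF chartedD(1)[OF M c]] p by auto
  have inv: "inv_into U \<kappa> (\<kappa> p) = p" using chartedD(2)[OF M c] p by (rule inv_into_f_f)
  fix f h assume f: "smooth_at M p f" 
  show "coord_field M (U, \<kappa>) a p (\<lambda>x. k * f x) = k * coord_field M (U, \<kappa>) a p f" for k
    using smooth_at_mult[OF M smooth_at_const[OF pp] f, of k] f
    by (simp add: coord_field_apply frechet_derivative_at[OF has_derivative_mult_right[OF d[OF f]], symmetric])
  assume h: "smooth_at M p h"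
  show "coord_field M (U, \<kappa>) a p (\<lambda>x. f x + h x) = coord_field M (U, \<kappa>) a p f + coord_field M (U, \<kappa>) a p h"
    using smooth_at_add[OF M f h] f h
    by (simp add: coord_field_apply frechet_derivative_at[OF has_derivative_add[OF d[OF f] d[OF h]], symmetric])
  show "coord_field M (U, \<kappa>) a p (\<lambda>x. f x * h x)
      = f p * coord_field M (U, \<kappa>) a p h + h p * coord_field M (U, \<kappa>) a p f"
    using smooth_at_mult[OF M f h] f h
    by (simp add: coord_field_apply frechet_derivative_at[OF has_derivative_mult[OF d[OF f] d[OF h]], symmetric] inv)
qed (simp add: coord_field_def)

lemma smooth_fun_coordinate:
  assumes "smooth_manifold M" "(U, \<kappa>) \<in> atlas M"
  shows "smooth_fun M U (\<lambda>x. \<kappa> x \<bullet> u)"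
proof (rule smooth_funI)
  fix V \<psi> assume d: "(V, \<psi>) \<in> atlas M"
  have M: "charted M" by (rule smooth_manifold_charted[OF assms(1)])
  have "smooth_on (\<psi> ` (V \<inter> U)) (\<kappa> \<circ> inv_into V \<psi>)"
    using assms d unfolding smooth_manifold_def by fastforce
  then show "smooth_on (\<psi> ` (V \<inter> U)) (\<lambda>y. \<kappa> (inv_into V \<psi> y) \<bullet> u)"
    using smooth_on_linear[OF bounded_linear_inner_left charted_open_image[OF M d chartedD(1)[OF M assms(2)]]]
    by (simp add: o_def)
qed

text \<open>Coordinate functions are dual to coordinate fields; testing against them is how
  coefficients of horizontal lifts are read off later.\<close>

lemma coord_field_coordinate:
  fixes M :: "('a, real^'m::finite) mfd"
  assumes sm: "smooth_manifold M" and c: "(U, \<kappa>) \<in> atlas M" and p: "p \<in> U"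
  shows "coord_field M (U, \<kappa>) a p (\<lambda>x. \<kappa> x \<bullet> axis b 1) = (if a = b then 1 else 0)"
proof -
  have M: "charted M" by (rule smooth_manifold_charted[OF sm])
  have U: "openin (mtop M) U" by (rule chartedD(1)[OF M c])
  have op: "open (\<kappa> ` U)" by (rule chartedD(3)[OF M c U]) simp
  have "frechet_derivative (\<lambda>y. \<kappa> (inv_into U \<kappa> y) \<bullet> axis b 1) (at (\<kappa> p))
      = frechet_derivative (\<lambda>y. y \<bullet> axis b 1) (at (\<kappa> p))"
    by (rule frechet_derivative_cong_open[OF op]) (use p in \<open>auto simp: f_inv_into_f\<close>)
  also have "\<dots> = (\<lambda>y. y \<bullet> axis b 1)"
    by (rule frechet_derivative_at[symmetric]) (rule bounded_linear_imp_has_derivative[OF bounded_linear_inner_left])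
  finally show ?thesis
    using coord_field_apply[OF smooth_atI[OF smooth_fun_coordinate[OF sm c] U p]]
    by (simp add: inner_axis_axis)
qed

text \<open>The chain rule for \<open>f\<close> read in the second chart, with the image of
  \<open>axis a 1\<close> under the transition derivative expanded in axes.\<close>

lemma coord_field_change:
  fixes M :: "('a, real^'m::finite) mfd"
  assumes sm: "smooth_manifold M" and c: "(U, \<kappa>) \<in> atlas M" and d: "(V, \<psi>) \<in> atlas M"
    and p: "p \<in> U" "p \<in> V"
  shows "coord_field M (U, \<kappa>) a p = lincomb (\<lambda>b. coord_field M (V, \<psi>) b p)
    (\<lambda>b. frechet_derivative (\<psi> \<circ> inv_into U \<kappa>) (at (\<kappa> p)) (axis a 1) $ b)"
proof (rule ext)
  fix f
  have M: "charted M" by (rule smooth_manifold_charted[OF sm])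
  have V: "openin (mtop M) V" by (rule chartedD(1)[OF M d])
  define D where "D = frechet_derivative (\<psi> \<circ> inv_into U \<kappa>) (at (\<kappa> p))"
  have op: "open (\<kappa> ` (U \<inter> V))" by (rule charted_open_image[OF M c V])
  have inj: "inj_on \<kappa> U" "inj_on \<psi> V" using chartedD(2)[OF M c] chartedD(2)[OF M d] by auto
  show "coord_field M (U, \<kappa>) a p f = lincomb (\<lambda>b. coord_field M (V, \<psi>) b p) (\<lambda>b. D (axis a 1) $ b) f"
  proof (cases "smooth_at M p f")
    case True
    let ?E = "frechet_derivative (\<lambda>y. f (inv_into V \<psi> y)) (at (\<psi> p))"
    have "smooth_on (\<kappa> ` (U \<inter> V)) (\<psi> \<circ> inv_into U \<kappa>)"
      using sm c d unfolding smooth_manifold_def by fastforce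
    then have D: "((\<lambda>y. \<psi> (inv_into U \<kappa> y)) has_derivative D) (at (\<kappa> p))"
      unfolding D_def using smooth_on_has_derivative[of "\<kappa> ` (U \<inter> V)" _ "\<kappa> p"] p by (simp add: o_def)
    have E: "((\<lambda>y. f (inv_into V \<psi> y)) has_derivative ?E) (at (\<psi> (inv_into U \<kappa> (\<kappa> p))))"
      using smooth_at_has_derivative[OF M d p(2) True] inv_into_f_f[OF inj(1) p(1)] by simp
    have "frechet_derivative (\<lambda>y. f (inv_into U \<kappa> y)) (at (\<kappa> p))
        = frechet_derivative (\<lambda>y. f (inv_into V \<psi> (\<psi> (inv_into U \<kappa> y)))) (at (\<kappa> p))"
      by (rule frechet_derivative_cong_open[OF op]) (use p inj in \<open>auto simp: inv_into_f_f\<close>)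
    also have "\<dots> = (\<lambda>v. ?E (D v))"
      by (rule frechet_derivative_at[symmetric]) (rule has_derivative_compose[OF D E])
    finally have "coord_field M (U, \<kappa>) a p f = ?E (D (axis a 1))"
      using True by (simp add: coord_field_apply)
    also have "\<dots> = ?E (\<Sum>b\<in>UNIV. D (axis a 1) $ b *\<^sub>R axis b 1)"
      using basis_expansion[of "D (axis a 1)"] by (simp add: scalar_mult_eq_scaleR)
    also have "\<dots> = (\<Sum>b\<in>UNIV. D (axis a 1) $ b *\<^sub>R ?E (axis b 1))"
    proof -
      interpret linear ?E by (rule has_derivative_linear[OF E])
      show ?thesis by (simp only: sum scale)
    qed
    finally show ?thesis
      using True by (simp add: lincomb_def coord_field_apply)
  qed (simp add: lincomb_def coord_field_def)
qed

section \<open>The reduced metric\<close>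

lemma smooth_fun_det:
  fixes F :: "'a \<Rightarrow> real^'n^'n::finite"
  assumes "charted M" "openin (mtop M) S" "\<And>i j. smooth_fun M S (\<lambda>x. F x $ i $ j)"
  shows "smooth_fun M S (\<lambda>x. det (F x))"
proof (rule smooth_funI)
  fix U \<kappa> assume c: "(U, \<kappa>) \<in> atlas M"
  show "smooth_on (\<kappa> ` (U \<inter> S)) (\<lambda>y. det (F (inv_into U \<kappa> y)))"
    by (rule smooth_on_det[OF charted_open_image[OF assms(1) c assms(2)]])
      (use smooth_funD[OF assms(3) c] in \<open>simp add: o_def\<close>)
qed

lemma smooth_fun_divide:
  assumes "charted M" "openin (mtop M) S" "smooth_fun M S f" "smooth_fun M S g"
    and "\<And>x. x \<in> S \<Longrightarrow> g x \<noteq> 0"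
  shows "smooth_fun M S (\<lambda>x. f x / g x)"
proof (rule smooth_funI)
  fix U \<kappa> assume c: "(U, \<kappa>) \<in> atlas M"
  have "g (inv_into U \<kappa> y) \<noteq> 0" if "y \<in> \<kappa> ` (U \<inter> S)" for y
    using that assms(5) chartedD(2)[OF assms(1) c] by (auto simp: inv_into_f_f)
  then show "smooth_on (\<kappa> ` (U \<inter> S)) (\<lambda>y. f (inv_into U \<kappa> y) / g (inv_into U \<kappa> y))"
    using smooth_on_divide[OF charted_open_image[OF assms(1) c assms(2)]
        smooth_funD[OF assms(3) c] smooth_funD[OF assms(4) c]] by (simp add: o_def)
qed

lemma lincomb_lincomb:
  fixes c :: "'i::finite \<Rightarrow> real" and d :: "'i \<Rightarrow> 'j::finite \<Rightarrow> real"
  shows "lincomb (\<lambda>i. lincomb Y (d i)) c = lincomb Y (\<lambda>j. \<Sum>i\<in>UNIV. c i * d i j)"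
proof (rule ext)
  fix f
  have "lincomb (\<lambda>i. lincomb Y (d i)) c f = (\<Sum>i\<in>UNIV. \<Sum>j\<in>UNIV. c i * d i j * Y j f)"
    by (simp add: lincomb_def sum_distrib_left mult.assoc)
  also have "\<dots> = (\<Sum>j\<in>UNIV. \<Sum>i\<in>UNIV. c i * d i j * Y j f)"
    by (rule sum.swap)
  finally show "lincomb (\<lambda>i. lincomb Y (d i)) c f = lincomb Y (\<lambda>j. \<Sum>i\<in>UNIV. c i * d i j) f"
    by (simp add: lincomb_def sum_distrib_right)
qed

lemma riemannian_metricD:
  assumes "riemannian_metric M g" "p \<in> pts M" "u \<in> tangent_space M p" "v \<in> tangent_space M p"
  shows "g p u v = g p v u" "u \<noteq> (\<lambda>_. 0) \<Longrightarrow> g p u u > 0"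
    "w \<in> tangent_space M p \<Longrightarrow> g p (\<lambda>f. r * u f + s * v f) w = r * g p u w + s * g p v w"
  using assms unfolding riemannian_metric_def by simp_all

lemma riemannian_metric_smooth:
  assumes "riemannian_metric M g" "openin (mtop M) W" "vector_field_on M W X" "vector_field_on M W Y"
  shows "smooth_fun M W (\<lambda>p. g p (X p) (Y p))"
  using assms unfolding riemannian_metric_def by simp

lemma riemannian_metric_lincomb:
  assumes g: "riemannian_metric M g" and p: "p \<in> pts M" and b: "\<And>i. b i \<in> tangent_space M p"
    and w: "w \<in> tangent_space M p"
  shows "g p (lincomb b c) w = (\<Sum>i\<in>UNIV. c i * g p (b i) w)"
proof -
  have "(\<lambda>f. \<Sum>i\<in>I. c i * b i f) \<in> tangent_space M p \<and>
      g p (\<lambda>f. \<Sum>i\<in>I. c i * b i f) w = (\<Sum>i\<in>I. c i * g p (b i) w)" if "finite I" for I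
    using that
  proof (induction I)
    case empty
    \<comment> \<open>Linearity with both coefficients zero gives the value of the metric at the
      zero vector.\<close>
    then show ?case
      using riemannian_metricD(3)[OF g p w w w, of 0 0] tangent_space_0[of M p] by simp
  next
    case (insert i I)
    then show ?case
      using tangent_space_add[OF b[of i], of _ "c i" 1] riemannian_metricD(3)[OF g p b[of i] _ w, of _ "c i" 1]
      by simp
  qed
  from this[OF finite] show ?thesis
    by (simp add: lincomb_def[abs_def])
qed

section \<open>The orbit projection, its local sections and horizontal lifts\<close>

locale chaplygin_sys =
  fixes S :: "('q, 'g, 'n::finite, 'k::finite, 'm::finite) chaplygin"
  assumes system: "chaplygin_system S"
begin

lemma Q_smooth: "smooth_manifold (Qman S)"
  using system unfolding chaplygin_system_def by (elim conjE)

lemma G_lie: "lie_group (grp S) (Gman S)"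
  using system unfolding chaplygin_system_def by (elim conjE)

lemma act_action: "group_action (grp S) (pts (Qman S)) (act S)"
  using system unfolding chaplygin_system_def by (elim conjE)

lemma principal: "principal_bundle S"
  using system unfolding chaplygin_system_def by (elim conjE)

lemma metric: "riemannian_metric (Qman S) (met S)"
  using system unfolding chaplygin_system_def by (elim conjE)

lemma met_act:
  "h \<in> carrier (grp S) \<Longrightarrow> q \<in> pts (Qman S) \<Longrightarrow> u \<in> tangent_space (Qman S) q \<Longrightarrow>
    v \<in> tangent_space (Qman S) q \<Longrightarrow>
    met S (act S h q) (tangent_map (Qman S) (act S h) q u) (tangent_map (Qman S) (act S h) q v) = met S q u v"
  using system unfolding chaplygin_system_def by simp

lemma hor_distribution: "distribution (Qman S) TYPE('m) (hor S)"
  using system unfolding chaplygin_system_def by (elim conjE)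

lemma hor_tangent: "q \<in> pts (Qman S) \<Longrightarrow> u \<in> hor S q \<Longrightarrow> u \<in> tangent_space (Qman S) q"
  using system unfolding chaplygin_system_def by (elim conjE) blast

lemma hor_act:
  "h \<in> carrier (grp S) \<Longrightarrow> q \<in> pts (Qman S) \<Longrightarrow>
    tangent_map (Qman S) (act S h) q ` hor S q = hor S (act S h q)"
  using system unfolding chaplygin_system_def by simp

lemma decomposition:
  "q \<in> pts (Qman S) \<Longrightarrow> v \<in> tangent_space (Qman S) q \<Longrightarrow>
    \<exists>!(u, w). u \<in> hor S q \<and> w \<in> vertical S q \<and> v = (\<lambda>f. u f + w f)"
  using system unfolding chaplygin_system_def by simp

lemma B_smooth: "smooth_manifold (Bman S)"
  using principal unfolding principal_bundle_def by (elim conjE)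

lemma pts_B: "pts (Bman S) = orbits (grp S) (pts (Qman S)) (act S)"
  using principal unfolding principal_bundle_def by (elim conjE)

lemma charted_Q: "charted (Qman S)"
  by (rule smooth_manifold_charted[OF Q_smooth])

lemma charted_B: "charted (Bman S)"
  by (rule smooth_manifold_charted[OF B_smooth])

lemma charted_G: "charted (Gman S)" and pts_G: "pts (Gman S) = carrier (grp S)"
  using G_lie smooth_manifold_charted unfolding lie_group_def by auto

lemma proj_in: "q \<in> pts (Qman S) \<Longrightarrow> proj S q \<in> pts (Bman S)"
  unfolding pts_B orbits_def by auto

lemma pts_B_proj: "x \<in> pts (Bman S) \<Longrightarrow> \<exists>q\<in>pts (Qman S). proj S q = x"
  unfolding pts_B orbits_def by auto

lemma act_in: "h \<in> carrier (grp S) \<Longrightarrow> q \<in> pts (Qman S) \<Longrightarrow> act S h q \<in> pts (Qman S)"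
  using group_action.element_image[OF act_action] by blast

text \<open>Right translation by \<open>h\<close> permutes the group elements that sweep out the
  orbit; the two inclusions use \<open>h\<close> and its inverse.\<close>

lemma proj_act:
  assumes h: "h \<in> carrier (grp S)" and q: "q \<in> pts (Qman S)"
  shows "proj S (act S h q) = proj S q"
proof -
  interpret A: group_action "grp S" "pts (Qman S)" "act S" by (rule act_action)
  have G: "group (grp S)" using G_lie by (simp add: lie_group_def)
  have "z \<in> proj S q" if "z \<in> proj S (act S h q)" for z
  proof -
    obtain g where g: "g \<in> carrier (grp S)" "z = act S g (act S h q)"
      using \<open>z \<in> proj S (act S h q)\<close> by (auto simp: orbit_def)
    then have "z = act S (g \<otimes>\<^bsub>grp S\<^esub> h) q"
      by (simp add: A.composition_rule[OF q g(1) h])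
    then show ?thesis
      using g h G by (auto simp: orbit_def intro: group.is_monoid monoid.m_closed)
  qed
  moreover have "z \<in> proj S (act S h q)" if "z \<in> proj S q" for z
  proof -
    obtain g where g: "g \<in> carrier (grp S)" "z = act S g q"
      using \<open>z \<in> proj S q\<close> by (auto simp: orbit_def)
    have i: "inv\<^bsub>grp S\<^esub> h \<in> carrier (grp S)"
      by (rule group.inv_closed[OF G h])
    have "act S (inv\<^bsub>grp S\<^esub> h) (act S h q) = q"
      using A.orbit_sym_aux[OF h q refl] .
    then have "z = act S (g \<otimes>\<^bsub>grp S\<^esub> inv\<^bsub>grp S\<^esub> h) (act S h q)"
      using g by (simp add: A.composition_rule[OF act_in[OF h q] g(1) i])
    then show ?thesis
      using g i G by (auto simp: orbit_def intro: group.is_monoid monoid.m_closed)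
  qed
  ultimately show ?thesis by blast
qed

text \<open>The section \<open>s\<close> keeps the group component of a trivialization constant at
  its value in \<open>q\<close>, which makes it pass through \<open>q\<close>. It transports
  functions from Q to Q/G and tangent vectors from Q/G to Q.\<close>

lemma trivialization:
  assumes q: "q \<in> pts (Qman S)"
  obtains U s where "openin (mtop (Bman S)) U" "proj S q \<in> U"
    "smooth_pullback (Qman S) (Bman S) (over S U) (proj S)"
    "smooth_pullback (Bman S) (Qman S) U s"
    "\<forall>x\<in>U. proj S (s x) = x" "s (proj S q) = q"
proof -
  let ?P = "prod_mfd (Bman S) (Gman S)"
  obtain U \<tau> where U: "openin (mtop (Bman S)) U" "proj S q \<in> U"
    and d: "diffeo (Qman S) ?P (over S U) (U \<times> carrier (grp S)) (\<lambda>q. (proj S q, \<tau> q))"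
    using principal proj_in[OF q] unfolding principal_bundle_def by (elim conjE) (drule (1) bspec, blast)
  define \<Phi> where "\<Phi> = (\<lambda>q. (proj S q, \<tau> q))"
  let ?I = "inv_into (over S U) \<Phi>"
  have d': "openin (mtop (Qman S)) (over S U)" "openin (mtop ?P) (U \<times> carrier (grp S))"
    "bij_betw \<Phi> (over S U) (U \<times> carrier (grp S))"
    "smooth_map (Qman S) ?P (over S U) \<Phi>" "smooth_map ?P (Qman S) (U \<times> carrier (grp S)) ?I"
    using d unfolding diffeo_def \<Phi>_def by simp_all
  have P: "charted ?P" by (rule charted_prod[OF charted_B charted_G])
  have ptsP: "pts ?P = pts (Bman S) \<times> pts (Gman S)" by (simp add: prod_mfd_def)
  have F: "smooth_pullback (Qman S) ?P (over S U) \<Phi>"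
    by (rule smooth_map_pullback[OF charted_Q P d'(1,4)])
  have I: "smooth_pullback ?P (Qman S) (U \<times> carrier (grp S)) ?I"
    by (rule smooth_map_pullback[OF P charted_Q d'(2,5)])
  have "{p \<in> over S U. \<Phi> p \<in> pts (Bman S) \<times> pts (Gman S)} = over S U"
    using smooth_pullbackD(1)[OF F] ptsP by auto
  then have 1: "smooth_pullback (Qman S) (Bman S) (over S U) (proj S)"
    using smooth_pullback_compose[OF F smooth_pullback_fst[OF charted_B charted_G]] by (simp add: \<Phi>_def)
  have qU: "q \<in> over S U" using q U by (simp add: over_def)
  then have t: "\<tau> q \<in> carrier (grp S)"
    using bij_betwE[OF d'(3)] by (auto simp: \<Phi>_def)
  have "{x \<in> pts (Bman S). (x, \<tau> q) \<in> U \<times> carrier (grp S)} = U"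
    using t openin_subset[OF U(1)] by auto
  then have 2: "smooth_pullback (Bman S) (Qman S) U (\<lambda>x. ?I (x, \<tau> q))"
    using smooth_pullback_compose[OF smooth_pullback_pair[OF charted_B charted_G] I, of "\<tau> q"] t
    by (simp add: pts_G)
  have "\<Phi> (?I (x, \<tau> q)) = (x, \<tau> q)" if "x \<in> U" for x
    using bij_betw_inv_into_right[OF d'(3)] that t by simp
  then have 3: "\<forall>x\<in>U. proj S (?I (x, \<tau> q)) = x"
    unfolding \<Phi>_def by simp
  have 4: "?I (proj S q, \<tau> q) = q"
    using bij_betw_inv_into_left[OF d'(3) qU] by (simp add: \<Phi>_def)
  show ?thesis
    by (rule that[OF U 1 2 3 4])
qed

lemma smooth_at_proj:
  assumes q: "q \<in> pts (Qman S)" and h: "smooth_at (Bman S) (proj S q) h"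
  shows "smooth_at (Qman S) q (\<lambda>p. h (proj S p))"
proof -
  obtain U s where U: "openin (mtop (Bman S)) U" "proj S q \<in> U"
    "smooth_pullback (Qman S) (Bman S) (over S U) (proj S)"
    "smooth_pullback (Bman S) (Qman S) U s"
    "\<forall>x\<in>U. proj S (s x) = x" "s (proj S q) = q"
    by (rule trivialization[OF q])
  show ?thesis
    by (rule smooth_pullback_at[where F = "proj S", OF U(3) _ h]) (use U(2) q in \<open>simp add: over_def\<close>)
qed

text \<open>Push \<open>w\<close> forward along a local section through \<open>q\<close>: section
  followed by projection is the identity near \<open>proj S q\<close>, and tangent vectors depend
  only on germs.\<close>

lemma tangent_proj_surj:
  assumes q: "q \<in> pts (Qman S)" and w: "w \<in> tangent_space (Bman S) (proj S q)"
  shows "\<exists>v\<in>tangent_space (Qman S) q. tangent_map (Bman S) (proj S) q v = w"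
proof -
  obtain U s where U: "openin (mtop (Bman S)) U" "proj S q \<in> U"
    and P: "smooth_pullback (Qman S) (Bman S) (over S U) (proj S)"
    and s: "smooth_pullback (Bman S) (Qman S) U s" "\<forall>x\<in>U. proj S (s x) = x" "s (proj S q) = q"
    by (rule trivialization[OF q])
  let ?v = "tangent_map (Qman S) s (proj S q) w"
  have "?v \<in> tangent_space (Qman S) q"
    using tangent_map_in[OF charted_Q s(1) U(2) w] s(3) by simp
  moreover have "tangent_map (Bman S) (proj S) q ?v h = w h" for h
  proof (cases "smooth_at (Bman S) (proj S q) h")
    case True
    have "tangent_map (Bman S) (proj S) q ?v h = ?v (\<lambda>p. h (proj S p))"
      by (rule tangent_map_apply[where F = "proj S", OF True])
    also have "\<dots> = w (\<lambda>x. h (proj S (s x)))"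
      by (rule tangent_map_apply[where F = s]) (use smooth_at_proj[OF q True] s(3) in simp)
    also have "\<dots> = w h"
      by (rule tangent_space_local[OF charted_B w U]) (simp add: s(2))
    finally show ?thesis .
  next
    case False
    then show ?thesis
      using tangent_spaceD(4)[OF w] by (simp add: tangent_map_def)
  qed
  ultimately show ?thesis by blast
qed

lemma hor_frame:
  assumes "q \<in> pts (Qman S)"
  shows "\<exists>W Y. openin (mtop (Qman S)) W \<and> q \<in> W \<and> (\<forall>i::'m. vector_field_on (Qman S) W (Y i)) \<and>
    (\<forall>x\<in>W. is_basis (\<lambda>i. Y i x) (hor S x))"
  using bspec[OF hor_distribution[unfolded distribution_def] assms]
  by (elim exE conjE) (intro exI conjI)

lemma hor_basis:
  assumes "q \<in> pts (Qman S)"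
  obtains Y :: "'m \<Rightarrow> 'q tvec" where "range (lincomb Y) = hor S q"
proof -
  obtain W and Y :: "'m \<Rightarrow> 'q \<Rightarrow> 'q tvec" where "q \<in> W" "\<forall>x\<in>W. is_basis (\<lambda>i. Y i x) (hor S x)"
    using hor_frame[OF assms] by (elim exE conjE)
  then show ?thesis
    using that[of "\<lambda>i. Y i q"] by (simp add: is_basis_def)
qed

text \<open>The distribution is known pointwise only as the span of a frame, so closure is obtained
  by rewriting each vector in that frame.\<close>

lemma hor_lincomb:
  assumes q: "q \<in> pts (Qman S)" and b: "\<And>i. b i \<in> hor S q"
  shows "lincomb b c \<in> hor S q"
proof -
  obtain Y :: "'m \<Rightarrow> 'q tvec" where Y: "range (lincomb Y) = hor S q"
    by (rule hor_basis[OF q])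
  then have "\<exists>d. b i = lincomb Y d" for i
    using b[of i] by auto
  then obtain d where "\<And>i. b i = lincomb Y (d i)" by metis
  then have "b = (\<lambda>i. lincomb Y (d i))" by auto
  then show ?thesis
    using Y by (auto simp: lincomb_lincomb)
qed

lemma hor_add:
  assumes q: "q \<in> pts (Qman S)" and "u \<in> hor S q" "w \<in> hor S q"
  shows "(\<lambda>f. r * u f + s * w f) \<in> hor S q"
proof -
  \<comment> \<open>Two vectors regarded as a family indexed by \<open>bool\<close>, which makes
    their combination a \<open>lincomb\<close>.\<close>
  have "lincomb (\<lambda>b. if b then u else w) (\<lambda>b. if b then r else s) \<in> hor S q"
    using assms by (intro hor_lincomb) auto
  then show ?thesis
    by (simp add: lincomb_def[abs_def] UNIV_bool add.commute)
qed

text \<open>The difference is horizontal and vertical at once. Reading it as purely horizontal and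
  as purely vertical gives two decompositions of one vector, and these must coincide.\<close>

lemma hor_lift_unique:
  assumes q: "q \<in> pts (Qman S)" and u: "u \<in> hor S q" and w: "w \<in> hor S q"
    and eq: "tangent_map (Bman S) (proj S) q u = tangent_map (Bman S) (proj S) q w"
  shows "u = w"
proof -
  define d where "d = (\<lambda>f. 1 * u f + (- 1) * w f)"
  have d: "d \<in> hor S q" unfolding d_def by (rule hor_add[OF q u w])
  have z: "(\<lambda>f. 0) \<in> hor S q" using hor_add[OF q u w, of 0 0] by simp
  have dt: "d \<in> tangent_space (Qman S) q" by (rule hor_tangent[OF q d])
  have "tangent_map (Bman S) (proj S) q d = (\<lambda>f. 1 * tangent_map (Bman S) (proj S) q u f
      + (- 1) * tangent_map (Bman S) (proj S) q w f)"
    unfolding d_def by (rule tangent_map_add)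
  then have dv: "d \<in> vertical S q"
    using dt by (simp add: vertical_def eq)
  have zv: "(\<lambda>f. 0) \<in> vertical S q"
    by (simp add: vertical_def tangent_space_0 tangent_map_def fun_eq_iff)
  let ?P = "\<lambda>(u, w). u \<in> hor S q \<and> w \<in> vertical S q \<and> d = (\<lambda>f. u f + w f)"
  have E: "\<exists>!z. ?P z"
    by (rule decomposition[OF q dt])
  have 1: "?P (d, \<lambda>f. 0)" and 2: "?P (\<lambda>f. 0, d)"
    using d z dv zv by simp_all
  have "(d, \<lambda>f. 0) = (\<lambda>f. 0, d)"
    by (rule trans[OF the1_equality[OF E 1, symmetric] the1_equality[OF E 2]])
  then have "d = (\<lambda>f. 0)" by (rule Pair_inject)
  then have "d f = 0" for f by (rule fun_cong)
  then show ?thesis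
    by (simp add: d_def fun_eq_iff)
qed

text \<open>Take the horizontal part of any lift; the discarded vertical part projects to
  zero.\<close>

lemma hor_lift_exists:
  assumes q: "q \<in> pts (Qman S)" and w: "w \<in> tangent_space (Bman S) (proj S q)"
  shows "\<exists>u\<in>hor S q. tangent_map (Bman S) (proj S) q u = w"
proof -
  obtain v where v: "v \<in> tangent_space (Qman S) q" "tangent_map (Bman S) (proj S) q v = w"
    using tangent_proj_surj[OF q w] by blast
  obtain u x where u: "u \<in> hor S q" "x \<in> vertical S q" "v = (\<lambda>f. u f + x f)"
    using decomposition[OF q v(1)] by auto
  have "tangent_map (Bman S) (proj S) q x = (\<lambda>_. 0)"
    using u(2) by (simp add: vertical_def)
  then have "tangent_map (Bman S) (proj S) q v = tangent_map (Bman S) (proj S) q u"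
    using tangent_map_add[of "Bman S" "proj S" q 1 u 1 x] u(3) by simp
  then show ?thesis using u(1) v(2) by auto
qed

lemma over_iff: "q \<in> over S U \<longleftrightarrow> q \<in> pts (Qman S) \<and> proj S q \<in> U"
  by (simp add: over_def)

lemma hlift_eqI:
  assumes "q \<in> pts (Qman S)" "v \<in> hor S q"
    "tangent_map (Bman S) (proj S) q v = coord_field (Bman S) c a (proj S q)"
  shows "hlift S c a q = v"
  unfolding hlift_def using assms hor_lift_unique[OF assms(1)] by (intro the_equality) auto

lemma hlift:
  assumes c: "(U, \<kappa>) \<in> atlas (Bman S)" and q: "q \<in> over S U"
  shows "hlift S (U, \<kappa>) a q \<in> hor S q"
    "tangent_map (Bman S) (proj S) q (hlift S (U, \<kappa>) a q) = coord_field (Bman S) (U, \<kappa>) a (proj S q)"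
proof -
  have q': "q \<in> pts (Qman S)" "proj S q \<in> U" using q by (auto simp: over_iff)
  obtain u where u: "u \<in> hor S q" "tangent_map (Bman S) (proj S) q u = coord_field (Bman S) (U, \<kappa>) a (proj S q)"
    using hor_lift_exists[OF q'(1) coord_field_in[OF charted_B c q'(2)]] by blast
  then show "hlift S (U, \<kappa>) a q \<in> hor S q"
    "tangent_map (Bman S) (proj S) q (hlift S (U, \<kappa>) a q) = coord_field (Bman S) (U, \<kappa>) a (proj S q)"
    using hlift_eqI[OF q'(1) u] by simp_all
qed

lemma hlift_tangent:
  assumes "(U, \<kappa>) \<in> atlas (Bman S)" "q \<in> over S U"
  shows "hlift S (U, \<kappa>) a q \<in> tangent_space (Qman S) q"
  using hor_tangent hlift(1)[OF assms] assms(2) by (simp add: over_iff)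

text \<open>The pushed-forward lift is again horizontal and still projects to the coordinate field,
  because \<open>proj S\<close> does not see the action; uniqueness of lifts identifies it.\<close>

lemma hlift_act:
  assumes c: "(U, \<kappa>) \<in> atlas (Bman S)" and q: "q \<in> over S U" and h: "h \<in> carrier (grp S)"
  shows "hlift S (U, \<kappa>) a (act S h q) = tangent_map (Qman S) (act S h) q (hlift S (U, \<kappa>) a q)"
proof (rule hlift_eqI)
  let ?v = "hlift S (U, \<kappa>) a q" and ?T = "tangent_map (Qman S) (act S h) q (hlift S (U, \<kappa>) a q)"
  have q': "q \<in> pts (Qman S)" "proj S q \<in> U" using q by (auto simp: over_iff)
  show hq: "act S h q \<in> pts (Qman S)" by (rule act_in[OF h q'(1)])
  show "?T \<in> hor S (act S h q)"
    using hor_act[OF h q'(1)] hlift(1)[OF c q, of a] by blast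
  have "tangent_map (Bman S) (proj S) (act S h q) ?T f = tangent_map (Bman S) (proj S) q ?v f" for f
  proof (cases "smooth_at (Bman S) (proj S q) f")
    case True
    then have f': "smooth_at (Bman S) (proj S (act S h q)) f"
      by (simp add: proj_act[OF h q'(1)])
    have "tangent_map (Bman S) (proj S) (act S h q) ?T f = ?T (\<lambda>p. f (proj S p))"
      by (rule tangent_map_apply[where F = "proj S", OF f'])
    also have "\<dots> = ?v (\<lambda>p. f (proj S (act S h p)))"
      by (rule tangent_map_apply[where F = "act S h", OF smooth_at_proj[OF hq f']])
    also have "\<dots> = ?v (\<lambda>p. f (proj S p))"
      by (rule tangent_space_local[OF charted_Q hlift_tangent[OF c q] openin_topspace q'(1)])
        (simp add: proj_act[OF h])
    also have "\<dots> = tangent_map (Bman S) (proj S) q ?v f"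
      by (rule tangent_map_apply[where F = "proj S", OF True, symmetric])
    finally show ?thesis .
  next
    case False
    then show ?thesis by (simp add: tangent_map_def proj_act[OF h q'(1)])
  qed
  then have "tangent_map (Bman S) (proj S) (act S h q) ?T = tangent_map (Bman S) (proj S) q ?v" by (rule ext)
  then show "tangent_map (Bman S) (proj S) (act S h q) ?T
      = coord_field (Bman S) (U, \<kappa>) a (proj S (act S h q))"
    by (simp add: hlift(2)[OF c q] proj_act[OF h q'(1)])
qed

text \<open>\<open>on_quotient\<close> evaluates at an arbitrarily chosen point of the orbit. That
  point is \<open>act S h q\<close> for some \<open>h\<close>; the lifts are equivariant and the
  metric is invariant, so \<open>q\<close> gives the same value.\<close>

lemma gred_proj:
  assumes c: "(U, \<kappa>) \<in> atlas (Bman S)" and q: "q \<in> over S U"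
  shows "gred S (U, \<kappa>) a b (proj S q) = Gaa S (U, \<kappa>) a b q"
proof -
  have q': "q \<in> pts (Qman S)" using q by (simp add: over_iff)
  have "q \<in> proj S q" by (rule group_action.orbit_refl[OF act_action q'])
  then have "(SOME p. p \<in> proj S q) \<in> proj S q" by (rule someI)
  then obtain h where h: "h \<in> carrier (grp S)" "(SOME p. p \<in> proj S q) = act S h q"
    by (auto simp: orbit_def)
  then show ?thesis
    unfolding gred_def on_quotient_def
    by (simp add: Gaa_def hlift_act[OF c q] met_act[OF h(1) q' hlift_tangent[OF c q] hlift_tangent[OF c q]])
qed

section \<open>The reduced metric: positivity, tensor law and smoothness\<close>

lemma chart_lift:
  assumes c: "(U, \<kappa>) \<in> atlas (Bman S)" and x: "x \<in> U"
  obtains q where "q \<in> over S U" "proj S q = x"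
proof -
  have "x \<in> pts (Bman S)" using openin_subset[OF chartedD(1)[OF charted_B c]] x by auto
  then show ?thesis
    using pts_B_proj x that by (auto simp: over_iff)
qed

lemma gred_sym:
  assumes c: "(U, \<kappa>) \<in> atlas (Bman S)" and x: "x \<in> U"
  shows "gred S (U, \<kappa>) a b x = gred S (U, \<kappa>) b a x"
proof -
  obtain q where q: "q \<in> over S U" "proj S q = x" by (rule chart_lift[OF c x])
  then have "met S q (hlift S (U, \<kappa>) a q) (hlift S (U, \<kappa>) b q) = met S q (hlift S (U, \<kappa>) b q) (hlift S (U, \<kappa>) a q)"
    by (intro riemannian_metricD(1)[OF metric] hlift_tangent[OF c]) (simp_all add: over_iff)
  then show ?thesis
    using gred_proj[OF c q(1)] q(2) by (simp add: Gaa_def)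
qed

lemma met_lincomb_hlift:
  assumes c: "(U, \<kappa>) \<in> atlas (Bman S)" and q: "q \<in> over S U"
  shows "met S q (lincomb (\<lambda>a. hlift S (U, \<kappa>) a q) s) (lincomb (\<lambda>a. hlift S (U, \<kappa>) a q) t)
    = (\<Sum>a\<in>UNIV. \<Sum>b\<in>UNIV. s a * t b * gred S (U, \<kappa>) a b (proj S q))"
proof -
  let ?h = "\<lambda>a. hlift S (U, \<kappa>) a q"
  have q': "q \<in> pts (Qman S)" using q by (simp add: over_iff)
  note ht = hlift_tangent[OF c q] and ll = tangent_space_lincomb[of ?h "Qman S" q, OF hlift_tangent[OF c q]]
  have "met S q (?h a) (lincomb ?h t) = (\<Sum>b\<in>UNIV. t b * gred S (U, \<kappa>) a b (proj S q))" for a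
  proof -
    have "met S q (?h a) (lincomb ?h t) = met S q (lincomb ?h t) (?h a)"
      by (rule riemannian_metricD(1)[OF metric q' ht ll])
    also have "\<dots> = (\<Sum>b\<in>UNIV. t b * met S q (?h b) (?h a))"
      by (rule riemannian_metric_lincomb[OF metric q' ht ht])
    also have "\<dots> = (\<Sum>b\<in>UNIV. t b * gred S (U, \<kappa>) a b (proj S q))"
      using riemannian_metricD(1)[OF metric q' ht ht] by (simp add: gred_proj[OF c q] Gaa_def)
    finally show ?thesis .
  qed
  then show ?thesis
    by (simp add: riemannian_metric_lincomb[OF metric q' ht ll] sum_distrib_left mult.assoc)
qed

lemma smooth_at_coordinate:
  assumes c: "(U, \<kappa>) \<in> atlas (Bman S)" and x: "x \<in> U"
  shows "smooth_at (Bman S) x (\<lambda>x. \<kappa> x \<bullet> axis b 1)"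
  by (rule smooth_atI[OF smooth_fun_coordinate[OF B_smooth c] chartedD(1)[OF charted_B c] x])

lemma hlift_coordinate:
  assumes c: "(U, \<kappa>) \<in> atlas (Bman S)" and q: "q \<in> over S U"
  shows "hlift S (U, \<kappa>) a q (\<lambda>p. \<kappa> (proj S p) \<bullet> axis b 1) = (if a = b then 1 else 0)"
proof -
  have x: "proj S q \<in> U" using q by (simp add: over_iff)
  have "hlift S (U, \<kappa>) a q (\<lambda>p. \<kappa> (proj S p) \<bullet> axis b 1)
      = tangent_map (Bman S) (proj S) q (hlift S (U, \<kappa>) a q) (\<lambda>x. \<kappa> x \<bullet> axis b 1)"
    by (rule tangent_map_apply[where F = "proj S", OF smooth_at_coordinate[OF c x], symmetric])
  then show ?thesis
    by (simp add: hlift(2)[OF c q] coord_field_coordinate[OF B_smooth c x])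
qed

text \<open>The combination of lifts with coefficients \<open>t\<close> differentiates the base
  coordinate \<open>b\<close> to \<open>t b\<close>, hence is a nonzero vector on Q, where the
  metric is positive.\<close>

lemma gred_pos:
  assumes c: "(U, \<kappa>) \<in> atlas (Bman S)" and x: "x \<in> U" and t: "t \<noteq> (\<lambda>_. 0)"
  shows "(\<Sum>a\<in>UNIV. \<Sum>b\<in>UNIV. t a * t b * gred S (U, \<kappa>) a b x) > 0"
proof -
  obtain q where q: "q \<in> over S U" "proj S q = x" by (rule chart_lift[OF c x])
  let ?v = "lincomb (\<lambda>a. hlift S (U, \<kappa>) a q) t"
  have v: "?v \<in> tangent_space (Qman S) q"
    by (rule tangent_space_lincomb) (rule hlift_tangent[OF c q(1)])
  obtain b where b: "t b \<noteq> 0" using t by auto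
  have "?v (\<lambda>p. \<kappa> (proj S p) \<bullet> axis b 1) = t b"
    by (simp add: lincomb_def hlift_coordinate[OF c q(1)] if_distrib cong: if_cong)
  then have "?v \<noteq> (\<lambda>_. 0)" using b by auto
  then have "met S q ?v ?v > 0"
    by (intro riemannian_metricD(2)[OF metric _ v v]) (use q in \<open>simp add: over_iff\<close>)
  then show ?thesis
    by (simp add: met_lincomb_hlift[OF c q(1)] q(2))
qed

text \<open>A kernel vector would have zero length for a positive definite form, so the matrix is
  injective and has a left inverse.\<close>

lemma gred_det:
  assumes c: "(U, \<kappa>) \<in> atlas (Bman S)" and x: "x \<in> U"
  shows "det (\<chi> a b. gred S (U, \<kappa>) a b x) \<noteq> 0"
proof -
  let ?g = "\<chi> a b. gred S (U, \<kappa>) a b x"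
  have "t = 0" if "?g *v t = 0" for t
  proof (rule ccontr)
    assume "t \<noteq> 0"
    then have "($) t \<noteq> (\<lambda>_. 0)" by (auto simp: vec_eq_iff fun_eq_iff)
    then have "(\<Sum>a\<in>UNIV. \<Sum>b\<in>UNIV. t $ a * t $ b * gred S (U, \<kappa>) a b x) > 0"
      by (rule gred_pos[OF c x])
    moreover have "(\<Sum>a\<in>UNIV. \<Sum>b\<in>UNIV. t $ a * t $ b * gred S (U, \<kappa>) a b x) = (\<Sum>a\<in>UNIV. t $ a * (?g *v t) $ a)"
      by (simp add: matrix_vector_mult_def sum_distrib_left ac_simps)
    ultimately show False
      using that by simp
  qed
  then have "\<exists>B. B ** ?g = mat 1"
    by (simp add: matrix_left_invertible_ker)
  then show ?thesis
    by (metis det_I det_mul mult_zero_right zero_neq_one)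
qed

text \<open>By uniqueness of lifts the lifted frames of two charts are related by the same Jacobian
  as the coordinate fields; the rest is bilinearity of the metric.\<close>

lemma gred_change:
  assumes c: "(U, \<kappa>) \<in> atlas (Bman S)" and d: "(V, \<psi>) \<in> atlas (Bman S)" and x: "x \<in> U" "x \<in> V"
  defines "J \<equiv> frechet_derivative (\<psi> \<circ> inv_into U \<kappa>) (at (\<kappa> x))"
  shows "gred S (U, \<kappa>) a b x
    = (\<Sum>i\<in>UNIV. \<Sum>j\<in>UNIV. J (axis a 1) $ i * J (axis b 1) $ j * gred S (V, \<psi>) i j x)"
proof -
  obtain q where q: "q \<in> over S U" "proj S q = x" by (rule chart_lift[OF c x(1)])
  then have q': "q \<in> over S V" "q \<in> pts (Qman S)" using x by (auto simp: over_iff)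
  have "hlift S (U, \<kappa>) a q = lincomb (\<lambda>b. hlift S (V, \<psi>) b q) (($) (J (axis a 1)))" for a
  proof (rule hlift_eqI[OF q'(2)])
    show "lincomb (\<lambda>b. hlift S (V, \<psi>) b q) (($) (J (axis a 1))) \<in> hor S q"
      by (rule hor_lincomb[OF q'(2) hlift(1)[OF d q'(1)]])
    show "tangent_map (Bman S) (proj S) q (lincomb (\<lambda>b. hlift S (V, \<psi>) b q) (($) (J (axis a 1))))
        = coord_field (Bman S) (U, \<kappa>) a (proj S q)"
      unfolding tangent_map_lincomb hlift(2)[OF d q'(1)] q(2) coord_field_change[OF B_smooth c d x] J_def ..
  qed
  then have "Gaa S (U, \<kappa>) a b q
      = (\<Sum>i\<in>UNIV. \<Sum>j\<in>UNIV. J (axis a 1) $ i * J (axis b 1) $ j * gred S (V, \<psi>) i j x)"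
    using met_lincomb_hlift[OF d q'(1)] by (simp add: Gaa_def q(2))
  then show ?thesis
    using gred_proj[OF c q(1)] q(2) by simp
qed

lemma vector_field_onD:
  assumes "vector_field_on M W X"
  shows "p \<in> W \<Longrightarrow> X p \<in> tangent_space M p"
    "openin (mtop M) V \<Longrightarrow> V \<subseteq> W \<Longrightarrow> smooth_fun M V f \<Longrightarrow> smooth_fun M V (\<lambda>p. X p f)"
  using assms unfolding vector_field_on_def by simp_all

text \<open>In a local frame \<open>Y\<close> of the distribution the coefficients of the horizontal lifts solve a
  linear system with smooth coefficients, so they are smooth by Cramer's rule.\<close>
lemma hlift_vector_field:
  assumes c: "(U, \<kappa>) \<in> atlas (Bman S)" and q: "q \<in> over S U"
  obtains W where "openin (mtop (Qman S)) W" "q \<in> W" "W \<subseteq> over S U"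
    "\<forall>a. vector_field_on (Qman S) W (hlift S (U, \<kappa>) a)"
proof -
  have q': "q \<in> pts (Qman S)" "proj S q \<in> U" using q by (auto simp: over_iff)
  obtain W0 Y where W0: "openin (mtop (Qman S)) W0" "q \<in> W0"
    and Y: "\<forall>i::'m. vector_field_on (Qman S) W0 (Y i)" "\<forall>x\<in>W0. is_basis (\<lambda>i. Y i x) (hor S x)"
    using hor_frame[OF q'(1)] by (elim exE conjE)
  obtain T s where T: "openin (mtop (Bman S)) T" "proj S q \<in> T"
    and P: "smooth_pullback (Qman S) (Bman S) (over S T) (proj S)"
    and "smooth_pullback (Bman S) (Qman S) T s" "\<forall>x\<in>T. proj S (s x) = x" "s (proj S q) = q"
    by (rule trivialization[OF q'(1)])
  have U: "openin (mtop (Bman S)) U" by (rule chartedD(1)[OF charted_B c])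
  define V where "V = {p \<in> over S T. proj S p \<in> U}"
  define W where "W = W0 \<inter> V"
  have W: "openin (mtop (Qman S)) W"
    unfolding W_def V_def by (intro openin_Int W0 smooth_pullbackD(2)[OF P U])
  have WU: "p \<in> over S U" if "p \<in> W" for p
    using that by (auto simp: W_def V_def over_iff)
  \<comment> \<open>\<open>M p\<close> is the matrix of the tangent map of \<open>proj S\<close>
    with respect to the frame \<open>Y\<close> and the coordinate fields. The coefficients of the
    lifts are the columns of the inverse of its transpose \<open>A p\<close>.\<close>
  define M where "M p i b = Y i p (\<lambda>x. \<kappa> (proj S x) \<bullet> axis b 1)" for p i b
  have M: "smooth_fun (Qman S) W (\<lambda>p. M p i b)" for i b
  proof -
    have "smooth_fun (Qman S) V (\<lambda>x. \<kappa> (proj S x) \<bullet> axis b 1)"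
      unfolding V_def by (rule smooth_pullbackD(3)[OF P U smooth_fun_coordinate[OF B_smooth c]])
    then have "smooth_fun (Qman S) W (\<lambda>x. \<kappa> (proj S x) \<bullet> axis b 1)"
      by (rule smooth_fun_subset) (simp add: W_def)
    then show ?thesis
      unfolding M_def by (rule vector_field_onD(2)[OF spec[OF Y(1)] W, rotated]) (simp add: W_def)
  qed
  define C where "C p a = (SOME z. hlift S (U, \<kappa>) a p = lincomb (\<lambda>i. Y i p) z)" for p a
  have C: "hlift S (U, \<kappa>) a p = lincomb (\<lambda>i. Y i p) (C p a)" if "p \<in> W" for p a
  proof -
    have "hlift S (U, \<kappa>) a p \<in> range (lincomb (\<lambda>i. Y i p))"
      using hlift(1)[OF c WU[OF that]] Y(2) that by (simp add: W_def is_basis_def)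
    then have "\<exists>z. hlift S (U, \<kappa>) a p = lincomb (\<lambda>i. Y i p) z" by auto
    then show ?thesis unfolding C_def by (rule someI_ex)
  qed
  define A where "A p = (\<chi> b i. M p i b)" for p
  have AC: "A p *v (\<chi> i. C p a i) = axis a 1" if "p \<in> W" for p a
  proof -
    have "(\<Sum>i\<in>UNIV. M p i b * C p a i) = (if a = b then 1 else 0)" for b
      using hlift_coordinate[OF c WU[OF that], of a b] unfolding C[OF that]
      by (simp add: lincomb_def M_def mult.commute)
    then show ?thesis
      by (simp add: A_def matrix_vector_mult_def vec_eq_iff axis_def eq_commute)
  qed
  have detA: "det (A p) \<noteq> 0" if "p \<in> W" for p
  proof -
    have "A p ** (\<chi> i a. C p a i) = mat 1"
      using AC[OF that] by (simp add: matrix_matrix_mult_def matrix_vector_mult_def vec_eq_iff mat_def axis_def)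
    then show ?thesis
      by (metis det_I det_mul mult_zero_left zero_neq_one)
  qed
  have smC: "smooth_fun (Qman S) W (\<lambda>p. C p a i)" for a i
  proof -
    \<comment> \<open>Column \<open>i\<close> of \<open>A p\<close> replaced by the right-hand side
      \<open>axis a 1\<close>: the numerator of Cramer's rule.\<close>
    let ?N = "\<lambda>p. \<chi> r j. if j = i then axis a 1 $ r else A p $ r $ j"
    have quot: "smooth_fun (Qman S) W (\<lambda>p. det (?N p) / det (A p))"
    proof (rule smooth_fun_divide[OF charted_Q W _ _ detA])
      show "smooth_fun (Qman S) W (\<lambda>p. det (A p))"
        by (rule smooth_fun_det[OF charted_Q W]) (simp add: A_def M)
      show "smooth_fun (Qman S) W (\<lambda>p. det (?N p))"
      proof (rule smooth_fun_det[OF charted_Q W])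
        show "smooth_fun (Qman S) W (\<lambda>p. ?N p $ r $ j)" for r j
          by (cases "j = i") (simp_all add: A_def M smooth_fun_const)
      qed
    qed
    have eq: "det (?N p) / det (A p) = C p a i" if "p \<in> W" for p
    proof -
      have "(\<chi> i. C p a i) = (\<chi> k. det (\<chi> r j. if j = k then axis a 1 $ r else A p $ r $ j) / det (A p))"
        using AC[OF that] cramer[OF detA[OF that]] by blast
      from arg_cong[OF this, of "\<lambda>v. v $ i"] show ?thesis by simp
    qed
    show ?thesis
      by (rule smooth_fun_cong[OF charted_Q W eq quot])
  qed
  have "vector_field_on (Qman S) W (hlift S (U, \<kappa>) a)" for a
    unfolding vector_field_on_def
  proof (intro conjI ballI allI impI)
    show "hlift S (U, \<kappa>) a p \<in> tangent_space (Qman S) p" if "p \<in> W" for p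
      by (rule hlift_tangent[OF c WU[OF that]])
    fix W1 f assume W1: "openin (mtop (Qman S)) W1" "W1 \<subseteq> W" and f: "smooth_fun (Qman S) W1 f"
    have "smooth_fun (Qman S) W1 (\<lambda>p. \<Sum>i\<in>UNIV. C p a i * Y i p f)"
    proof (intro smooth_fun_sum[OF charted_Q W1(1)] smooth_fun_mult[OF charted_Q W1(1)])
      show "smooth_fun (Qman S) W1 (\<lambda>p. C p a i)" for i
        by (rule smooth_fun_subset[OF smC W1(2)])
      show "smooth_fun (Qman S) W1 (\<lambda>p. Y i p f)" for i
        by (rule vector_field_onD(2)[OF spec[OF Y(1)] W1(1) _ f]) (use W1(2) in \<open>auto simp: W_def\<close>)
    qed
    then show "smooth_fun (Qman S) W1 (\<lambda>p. hlift S (U, \<kappa>) a p f)"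
      by (rule smooth_fun_cong[OF charted_Q W1(1), rotated]) (use W1(2) C in \<open>auto simp: lincomb_def\<close>)
  qed
  moreover have "q \<in> W"
    using W0 T q' by (simp add: W_def V_def over_iff)
  moreover have "W \<subseteq> over S U" using WU by blast
  ultimately show ?thesis using that[OF W] by simp
qed

text \<open>Along a local section \<open>s\<close> the reduced metric equals \<open>Gaa\<close> at
  \<open>s x\<close>, a smooth function on Q composed with a smooth map.\<close>

lemma gred_smooth:
  assumes c: "(U, \<kappa>) \<in> atlas (Bman S)"
  shows "smooth_on (\<kappa> ` U) (\<lambda>y. gred S (U, \<kappa>) a b (inv_into U \<kappa> y))"
proof (rule smooth_on_local)
  fix y assume "y \<in> \<kappa> ` U"
  then obtain x where x: "x \<in> U" "y = \<kappa> x" by auto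
  obtain q where q: "q \<in> over S U" "proj S q = x" by (rule chart_lift[OF c x(1)])
  have q': "q \<in> pts (Qman S)" using q by (simp add: over_iff)
  obtain W where W: "openin (mtop (Qman S)) W" "q \<in> W" "W \<subseteq> over S U"
    and vf: "\<forall>a. vector_field_on (Qman S) W (hlift S (U, \<kappa>) a)"
    by (rule hlift_vector_field[OF c q(1)])
  obtain V s where V: "openin (mtop (Bman S)) V" "proj S q \<in> V"
    and P: "smooth_pullback (Qman S) (Bman S) (over S V) (proj S)"
    and s: "smooth_pullback (Bman S) (Qman S) V s" "\<forall>x\<in>V. proj S (s x) = x" "s (proj S q) = q"
    by (rule trivialization[OF q'])
  define T where "T = {x \<in> V. s x \<in> W}"
  have T: "openin (mtop (Bman S)) T" "x \<in> T"
    unfolding T_def using smooth_pullbackD(2)[OF s(1) W(1)] V q s(3) W(2) by auto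
  have "smooth_fun (Qman S) W (Gaa S (U, \<kappa>) a b)"
    unfolding Gaa_def[abs_def] by (rule riemannian_metric_smooth[OF metric W(1) spec[OF vf] spec[OF vf]])
  then have "smooth_fun (Bman S) T (\<lambda>x. Gaa S (U, \<kappa>) a b (s x))"
    unfolding T_def by (rule smooth_pullbackD(3)[OF s(1) W(1)])
  then have "smooth_fun (Bman S) T (gred S (U, \<kappa>) a b)"
  proof (rule smooth_fun_cong[OF charted_B T(1), rotated])
    fix z assume z: "z \<in> T"
    then have "s z \<in> over S U" "proj S (s z) = z" using W(3) s(2) by (auto simp: T_def)
    then show "Gaa S (U, \<kappa>) a b (s z) = gred S (U, \<kappa>) a b z"
      using gred_proj[OF c] by metis
  qed
  from smooth_funD[OF this c] show "\<exists>T. open T \<and> y \<in> T \<and> smooth_on T (\<lambda>y. gred S (U, \<kappa>) a b (inv_into U \<kappa> y))"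
    using charted_open_image[OF charted_B c T(1)] x T(2) by (auto simp: o_def)
qed

end

section \<open>The Lagrangian two-form in coordinates\<close>

definition omega0 :: "((real^'m::finite) \<times> (real^'m)) covec" where
  "omega0 v = fst (v 0) \<bullet> snd (v 1) - fst (v 1) \<bullet> snd (v 0)"

lemma alternating_form_omega0: "alternating_form 2 omega0"
proof (rule alternating_formI)
  show "omega0 v = omega0 w" if "\<forall>i<2. v i = w i" for v w :: "nat \<Rightarrow> (real^'m) \<times> (real^'m)"
    using that by (simp add: omega0_def)
  show "linear (\<lambda>u. omega0 (v(i := u)))" if "i < 2" for v :: "nat \<Rightarrow> (real^'m) \<times> (real^'m)" and i
    using that by (cases "i = 0") (auto simp: omega0_def linear_iff inner_simps algebra_simps)
  show "omega0 v = 0" if "i < 2" "j < 2" "i \<noteq> j" "v i = v j"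
    for v :: "nat \<Rightarrow> (real^'m) \<times> (real^'m)" and i j
    using that by (auto simp: omega0_def less_2_cases_iff)
qed

lemma omega0_power_nonzero:
  "\<exists>w :: nat \<Rightarrow> (real^'m::finite) \<times> (real^'m). wedge_power omega0 CARD('m) w \<noteq> 0"
proof -
  obtain en :: "nat \<Rightarrow> 'm" where en: "bij_betw en {..<CARD('m)} UNIV"
    using ex_bij_betw_nat_finite[of "UNIV :: 'm set"] by (auto simp: lessThan_atLeast0)
  then have inj: "en a = en c \<longleftrightarrow> a = c" if "a < CARD('m)" "c < CARD('m)" for a c
    using that by (auto simp: bij_betw_def inj_on_eq_iff)
  define w :: "nat \<Rightarrow> (real^'m) \<times> (real^'m)"
    where "w i = (if even i then (axis (en (i div 2)) 1, 0) else (0, axis (en (i div 2)) 1))" for i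
  have "wedge_power omega0 CARD('m) w > 0"
    unfolding w_def[abs_def] by (rule wedge_power_symplectic_pos[OF alternating_form_omega0])
      (simp_all add: omega0_def inner_axis_axis inj)
  then show ?thesis by (intro exI[of _ w]) simp
qed

text \<open>The case \<open>J = mat 1\<close> of the block determinant: base directions are kept,
  and the off-diagonal part \<open>K\<close> leaves no trace in the top power.\<close>

lemma omega0_power_shear:
  fixes G :: "real^'m^'m::finite"
  assumes "linear K"
  shows "wedge_power (\<lambda>v. omega0 (\<lambda>i. (fst (v i), G *v snd (v i) + K (fst (v i))))) CARD('m) v
    = det G * wedge_power omega0 CARD('m) v"
  using top_form_block[OF alternating_form_wedge_power[OF alternating_form_omega0] assms, of "mat 1" v G]
  by (simp add: wedge_power_pullback[of omega0 "\<lambda>x. (fst x, G *v snd x + K (fst x))"])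

lemma permutes_lessThan_2: "{\<sigma>. \<sigma> permutes {..<1 + 1}} = {id, Transposition.transpose 0 (1::nat)}"
proof -
  have eq: "{..<1 + 1} = {0, 1::nat}" by auto
  show ?thesis unfolding eq permutes_doubleton_iff by auto
qed

lemma wedge_dq:
  "wedge 1 1 (dq b) (dq d) v = fst (v 0) $ b * fst (v 1) $ d - fst (v 1) $ b * fst (v 0) $ d"
proof -
  have "Transposition.transpose 0 (1::nat) \<noteq> id"
    by (metis id_apply transpose_apply_first zero_neq_one)
  then show ?thesis
    unfolding wedge_def permutes_lessThan_2 by (simp add: dq_def sign_swap_id)
qed

section \<open>Coordinate expressions in one chart of Q/G\<close>

locale chaplygin_chart = chaplygin_sys S for S :: "('q, 'g, 'n::finite, 'k::finite, 'm::finite) chaplygin" +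
  fixes U :: "'q set set" and \<kappa> :: "'q set \<Rightarrow> real^'m"
  assumes chart: "(U, \<kappa>) \<in> atlas (Bman S)"
begin

abbreviation "c \<equiv> (U, \<kappa>)"

definition gc :: "'m \<Rightarrow> 'm \<Rightarrow> real^'m \<Rightarrow> real" where
  "gc a b x = gred S c a b (inv_into U \<kappa> x)"

definition dgc :: "'m \<Rightarrow> 'm \<Rightarrow> real^'m \<Rightarrow> real^'m \<Rightarrow> real" where
  "dgc a b x = frechet_derivative (gc a b) (at x)"

definition gmat :: "real^'m \<Rightarrow> real^'m^'m" where
  "gmat x = (\<chi> a b. gc a b x)"

text \<open>The derivative of the fibre momenta at \<open>(x, u)\<close> in horizontal direction.\<close>
definition shear :: "real^'m \<Rightarrow> real^'m \<Rightarrow> real^'m \<Rightarrow> real^'m" where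
  "shear x u h = (\<chi> b. \<Sum>a\<in>UNIV. dgc a b x h * u $ a)"

lemma inj_chart: "inj_on \<kappa> U" and open_chart: "open (\<kappa> ` U)"
  using chartedD[OF charted_B chart] chartedD(3)[OF charted_B chart, of U] by auto

lemma inv_chart_in: "x \<in> \<kappa> ` U \<Longrightarrow> inv_into U \<kappa> x \<in> U"
  by (rule inv_into_into)

lemma tdom_iff: "y \<in> tdom c \<longleftrightarrow> fst y \<in> \<kappa> ` U"
  by (cases y) (simp add: tdom_def)

lemma open_tdom: "open (tdom c)"
  unfolding tdom_def using open_chart by (simp add: open_Times)

lemma base_chart: "base c y = inv_into U \<kappa> (fst y)"
  by (simp add: base_def)

lemma gc_smooth: "smooth_on (\<kappa> ` U) (gc a b)"
  using gred_smooth[OF chart] by (simp add: gc_def[abs_def])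

lemma gc_sym: "x \<in> \<kappa> ` U \<Longrightarrow> gc a b x = gc b a x"
  unfolding gc_def by (rule gred_sym[OF chart inv_chart_in])

lemma det_gmat: "x \<in> \<kappa> ` U \<Longrightarrow> det (gmat x) \<noteq> 0"
  unfolding gmat_def gc_def by (rule gred_det[OF chart inv_chart_in])

lemma gc_derivative: "x \<in> \<kappa> ` U \<Longrightarrow> (gc a b has_derivative dgc a b x) (at x)"
  unfolding dgc_def by (rule smooth_on_has_derivative[OF gc_smooth])

lemma gc_fst_derivative:
  "fst y \<in> \<kappa> ` U \<Longrightarrow> ((\<lambda>z. gc a b (fst z)) has_derivative (\<lambda>h. dgc a b (fst y) (fst h))) (at y)"
  by (rule has_derivative_compose[OF has_derivative_fst[OF has_derivative_ident] gc_derivative])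

lemma dgc_linear: "x \<in> \<kappa> ` U \<Longrightarrow> linear (dgc a b x)"
  using has_derivative_linear[OF gc_derivative] .

lemma dgc_sym:
  assumes "x \<in> \<kappa> ` U"
  shows "dgc a b x = dgc b a x"
  unfolding dgc_def by (rule frechet_derivative_cong_open[OF open_chart assms gc_sym])

lemma shear_linear:
  assumes "x \<in> \<kappa> ` U"
  shows "linear (shear x u)"
  using linear_add[OF dgc_linear[OF assms]] linear_scale[OF dgc_linear[OF assms]]
  by (auto simp: linear_iff shear_def vec_eq_iff sum.distrib sum_distrib_left algebra_simps)

lemma snd_nth_derivative: "((\<lambda>z. snd z $ a) has_derivative (\<lambda>h. snd h $ a)) (at y)"
  by (rule bounded_linear_imp_has_derivative)
    (intro bounded_linear_compose[OF bounded_linear_vec_nth bounded_linear_snd])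

text \<open>For fixed \<open>w\<close>, \<open>theta_l\<close> pairs the momenta \<open>g u\<close>
  with a constant base vector, so only the momenta vary: along the fibre through
  \<open>gmat\<close>, along the base through \<open>shear\<close>.\<close>

lemma theta_l_derivative:
  assumes y: "y \<in> tdom c"
  shows "((\<lambda>z. theta_l S c z w) has_derivative
    (\<lambda>h. (gmat (fst y) *v snd h + shear (fst y) (snd y) (fst h)) \<bullet> fst (w 0))) (at y)"
proof -
  have x: "fst y \<in> \<kappa> ` U" using y by (simp add: tdom_iff)
  have th: "theta_l S c z w = (\<Sum>a\<in>UNIV. \<Sum>b\<in>UNIV. gc a b (fst z) * snd z $ a * fst (w 0) $ b)" for z
    by (simp add: theta_l_def base_chart gc_def dq_def)
  have "((\<lambda>z. theta_l S c z w) has_derivative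
    (\<lambda>h. \<Sum>a\<in>UNIV. \<Sum>b\<in>UNIV. (gc a b (fst y) * snd h $ a + dgc a b (fst y) (fst h) * snd y $ a) * fst (w 0) $ b)) (at y)"
    unfolding th
    by (intro has_derivative_sum has_derivative_mult_left has_derivative_mult gc_fst_derivative x snd_nth_derivative)
  moreover have "(\<Sum>a\<in>UNIV. \<Sum>b\<in>UNIV. (gc a b (fst y) * snd h $ a + dgc a b (fst y) (fst h) * snd y $ a) * fst (w 0) $ b)
      = (gmat (fst y) *v snd h + shear (fst y) (snd y) (fst h)) \<bullet> fst (w 0)" for h
    unfolding inner_vec_def inner_real_def
    by (subst sum.swap)
      (simp add: gmat_def shear_def matrix_vector_mult_def gc_sym[OF x, of b for b] sum_distrib_right sum.distrib ring_distribs)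
  ultimately show ?thesis by simp
qed

text \<open>Minus the exterior derivative antisymmetrizes the variation of the momenta against the
  base components, which is \<open>omega0\<close> in the variables position and momentum.\<close>

lemma omega_l_eq:
  assumes y: "y \<in> tdom c"
  shows "omega_l S c y v
    = omega0 (\<lambda>i. (fst (v i), gmat (fst y) *v snd (v i) + shear (fst y) (snd y) (fst (v i))))"
proof -
  let ?P = "\<lambda>h. gmat (fst y) *v snd h + shear (fst y) (snd y) (fst h)"
  have "{..1::nat} = {0, 1}" by auto
  then have "omega_l S c y v
      = frechet_derivative (\<lambda>z. theta_l S c z (\<lambda>j. if j < 1 then v j else v (Suc j))) (at y) (v 1)
        - frechet_derivative (\<lambda>z. theta_l S c z (\<lambda>j. v (Suc j))) (at y) (v 0)"
    by (simp add: omega_l_def ext_deriv_def)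
  also have "\<dots> = ?P (v 1) \<bullet> fst (v 0) - ?P (v 0) \<bullet> fst (v 1)"
    by (simp add: frechet_derivative_at[OF theta_l_derivative[OF y], symmetric])
  finally show ?thesis
    by (simp add: omega0_def inner_commute)
qed

lemma omega_l_power:
  assumes y: "y \<in> tdom c"
  shows "wedge_power (omega_l S c y) CARD('m) v = det (gmat (fst y)) * wedge_power omega0 CARD('m) v"
proof -
  have "omega_l S c y = (\<lambda>v. omega0 (\<lambda>i. (fst (v i), gmat (fst y) *v snd (v i) + shear (fst y) (snd y) (fst (v i)))))"
    by (rule ext) (rule omega_l_eq[OF y])
  then show ?thesis
    using omega0_power_shear[OF shear_linear] y by (simp add: tdom_iff)
qed

lemma omega_l_gammaG_power:
  assumes y: "y \<in> tdom c"
  shows "wedge_power (\<lambda>w. omega_l S c y w - gammaG S \<xi> c R y w) CARD('m) v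
    = det (gmat (fst y)) * wedge_power omega0 CARD('m) v"
proof -
  \<comment> \<open>\<open>C b d\<close> is the coefficient of the wedge of \<open>dq b\<close> and
    \<open>dq d\<close> in \<open>gammaG\<close>, already contracted with the velocity, and
    \<open>N\<close> is the linear map with these entries. Subtracting \<open>gammaG\<close>
    replaces the shear by its difference with \<open>N\<close> and leaves \<open>gmat\<close>
    untouched.\<close>
  define C where "C b d = (\<Sum>a\<in>UNIV. (- GR S \<xi> c R b a d (base c y) + GR S \<xi> c R d a b (base c y)
      - 2 * GR S \<xi> c R a b d (base c y)) * snd y $ a) / 6" for b d
  define N where "N h = (\<chi> b. \<Sum>d\<in>UNIV. C b d * h $ d)" for h :: "real^'m"
  let ?K = "\<lambda>h. shear (fst y) (snd y) h - N h"
  have N: "linear N"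
    by (auto simp: linear_iff N_def vec_eq_iff sum.distrib sum_distrib_left algebra_simps)
  have K: "linear ?K"
    by (intro linear_compose_sub N shear_linear) (use y in \<open>simp add: tdom_iff\<close>)
  have "gammaG S \<xi> c R y w = fst (w 0) \<bullet> N (fst (w 1)) - fst (w 1) \<bullet> N (fst (w 0))" for w
  proof -
    have "gammaG S \<xi> c R y w = (\<Sum>b\<in>UNIV. \<Sum>d\<in>UNIV. \<Sum>a\<in>UNIV.
        (- GR S \<xi> c R b a d (base c y) + GR S \<xi> c R d a b (base c y) - 2 * GR S \<xi> c R a b d (base c y))
          * snd y $ a * (fst (w 0) $ b * fst (w 1) $ d - fst (w 1) $ b * fst (w 0) $ d)) / 6"
      unfolding gammaG_def wedge_dq by (subst sum.swap) (subst sum.swap, rule refl)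
    also have "\<dots> = (\<Sum>b\<in>UNIV. \<Sum>d\<in>UNIV. C b d * (fst (w 0) $ b * fst (w 1) $ d - fst (w 1) $ b * fst (w 0) $ d))"
      by (simp only: C_def sum_distrib_right sum_divide_distrib times_divide_eq_left)
    also have "\<dots> = fst (w 0) \<bullet> N (fst (w 1)) - fst (w 1) \<bullet> N (fst (w 0))"
      by (simp add: inner_vec_def N_def sum_distrib_left sum_subtractf[symmetric] algebra_simps)
    finally show ?thesis .
  qed
  then have "(\<lambda>w. omega_l S c y w - gammaG S \<xi> c R y w)
      = (\<lambda>v. omega0 (\<lambda>i. (fst (v i), gmat (fst y) *v snd (v i) + ?K (fst (v i)))))"
    by (simp add: fun_eq_iff omega_l_eq[OF y] omega0_def inner_simps)
  then show ?thesis
    using omega0_power_shear[OF K] by simp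
qed

end

section \<open>Invariance of the volume form\<close>

lemma alternating_form_scale:
  assumes "alternating_form k \<alpha>"
  shows "alternating_form k (\<lambda>v. r * \<alpha> v)"
  using alternating_form_diff_scale[OF assms assms, of "1 - r"] by (simp add: algebra_simps)

text \<open>The fibre part of a tangent transition map is linear in the velocity, so its derivative
  is block triangular with the Jacobian of the base transition twice on the diagonal;
  \<open>K\<close> carries the second derivatives.\<close>

lemma ttrans_derivative:
  fixes c d :: "('a, real^'m::finite) chart"
  defines "\<phi> \<equiv> snd d \<circ> inv_into (fst c) (snd c)"
  assumes "open A" "smooth_on A \<phi>" "fst y \<in> A"
  obtains K where "linear K"
    "(ttrans c d has_derivative (\<lambda>h. (matrix (frechet_derivative \<phi> (at (fst y))) *v fst h,
       matrix (frechet_derivative \<phi> (at (fst y))) *v snd h + K (fst h)))) (at y)"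
proof -
  let ?D = "\<lambda>x. frechet_derivative \<phi> (at x)"
  have D: "(\<phi> has_derivative ?D x) (at x)" if "x \<in> A" for x
    by (rule smooth_on_has_derivative[OF assms(3) that])
  have mat: "matrix (?D (fst y)) *v w = ?D (fst y) w" for w
    by (rule matrix_works) (use has_derivative_linear[OF D[OF assms(4)]] in \<open>simp add: linear_matrix_vector_mul_eq\<close>)
  define K where "K h = (\<Sum>b\<in>UNIV. snd y $ b *\<^sub>R frechet_derivative (\<lambda>x. ?D x (axis b 1)) (at (fst y)) h)"
    for h
  have dd: "((\<lambda>x. ?D x (axis b 1)) has_derivative frechet_derivative (\<lambda>x. ?D x (axis b 1)) (at (fst y))) (at (fst y))"
    for b
    by (rule smooth_on_has_derivative[OF smooth_on_frechet_derivative[OF assms(3)] assms(4)])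
  have K: "linear K"
    unfolding K_def
    by (intro linear_compose_sum ballI linear_compose_scale_right has_derivative_linear[OF dd])
  \<comment> \<open>Expanding the velocity in axes separates it from the base point, so the product
    rule needs only the derivatives of the maps \<open>x \<mapsto> ?D x (axis b 1)\<close>.\<close>
  have expand: "?D x w = (\<Sum>b\<in>UNIV. w $ b *\<^sub>R ?D x (axis b 1))" if "x \<in> A" for x w
  proof -
    interpret linear "?D x" by (rule has_derivative_linear[OF D[OF that]])
    have "?D x (\<Sum>b\<in>UNIV. w $ b *\<^sub>R axis b 1) = (\<Sum>b\<in>UNIV. w $ b *\<^sub>R ?D x (axis b 1))"
      by (simp only: sum scale)
    then show ?thesis
      using basis_expansion[of w] by (simp add: scalar_mult_eq_scaleR)
  qed
  have fy: "(fst has_derivative fst) (at y)"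
    by (rule bounded_linear_imp_has_derivative[OF bounded_linear_fst])
  have "((\<lambda>z. snd z $ b *\<^sub>R ?D (fst z) (axis b 1)) has_derivative
      (\<lambda>h. snd y $ b *\<^sub>R frechet_derivative (\<lambda>x. ?D x (axis b 1)) (at (fst y)) (fst h)
        + snd h $ b *\<^sub>R ?D (fst y) (axis b 1))) (at y)" for b
    by (intro has_derivative_scaleR has_derivative_compose[OF fy dd] bounded_linear_imp_has_derivative
        bounded_linear_compose[OF bounded_linear_vec_nth bounded_linear_snd])
  then have "((\<lambda>z. \<Sum>b\<in>UNIV. snd z $ b *\<^sub>R ?D (fst z) (axis b 1)) has_derivative
      (\<lambda>h. \<Sum>b\<in>UNIV. snd y $ b *\<^sub>R frechet_derivative (\<lambda>x. ?D x (axis b 1)) (at (fst y)) (fst h)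
        + snd h $ b *\<^sub>R ?D (fst y) (axis b 1))) (at y)"
    by (intro has_derivative_sum)
  moreover have "(\<lambda>h. \<Sum>b\<in>UNIV. snd y $ b *\<^sub>R frechet_derivative (\<lambda>x. ?D x (axis b 1)) (at (fst y)) (fst h)
        + snd h $ b *\<^sub>R ?D (fst y) (axis b 1)) = (\<lambda>h. ?D (fst y) (snd h) + K (fst h))"
    unfolding expand[OF assms(4), of "snd h" for h] K_def by (simp add: sum.distrib add.commute)
  ultimately have 2: "((\<lambda>z. \<Sum>b\<in>UNIV. snd z $ b *\<^sub>R ?D (fst z) (axis b 1)) has_derivative
      (\<lambda>h. ?D (fst y) (snd h) + K (fst h))) (at y)" by (simp only:)
  have 1: "((\<lambda>z. \<phi> (fst z)) has_derivative (\<lambda>h. ?D (fst y) (fst h))) (at y)"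
    by (rule has_derivative_compose[OF fy D[OF assms(4)]])
  have op: "open (A \<times> (UNIV :: (real^'m) set))"
    using assms(2) by (simp add: open_Times)
  have "(ttrans c d has_derivative (\<lambda>h. (?D (fst y) (fst h), ?D (fst y) (snd h) + K (fst h)))) (at y)"
    by (rule has_derivative_transform_within_open[OF has_derivative_Pair[OF 1 2] op])
      (use assms(4) expand in \<open>auto simp: mem_Times_iff ttrans_def \<phi>_def split_beta\<close>)
  then show ?thesis
    using that[OF K] by (simp only: mat)
qed

lemma sum_Basis_prod:
  "(\<Sum>u\<in>(Basis :: ((real^'m::finite) \<times> (real^'m)) set). F u \<bullet> u)
    = (\<Sum>e\<in>UNIV. fst (F (axis e 1, 0)) $ e) + (\<Sum>e\<in>UNIV. snd (F (0, axis e 1)) $ e)"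
proof -
  have inj: "inj (\<lambda>e::'m. axis e (1::real))"
    by (auto simp: inj_on_def axis_eq_axis)
  have "(\<Sum>u\<in>(Basis :: ((real^'m) \<times> (real^'m)) set). F u \<bullet> u)
      = (\<Sum>u\<in>(\<lambda>u. (u, 0)) ` Basis. F u \<bullet> u) + (\<Sum>u\<in>(\<lambda>u. (0, u)) ` Basis. F u \<bullet> u)"
    unfolding Basis_prod_def by (rule sum.union_disjoint) (auto simp: nonzero_Basis)
  also have "(\<Sum>u\<in>(\<lambda>u::real^'m. (u, 0::real^'m)) ` Basis. F u \<bullet> u) = (\<Sum>e\<in>UNIV. fst (F (axis e 1, 0)) $ e)"
    unfolding Basis_vec_axis image_image
    by (subst sum.reindex) (auto simp: inj_on_def axis_eq_axis inner_prod_def inner_axis)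
  also have "(\<Sum>u\<in>(\<lambda>u::real^'m. (0::real^'m, u)) ` Basis. F u \<bullet> u) = (\<Sum>e\<in>UNIV. snd (F (0, axis e 1)) $ e)"
    unfolding Basis_vec_axis image_image
    by (subst sum.reindex) (auto simp: inj_on_def axis_eq_axis inner_prod_def inner_axis)
  finally show ?thesis .
qed

text \<open>The trace of the fibre derivative of \<open>\<Gamma>\<close>, computed by contracting condition \<open>(A')\<^sup>G\<close> with the
  inverse metric; \<open>T\<close> is the symbol of the quadratic spray \<open>g\<^sub>d\<^sub>e \<Gamma>\<^sup>e = T\<^sub>d\<^sub>a\<^sub>b u\<^sup>a u\<^sup>b\<close>.\<close>
lemma contracted_symbol:
  fixes I g :: "real^'m^'m::finite" and D H T :: "'m \<Rightarrow> 'm \<Rightarrow> 'm \<Rightarrow> real" and F :: "'m \<Rightarrow> real"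
  assumes Ig: "I ** g = mat 1" and Isym: "\<And>a b. I $ a $ b = I $ b $ a" and gsym: "\<And>a b. g $ a $ b = g $ b $ a"
    and Dsym: "\<And>a b d. D a b d = D b a d"
    and T: "\<And>d a b. T d a b = D a b d / 2 - D a d b + H a b d"
    and A: "\<And>a b d. H b a d + H a b d + g $ b $ d * F a + g $ a $ d * F b - 2 * g $ a $ b * F d = 0"
  shows "(\<Sum>e\<in>UNIV. \<Sum>d\<in>UNIV. I $ e $ d * (T d e b + T d b e))
    = - (\<Sum>e\<in>UNIV. \<Sum>d\<in>UNIV. I $ e $ d * D d e b) + (1 - real CARD('m)) * F b"
proof -
  have Ig': "(\<Sum>d\<in>UNIV. I $ e $ d * g $ d $ b) = (if e = b then 1 else 0)" for e b
    using Ig by (simp add: matrix_matrix_mult_def vec_eq_iff mat_def)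
  \<comment> \<open>Symmetrizing \<open>T\<close> produces exactly the two \<open>H\<close> terms of
    the condition at the indices \<open>b\<close>, \<open>e\<close>, \<open>d\<close>, which
    exchanges them for metric terms in \<open>F\<close>.\<close>
  have h: "T d e b + T d b e = D e b d - D b d e - D d e b - g $ d $ b * F e - g $ d $ e * F b + 2 * (g $ e $ b * F d)"
    for e d
    using A[of b e d] Dsym[of b e d] Dsym[of d e b] unfolding T gsym[of d b] gsym[of d e] by linarith
  have t: "I $ e $ d * (T d e b + T d b e) = I $ e $ d * D e b d - I $ e $ d * D b d e - I $ e $ d * D d e b
      - I $ e $ d * g $ d $ b * F e - I $ e $ d * g $ d $ e * F b + 2 * (I $ d $ e * g $ e $ b * F d)" for e d
    unfolding h Isym[of d e] by (simp add: algebra_simps)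
  \<comment> \<open>Exchanging the contracted indices turns one sum into the other. They enter with
    opposite signs, so one derivative term out of three is left.\<close>
  have s1: "(\<Sum>e\<in>UNIV. \<Sum>d\<in>UNIV. I $ e $ d * D e b d) = (\<Sum>e\<in>UNIV. \<Sum>d\<in>UNIV. I $ e $ d * D b d e)"
    by (subst sum.swap) (intro sum.cong refl arg_cong2[where f = "(*)"] Isym Dsym)
  \<comment> \<open>The next three contractions enter with weights -1, -1 and 2; as the second is
    the full trace of the identity, together they give the factor \<open>1 - m\<close>.\<close>
  have s2: "(\<Sum>e\<in>UNIV. \<Sum>d\<in>UNIV. I $ e $ d * g $ d $ b * F e) = F b"
    by (simp add: sum_distrib_right[symmetric] Ig' if_distrib[of "\<lambda>z. z * _"] cong: if_cong)
  have s3: "(\<Sum>e\<in>UNIV. \<Sum>d\<in>UNIV. I $ e $ d * g $ d $ e * F b) = real CARD('m) * F b"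
    by (simp add: sum_distrib_right[symmetric] Ig')
  have s4: "(\<Sum>e\<in>UNIV. \<Sum>d\<in>UNIV. I $ d $ e * g $ e $ b * F d) = F b"
    by (subst sum.swap) (rule s2)
  show ?thesis
    unfolding t sum.distrib sum_subtractf sum_distrib_left[symmetric] s1 s2 s3 s4 by (simp add: algebra_simps)
qed

section \<open>Volume density, equation of motion and divergence in one chart\<close>

context chaplygin_chart
begin

lemma base_function_derivative:
  assumes f: "smooth_fun (Bman S) (pts (Bman S)) f" and y: "y \<in> tdom c"
  shows "((\<lambda>z. f (base c z)) has_derivative
    (\<lambda>h. frechet_derivative (\<lambda>x. f (inv_into U \<kappa> x)) (at (fst y)) (fst h))) (at y)"
proof -
  have "U \<inter> pts (Bman S) = U"
    using openin_subset[OF chartedD(1)[OF charted_B chart]] by auto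
  then have "smooth_on (\<kappa> ` U) (\<lambda>x. f (inv_into U \<kappa> x))"
    using smooth_funD[OF f chart] by (simp add: o_def)
  then show ?thesis
    unfolding base_chart
    by (intro has_derivative_compose[OF has_derivative_fst[OF has_derivative_ident] smooth_on_has_derivative])
      (use y in \<open>simp_all add: tdom_iff\<close>)
qed

text \<open>The coefficient of the volume form against the constant form
  \<open>wedge_power omega0 CARD('m)\<close>; it varies with the base point only.\<close>

definition vol_density :: "('q set \<Rightarrow> real) \<Rightarrow> (real^'m) \<times> (real^'m) \<Rightarrow> real" where
  "vol_density f y = exp ((real CARD('m) - 1) * f (base c y)) * det (gmat (fst y))"

lemma vol_density_smooth:
  assumes f: "smooth_fun (Bman S) (pts (Bman S)) f"
  shows "smooth_on (tdom c) (vol_density f)"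
proof -
  have "U \<inter> pts (Bman S) = U"
    using openin_subset[OF chartedD(1)[OF charted_B chart]] by auto
  then have "smooth_on (\<kappa> ` U) (\<lambda>x. f (inv_into U \<kappa> x))"
    using smooth_funD[OF f chart] by (simp add: o_def)
  then have "smooth_on (\<kappa> ` U) (\<lambda>x. (real CARD('m) - 1) * f (inv_into U \<kappa> x))"
    by (rule smooth_on_mult[OF open_chart smooth_on_const])
  then have "smooth_on (\<kappa> ` U) (\<lambda>x. exp ((real CARD('m) - 1) * f (inv_into U \<kappa> x)))"
    by (rule smooth_on_compose[OF open_chart open_UNIV subset_UNIV _ smooth_on_exp])
  moreover have "smooth_on (\<kappa> ` U) (\<lambda>x. det (gmat x))"
    by (rule smooth_on_det[OF open_chart]) (simp add: gmat_def gc_smooth)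
  ultimately have *: "smooth_on (\<kappa> ` U) (\<lambda>x. exp ((real CARD('m) - 1) * f (inv_into U \<kappa> x)) * det (gmat x))"
    by (rule smooth_on_mult[OF open_chart])
  have "smooth_on (tdom c) (\<lambda>y. exp ((real CARD('m) - 1) * f (inv_into U \<kappa> (fst y))) * det (gmat (fst y)))"
    by (rule smooth_on_compose[OF open_tdom open_chart _ smooth_on_linear[OF bounded_linear_fst open_tdom smooth_on_id] *])
      (auto simp: tdom_def)
  then show ?thesis
    by (simp add: vol_density_def[abs_def] base_chart)
qed

lemma gmat_inverse:
  assumes x: "x \<in> \<kappa> ` U"
  obtains I where "I ** gmat x = mat 1" "gmat x ** I = mat 1" "\<And>a b. I $ a $ b = I $ b $ a"
proof -
  have "invertible (gmat x)" using det_gmat[OF x] by (simp add: invertible_det_nz)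
  then obtain I where I: "gmat x ** I = mat 1" "I ** gmat x = mat 1" by (auto simp: invertible_def)
  have g: "transpose (gmat x) = gmat x"
    using gc_sym[OF x] by (simp add: transpose_def gmat_def vec_eq_iff)
  have "transpose I ** gmat x = mat 1"
    using arg_cong[OF I(1), of transpose] by (simp add: matrix_transpose_mul g transpose_mat)
  then have "transpose I = I"
    using I by (metis matrix_mul_assoc matrix_mul_lid matrix_mul_rid)
  then have "I $ a $ b = I $ b $ a" for a b
    by (metis transpose_def vec_lambda_beta)
  then show ?thesis using that I by blast
qed

lemma energy_derivative:
  assumes y: "y \<in> tdom c"
  shows "(energy_l S c has_derivative (\<lambda>h. (\<Sum>a\<in>UNIV. \<Sum>b\<in>UNIV.
    gc a b (fst y) * snd y $ a * snd h $ b + (gc a b (fst y) * snd h $ a + dgc a b (fst y) (fst h) * snd y $ a) * snd y $ b) / 2)) (at y)"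
proof -
  have x: "fst y \<in> \<kappa> ` U" using y by (simp add: tdom_iff)
  have "energy_l S c = (\<lambda>z. (\<Sum>a\<in>UNIV. \<Sum>b\<in>UNIV. gc a b (fst z) * snd z $ a * snd z $ b) / 2)"
    by (simp add: energy_l_def fun_eq_iff base_chart gc_def)
  moreover have "((\<lambda>z. (\<Sum>a\<in>UNIV. \<Sum>b\<in>UNIV. gc a b (fst z) * snd z $ a * snd z $ b) / 2) has_derivative (\<lambda>h. (\<Sum>a\<in>UNIV. \<Sum>b\<in>UNIV.
    gc a b (fst y) * snd y $ a * snd h $ b + (gc a b (fst y) * snd h $ a + dgc a b (fst y) (fst h) * snd y $ a) * snd y $ b) / 2)) (at y)"
    unfolding divide_inverse
    by (intro has_derivative_mult_left has_derivative_sum has_derivative_mult gc_fst_derivative x snd_nth_derivative)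
  ultimately show ?thesis by simp
qed

text \<open>After symmetrization in \<open>a\<close> and \<open>b\<close> the first two terms are
  minus the Christoffel symbols of the first kind of the reduced metric; the last is the gyroscopic
  force. The form without symmetrization is the one that the equation of motion produces
  directly.\<close>

definition symbol :: "('k \<Rightarrow> 'g tvec) \<Rightarrow> ('m + 'k \<Rightarrow> 'm + 'k \<Rightarrow> 'm + 'k \<Rightarrow> 'q \<Rightarrow> real) \<Rightarrow> real^'m \<Rightarrow>
    'm \<Rightarrow> 'm \<Rightarrow> 'm \<Rightarrow> real" where
  "symbol \<xi> R x d a b = dgc a b x (axis d 1) / 2 - dgc a d x (axis b 1)
    + GR S \<xi> c R a b d (inv_into U \<kappa> x)"

lemma axis_expansion_dgc:
  assumes "x \<in> \<kappa> ` U"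
  shows "dgc a b x h = (\<Sum>d\<in>UNIV. h $ d * dgc a b x (axis d 1))"
proof -
  interpret linear "dgc a b x" by (rule dgc_linear[OF assms])
  have "dgc a b x (\<Sum>d\<in>UNIV. h $ d *\<^sub>R axis d 1) = (\<Sum>d\<in>UNIV. h $ d *\<^sub>R dgc a b x (axis d 1))"
    by (simp only: sum scale)
  then show ?thesis
    using basis_expansion[of h] by (simp add: scalar_mult_eq_scaleR)
qed

text \<open>Testing the equation of motion on the base direction \<open>axis d 1\<close> isolates
  row \<open>d\<close>. The velocity paired with \<open>shear\<close> is twice the base derivative
  of the energy, so half of it survives: the factor one half in \<open>symbol\<close>.\<close>

lemma spray_equation:
  assumes y: "y \<in> tdom c" and fst: "fst (X y) = snd y"
    and eq: "\<And>v. interior_prod X (omega_l S c) y v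
      = ext_deriv 0 (\<lambda>z _. energy_l S c z) y v + alpha_red S \<xi> c R y v"
  shows "(gmat (fst y) *v snd (X y)) $ d
    = (\<Sum>a\<in>UNIV. \<Sum>b\<in>UNIV. symbol \<xi> R (fst y) d a b * snd y $ a * snd y $ b)"
proof -
  let ?x = "fst y" and ?u = "snd y"
  have x: "?x \<in> \<kappa> ` U" using y by (simp add: tdom_iff)
  let ?h = "(axis d 1, 0) :: (real^'m) \<times> (real^'m)"
  have "interior_prod X (omega_l S c) y (\<lambda>_. ?h)
      = ?u \<bullet> shear ?x ?u (axis d 1) - (gmat ?x *v snd (X y)) $ d - shear ?x ?u ?u $ d"
    unfolding interior_prod_def omega_l_eq[OF y]
    by (simp add: omega0_def fst inner_axis' inner_simps)
  moreover have "ext_deriv 0 (\<lambda>z _. energy_l S c z) y (\<lambda>_. ?h)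
      = (\<Sum>a\<in>UNIV. \<Sum>b\<in>UNIV. dgc a b ?x (axis d 1) * ?u $ a * ?u $ b) / 2"
    unfolding ext_deriv_def by (simp add: frechet_derivative_at[OF energy_derivative[OF y], symmetric])
  moreover have "alpha_red S \<xi> c R y (\<lambda>_. ?h)
      = - (\<Sum>a\<in>UNIV. \<Sum>b\<in>UNIV. GR S \<xi> c R a b d (inv_into U \<kappa> ?x) * ?u $ a * ?u $ b)"
    unfolding alpha_red_def base_chart dq_def
    by (simp add: axis_def if_distrib[of "\<lambda>z. _ * z"] cong: if_cong)
  moreover have "?u \<bullet> shear ?x ?u (axis d 1) = (\<Sum>a\<in>UNIV. \<Sum>b\<in>UNIV. dgc a b ?x (axis d 1) * ?u $ a * ?u $ b)"
    unfolding inner_vec_def inner_real_def shear_def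
    by (subst sum.swap) (simp add: sum_distrib_left ac_simps)
  moreover have "shear ?x ?u ?u $ d = (\<Sum>a\<in>UNIV. \<Sum>b\<in>UNIV. dgc a d ?x (axis b 1) * ?u $ a * ?u $ b)"
    by (simp add: shear_def axis_expansion_dgc[OF x, of _ d "?u"] sum_distrib_left ac_simps)
  ultimately have "(gmat ?x *v snd (X y)) $ d =
      (\<Sum>a\<in>UNIV. \<Sum>b\<in>UNIV. dgc a b ?x (axis d 1) * ?u $ a * ?u $ b) / 2
      - (\<Sum>a\<in>UNIV. \<Sum>b\<in>UNIV. dgc a d ?x (axis b 1) * ?u $ a * ?u $ b)
      + (\<Sum>a\<in>UNIV. \<Sum>b\<in>UNIV. GR S \<xi> c R a b d (inv_into U \<kappa> ?x) * ?u $ a * ?u $ b)"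
    using eq[of "\<lambda>_. ?h"] by simp
  also have "\<dots> = (\<Sum>a\<in>UNIV. \<Sum>b\<in>UNIV. symbol \<xi> R ?x d a b * ?u $ a * ?u $ b)"
    unfolding sum_divide_distrib sum_subtractf[symmetric] sum.distrib[symmetric] symbol_def
    by (intro sum.cong refl) (simp add: algebra_simps)
  finally show ?thesis .
qed


lemma volume_form_eq:
  assumes "y \<in> tdom c"
  shows "exp ((real CARD('m) - 1) * f (base c y)) * wedge_power (omega_l S c y) CARD('m) v
    = vol_density f y * wedge_power omega0 CARD('m) v"
  by (simp add: omega_l_power[OF assms] vol_density_def)

lemma vol_density_nonzero: "y \<in> tdom c \<Longrightarrow> vol_density f y \<noteq> 0"
  using det_gmat by (simp add: vol_density_def tdom_iff)

text \<open>Written as the density times its logarithmic derivative, so that the density factors out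
  of the Lie derivative; the double sum is Jacobi's formula.\<close>

lemma vol_density_derivative:
  assumes f: "smooth_fun (Bman S) (pts (Bman S)) f" and y: "y \<in> tdom c" and I: "gmat (fst y) ** I = mat 1"
  shows "(vol_density f has_derivative (\<lambda>h. vol_density f y *
    ((real CARD('m) - 1) * frechet_derivative (\<lambda>x. f (inv_into U \<kappa> x)) (at (fst y)) (fst h)
      + (\<Sum>i\<in>UNIV. \<Sum>j\<in>UNIV. I $ i $ j * dgc j i (fst y) (fst h))))) (at y)"
proof -
  have x: "fst y \<in> \<kappa> ` U" using y by (simp add: tdom_iff)
  have "((\<lambda>x. det (gmat x)) has_derivative
      (\<lambda>h. det (gmat (fst y)) * (\<Sum>i\<in>UNIV. \<Sum>j\<in>UNIV. I $ i $ j * dgc j i (fst y) h))) (at (fst y))"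
    by (rule det_has_derivative[where M = gmat, OF _ I]) (simp add: gmat_def gc_derivative[OF x])
  then have 1: "((\<lambda>z. det (gmat (fst z))) has_derivative
      (\<lambda>h. det (gmat (fst y)) * (\<Sum>i\<in>UNIV. \<Sum>j\<in>UNIV. I $ i $ j * dgc j i (fst y) (fst h)))) (at y)"
    by (rule has_derivative_compose[OF has_derivative_fst[OF has_derivative_ident]])
  have 2: "((\<lambda>z. exp ((real CARD('m) - 1) * f (base c z))) has_derivative
      (\<lambda>h. (real CARD('m) - 1) * frechet_derivative (\<lambda>x. f (inv_into U \<kappa> x)) (at (fst y)) (fst h)
        * exp ((real CARD('m) - 1) * f (base c y)))) (at y)"
    by (rule has_derivative_exp[OF has_derivative_mult_right[OF base_function_derivative[OF f y]]])
  show ?thesis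
    using has_derivative_mult[OF 2 1] unfolding vol_density_def[abs_def]
    by (simp add: algebra_simps)
qed

text \<open>Only fibre directions contribute to the trace, and along a fibre the base point is
  fixed: the field is quadratic in the velocity with constant coefficients, and no derivative of the
  inverse metric appears.\<close>

lemma trace_derivative:
  assumes X: "smooth_on (tdom c) X"
    and fst: "\<And>y. y \<in> tdom c \<Longrightarrow> fst (X y) = snd y"
    and eq: "\<And>y v. y \<in> tdom c \<Longrightarrow> interior_prod X (omega_l S c) y v
      = ext_deriv 0 (\<lambda>z _. energy_l S c z) y v + alpha_red S \<xi> c R y v"
    and f: "smooth_fun (Bman S) (pts (Bman S)) f" and A: "condA' S \<xi> c R f"
    and y: "y \<in> tdom c" and I: "I ** gmat (fst y) = mat 1" "\<And>a b. I $ a $ b = I $ b $ a"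
  shows "(\<Sum>b\<in>Basis. frechet_derivative X (at y) b \<bullet> b)
    = (1 - real CARD('m)) * frechet_derivative (\<lambda>x. f (inv_into U \<kappa> x)) (at (fst y)) (snd y)
      - (\<Sum>i\<in>UNIV. \<Sum>j\<in>UNIV. I $ i $ j * dgc j i (fst y) (snd y))"
proof -
  let ?x = "fst y" and ?u = "snd y"
  let ?DX = "frechet_derivative X (at y)" and ?Df = "frechet_derivative (\<lambda>x. f (inv_into U \<kappa> x)) (at ?x)"
  let ?s = "symbol \<xi> R ?x"
  have x: "?x \<in> \<kappa> ` U" using y by (simp add: tdom_iff)
  have DX: "(X has_derivative ?DX) (at y)"
    by (rule smooth_on_has_derivative[OF X y])
  \<comment> \<open>The base component of \<open>X\<close> is the velocity, whose derivative in base
    directions is zero; this removes the base half of the trace.\<close>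
  have "((\<lambda>z. fst (X z)) has_derivative (\<lambda>h. fst (?DX h))) (at y)"
    by (rule has_derivative_fst[OF DX])
  then have "(snd has_derivative (\<lambda>h. fst (?DX h))) (at y)"
    by (rule has_derivative_transform_within_open[OF _ open_tdom y]) (rule fst)
  then have "(\<lambda>h. fst (?DX h)) = snd"
    by (rule has_derivative_unique) (rule bounded_linear_imp_has_derivative[OF bounded_linear_snd])
  then have fst_DX: "fst (?DX h) = snd h" for h by (rule fun_cong)
  have snd_X: "snd (X (?x, w)) $ e = (\<Sum>d\<in>UNIV. I $ e $ d * (\<Sum>a\<in>UNIV. \<Sum>b\<in>UNIV. ?s d a b * (w $ a * w $ b)))" for w e
  proof -
    have xw: "(?x, w) \<in> tdom c" using x by (simp add: tdom_iff)
    have "snd (X (?x, w)) = I *v (gmat ?x *v snd (X (?x, w)))"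
      by (simp add: matrix_vector_mul_assoc I(1))
    then have "snd (X (?x, w)) $ e = (I *v (gmat ?x *v snd (X (?x, w)))) $ e"
      by (rule arg_cong)
    also have "\<dots> = (\<Sum>d\<in>UNIV. I $ e $ d * (gmat ?x *v snd (X (?x, w))) $ d)"
      by (simp only: matrix_vector_mult_def[of I] vec_lambda_beta)
    finally show ?thesis
      using spray_equation[OF xw fst[OF xw] eq[OF xw]] by (simp add: mult.assoc)
  qed
  have snd_DX: "snd (?DX (0, axis e 1)) $ e = (\<Sum>b\<in>UNIV. \<Sum>d\<in>UNIV. I $ e $ d * (?s d e b + ?s d b e) * ?u $ b)" for e
  proof -
    have nth: "((\<lambda>w. w $ a) has_derivative (\<lambda>h. h $ a)) (at ?u)" for a
      by (rule bounded_linear_imp_has_derivative[OF bounded_linear_vec_nth])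
    have "((\<lambda>w. X (?x, w)) has_derivative (\<lambda>h. ?DX (0, h))) (at ?u)"
      by (rule has_derivative_compose[OF has_derivative_Pair[OF has_derivative_const has_derivative_ident]]) (use DX in simp)
    then have "((\<lambda>w. snd (X (?x, w)) $ e) has_derivative (\<lambda>h. snd (?DX (0, h)) $ e)) (at ?u)"
      by (intro bounded_linear.has_derivative[OF bounded_linear_compose[OF bounded_linear_vec_nth bounded_linear_snd]])
    moreover have "((\<lambda>w. snd (X (?x, w)) $ e) has_derivative
        (\<lambda>h. \<Sum>d\<in>UNIV. I $ e $ d * (\<Sum>a\<in>UNIV. \<Sum>b\<in>UNIV. ?s d a b * (?u $ a * h $ b + h $ a * ?u $ b)))) (at ?u)"
      unfolding snd_X
      by (intro has_derivative_sum has_derivative_mult_right has_derivative_mult nth)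
    ultimately have "(\<lambda>h. snd (?DX (0, h)) $ e)
        = (\<lambda>h. \<Sum>d\<in>UNIV. I $ e $ d * (\<Sum>a\<in>UNIV. \<Sum>b\<in>UNIV. ?s d a b * (?u $ a * h $ b + h $ a * ?u $ b)))"
      by (rule has_derivative_unique)
    then have "snd (?DX (0, axis e 1)) $ e
        = (\<Sum>d\<in>UNIV. I $ e $ d * (\<Sum>a\<in>UNIV. \<Sum>b\<in>UNIV. ?s d a b * (?u $ a * axis e 1 $ b + axis e 1 $ a * ?u $ b)))"
      by (rule fun_cong)
    also have "\<dots> = (\<Sum>d\<in>UNIV. I $ e $ d * (\<Sum>b\<in>UNIV. (?s d e b + ?s d b e) * ?u $ b))"
    proof -
      have 1: "(\<Sum>a\<in>UNIV. \<Sum>b\<in>UNIV. ?s d a b * (?u $ a * axis e 1 $ b)) = (\<Sum>a\<in>UNIV. ?s d a e * ?u $ a)" for d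
        by (simp add: axis_def if_distrib[of "\<lambda>z. _ * z"] cong: if_cong)
      have 2: "(\<Sum>a\<in>UNIV. \<Sum>b\<in>UNIV. ?s d a b * (axis e 1 $ a * ?u $ b)) = (\<Sum>b\<in>UNIV. ?s d e b * ?u $ b)" for d
        by (subst sum.swap)
          (simp add: axis_def if_distrib[of "\<lambda>z. _ * z"] if_distrib[of "\<lambda>z. z * _"] cong: if_cong)
      have "(\<Sum>a\<in>UNIV. \<Sum>b\<in>UNIV. ?s d a b * (?u $ a * axis e 1 $ b + axis e 1 $ a * ?u $ b))
          = (\<Sum>b\<in>UNIV. (?s d e b + ?s d b e) * ?u $ b)" for d
        unfolding distrib_left distrib_right sum.distrib 1 2 by simp
      then show ?thesis by (simp only:)
    qed
    also have "\<dots> = (\<Sum>b\<in>UNIV. \<Sum>d\<in>UNIV. I $ e $ d * (?s d e b + ?s d b e) * ?u $ b)"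
      by (subst sum.swap) (simp add: sum_distrib_left mult.assoc)
    finally show ?thesis .
  qed
  have p: "inv_into U \<kappa> ?x \<in> U" "\<kappa> (inv_into U \<kappa> ?x) = ?x"
    using x inv_chart_in by (simp_all add: f_inv_into_f)
  have pB: "inv_into U \<kappa> ?x \<in> pts (Bman S)"
    using openin_subset[OF chartedD(1)[OF charted_B chart]] p(1) by auto
  have fp: "smooth_at (Bman S) (inv_into U \<kappa> ?x) f"
    by (rule smooth_atI[OF f openin_topspace pB])
  have F: "coord_field (Bman S) c a (inv_into U \<kappa> ?x) f = ?Df (axis a 1)" for a
    using coord_field_apply[OF fp, of U \<kappa> a] p(2) by simp
  \<comment> \<open>Coefficient of the velocity component \<open>b\<close> in the divergence;
    \<open>condA'\<close> enters only here, with its coordinate fields rewritten as partial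
    derivatives of \<open>f\<close> in the chart.\<close>
  have sym: "(\<Sum>e\<in>UNIV. \<Sum>d\<in>UNIV. I $ e $ d * (?s d e b + ?s d b e))
      = - (\<Sum>e\<in>UNIV. \<Sum>d\<in>UNIV. I $ e $ d * dgc d e ?x (axis b 1)) + (1 - real CARD('m)) * ?Df (axis b 1)" for b
  proof (rule contracted_symbol[where H = "\<lambda>a b d. GR S \<xi> c R a b d (inv_into U \<kappa> ?x)"
        and g = "gmat ?x" and F = "\<lambda>a. ?Df (axis a 1)" and D = "\<lambda>a b d. dgc a b ?x (axis d 1)"])
    show "I ** gmat ?x = mat 1" "\<And>a b. I $ a $ b = I $ b $ a" by (rule I)+
    show "gmat ?x $ a $ b = gmat ?x $ b $ a" for a b
      using gc_sym[OF x] by (simp add: gmat_def)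
    show "dgc a b ?x (axis d 1) = dgc b a ?x (axis d 1)" for a b d
      by (simp only: dgc_sym[OF x, of a b])
    show "?s d a b = dgc a b ?x (axis d 1) / 2 - dgc a d ?x (axis b 1) + GR S \<xi> c R a b d (inv_into U \<kappa> ?x)" for d a b
      by (simp add: symbol_def)
    show "GR S \<xi> c R b a d (inv_into U \<kappa> ?x) + GR S \<xi> c R a b d (inv_into U \<kappa> ?x)
        + gmat ?x $ b $ d * ?Df (axis a 1) + gmat ?x $ a $ d * ?Df (axis b 1)
        - 2 * gmat ?x $ a $ b * ?Df (axis d 1) = 0" for a b d
      using spec[OF spec[OF spec[OF bspec[OF A[unfolded condA'_def fst_conv] p(1)], of a], of b], of d]
      by (simp add: F gmat_def gc_def)
  qed
  have Df: "?Df ?u = (\<Sum>b\<in>UNIV. ?u $ b * ?Df (axis b 1))"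
  proof -
    have "linear ?Df"
      by (rule has_derivative_linear[OF smooth_at_has_derivative[OF charted_B chart p(1) fp, unfolded p(2)]])
    then interpret linear ?Df .
    have "?Df (\<Sum>b\<in>UNIV. ?u $ b *\<^sub>R axis b 1) = (\<Sum>b\<in>UNIV. ?u $ b *\<^sub>R ?Df (axis b 1))"
      by (simp only: sum scale)
    then show ?thesis
      using basis_expansion[of ?u] by (simp add: scalar_mult_eq_scaleR)
  qed
  have "(\<Sum>b\<in>Basis. ?DX b \<bullet> b)
      = (\<Sum>e\<in>UNIV. \<Sum>b\<in>UNIV. \<Sum>d\<in>UNIV. I $ e $ d * (?s d e b + ?s d b e) * ?u $ b)"
    by (simp add: sum_Basis_prod fst_DX snd_DX)
  also have "\<dots> = (\<Sum>b\<in>UNIV. (\<Sum>e\<in>UNIV. \<Sum>d\<in>UNIV. I $ e $ d * (?s d e b + ?s d b e)) * ?u $ b)"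
    by (subst sum.swap) (simp add: sum_distrib_right)
  also have "\<dots> = (\<Sum>b\<in>UNIV. (1 - real CARD('m)) * (?u $ b * ?Df (axis b 1))
      - (\<Sum>e\<in>UNIV. \<Sum>d\<in>UNIV. I $ e $ d * (?u $ b * dgc d e ?x (axis b 1))))"
    unfolding sym by (simp add: algebra_simps sum_distrib_left sum_distrib_right)
  also have "\<dots> = (1 - real CARD('m)) * ?Df ?u
      - (\<Sum>b\<in>UNIV. \<Sum>e\<in>UNIV. \<Sum>d\<in>UNIV. I $ e $ d * (?u $ b * dgc d e ?x (axis b 1)))"
    by (simp only: sum_subtractf Df sum_distrib_left)
  also have "(\<Sum>b\<in>UNIV. \<Sum>e\<in>UNIV. \<Sum>d\<in>UNIV. I $ e $ d * (?u $ b * dgc d e ?x (axis b 1)))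
      = (\<Sum>e\<in>UNIV. \<Sum>d\<in>UNIV. I $ e $ d * dgc d e ?x ?u)"
  proof -
    have "(\<Sum>b\<in>UNIV. \<Sum>e\<in>UNIV. \<Sum>d\<in>UNIV. I $ e $ d * (?u $ b * dgc d e ?x (axis b 1)))
        = (\<Sum>e\<in>UNIV. \<Sum>b\<in>UNIV. \<Sum>d\<in>UNIV. I $ e $ d * (?u $ b * dgc d e ?x (axis b 1)))"
      by (rule sum.swap)
    also have "\<dots> = (\<Sum>e\<in>UNIV. \<Sum>d\<in>UNIV. \<Sum>b\<in>UNIV. I $ e $ d * (?u $ b * dgc d e ?x (axis b 1)))"
      by (rule sum.cong[OF refl], rule sum.swap)
    also have "\<dots> = (\<Sum>e\<in>UNIV. \<Sum>d\<in>UNIV. I $ e $ d * dgc d e ?x ?u)"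
      by (simp only: axis_expansion_dgc[OF x, of _ _ ?u] sum_distrib_left)
    finally show ?thesis .
  qed
  finally show ?thesis .
qed

text \<open>In the chart the form is a density times a constant form. The directional derivative
  contributes the logarithmic derivative \<open>t\<close> of the density, the Jacobian of the field
  contributes its trace, and that trace is \<open>- t\<close>.\<close>

lemma lie_deriv_volume_form:
  assumes X: "smooth_on (tdom c) X"
    and fst: "\<And>y. y \<in> tdom c \<Longrightarrow> fst (X y) = snd y"
    and eq: "\<And>y v. y \<in> tdom c \<Longrightarrow> interior_prod X (omega_l S c) y v
      = ext_deriv 0 (\<lambda>z _. energy_l S c z) y v + alpha_red S \<xi> c R y v"
    and f: "smooth_fun (Bman S) (pts (Bman S)) f" and A: "condA' S \<xi> c R f"
    and y: "y \<in> tdom c"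
  shows "lie_deriv (2 * CARD('m)) X
    (\<lambda>y v. exp ((real CARD('m) - 1) * f (base c y)) * wedge_power (omega_l S c y) CARD('m) v) y v = 0"
proof -
  let ?\<Omega> = "wedge_power omega0 CARD('m) :: ((real^'m) \<times> (real^'m)) covec"
  let ?DX = "frechet_derivative X (at y)"
  have x: "fst y \<in> \<kappa> ` U" using y by (simp add: tdom_iff)
  obtain I where I: "I ** gmat (fst y) = mat 1" "gmat (fst y) ** I = mat 1" and Isym: "\<forall>a b. I $ a $ b = I $ b $ a"
    using gmat_inverse[OF x] by metis
  define t where "t = (real CARD('m) - 1) * frechet_derivative (\<lambda>x. f (inv_into U \<kappa> x)) (at (fst y)) (snd y)
      + (\<Sum>i\<in>UNIV. \<Sum>j\<in>UNIV. I $ i $ j * dgc j i (fst y) (snd y))"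
  have "frechet_derivative
      (\<lambda>z. exp ((real CARD('m) - 1) * f (base c z)) * wedge_power (omega_l S c z) CARD('m) v) (at y)
      = frechet_derivative (\<lambda>z. vol_density f z * ?\<Omega> v) (at y)"
    by (rule frechet_derivative_cong_open[OF open_tdom y volume_form_eq])
  moreover have "frechet_derivative (\<lambda>z. vol_density f z * ?\<Omega> v) (at y) (X y) = vol_density f y * t * ?\<Omega> v"
    by (simp add: frechet_derivative_at[OF has_derivative_mult_left[OF vol_density_derivative[OF f y I(2)]], symmetric] fst[OF y] t_def)
  ultimately have 1: "frechet_derivative
      (\<lambda>z. exp ((real CARD('m) - 1) * f (base c z)) * wedge_power (omega_l S c z) CARD('m) v) (at y) (X y)
      = vol_density f y * t * ?\<Omega> v" by (simp only:)
  have alt: "alternating_form DIM((real^'m) \<times> (real^'m)) ?\<Omega>"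
    using alternating_form_wedge_power[OF alternating_form_omega0, of "CARD('m)"] by (simp add: mult_2)
  have "(\<Sum>i<2 * CARD('m). ?\<Omega> (v(i := ?DX (v i)))) = (\<Sum>b\<in>Basis. ?DX b \<bullet> b) * ?\<Omega> v"
    using top_form_trace[OF alt has_derivative_linear[OF smooth_on_has_derivative[OF X y]], of v]
    by (simp add: mult_2)
  also have "(\<Sum>b\<in>Basis. ?DX b \<bullet> b) = - t"
    using trace_derivative[OF X fst eq f A y I(1)] Isym by (simp add: t_def algebra_simps)
  finally have 2: "(\<Sum>i<2 * CARD('m). exp ((real CARD('m) - 1) * f (base c y)) *
      wedge_power (omega_l S c y) CARD('m) (v(i := ?DX (v i)))) = vol_density f y * (- t) * ?\<Omega> v"
    by (simp only: volume_form_eq[OF y] sum_distrib_left[symmetric] mult.assoc)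
  show ?thesis
    unfolding lie_deriv_def 1 2 by simp
qed

section \<open>Transformation law, smoothness and non-vanishing of the volume form\<close>

lemma volume_form_change:
  assumes d: "(V, \<psi>) \<in> atlas (Bman S)" and y: "y \<in> toverlap c (V, \<psi>)"
  shows "exp ((real CARD('m) - 1) * f (base c y)) * wedge_power (omega_l S c y) CARD('m) v
    = exp ((real CARD('m) - 1) * f (base (V, \<psi>) (ttrans c (V, \<psi>) y))) *
      wedge_power (omega_l S (V, \<psi>) (ttrans c (V, \<psi>) y)) CARD('m)
        (\<lambda>i. frechet_derivative (ttrans c (V, \<psi>)) (at y) (v i))"
proof -
  interpret d: chaplygin_chart S V \<psi> by unfold_locales (rule d)
  let ?t = "ttrans c (V, \<psi>)" and ?\<phi> = "\<psi> \<circ> inv_into U \<kappa>"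
  let ?J = "frechet_derivative ?\<phi> (at (fst y))"
  have V: "openin (mtop (Bman S)) V" by (rule chartedD(1)[OF charted_B d])
  have x: "fst y \<in> \<kappa> ` (U \<inter> V)" using y by (auto simp: toverlap_def)
  then obtain p where p: "p \<in> U" "p \<in> V" "fst y = \<kappa> p" by auto
  then have ip: "inv_into U \<kappa> (fst y) = p" using inj_chart by simp
  have yc: "y \<in> tdom c" using p by (simp add: tdom_iff)
  have ft: "fst (?t y) = \<psi> p" by (simp add: ttrans_def split_beta ip)
  have td: "?t y \<in> tdom (V, \<psi>)" using p ft by (simp add: d.tdom_iff)
  \<comment> \<open>Both coordinate expressions lie over the same point \<open>p\<close> of the
    quotient, so the exponential factors agree.\<close>
  have b: "base c y = p" "base (V, \<psi>) (?t y) = p"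
    using p(2) d.inj_chart by (simp_all add: base_chart d.base_chart ip ft)
  have sm: "smooth_on (\<kappa> ` (U \<inter> V)) ?\<phi>"
    using B_smooth chart d unfolding smooth_manifold_def by fastforce
  obtain K where K: "linear K" and D: "(?t has_derivative
      (\<lambda>h. (matrix ?J *v fst h, matrix ?J *v snd h + K (fst h)))) (at y)"
    using ttrans_derivative[where c = c and d = "(V, \<psi>)" and y = y, OF charted_open_image[OF charted_B chart V]] sm x
    by auto
  from D have D: "frechet_derivative ?t (at y) = (\<lambda>h. (matrix ?J *v fst h, matrix ?J *v snd h + K (fst h)))"
    by (rule frechet_derivative_at[symmetric])
  \<comment> \<open>The tensor law in matrix form. Its determinant brings the same square of the
    Jacobian determinant as the block triangular derivative of \<open>?t\<close>.\<close>
  have "gmat (fst y) = transpose (matrix ?J) ** (d.gmat (\<psi> p) ** matrix ?J)"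
    using p(2) d.inj_chart
    by (simp add: gmat_def d.gmat_def gc_def d.gc_def ip gred_change[OF chart d p(1,2)] p(3)[symmetric] vec_eq_iff
        matrix_matrix_mult_def transpose_def matrix_def sum_distrib_left ac_simps)
  then have det: "det (gmat (fst y)) = det (matrix ?J) * det (matrix ?J) * det (d.gmat (\<psi> p))"
    by (simp add: det_mul)
  have w: "wedge_power omega0 CARD('m) (\<lambda>i. frechet_derivative ?t (at y) (v i))
      = det (matrix ?J) * det (matrix ?J) * wedge_power omega0 CARD('m) v"
    unfolding D by (rule top_form_block[OF alternating_form_wedge_power[OF alternating_form_omega0] K])
  show ?thesis
    unfolding volume_form_eq[OF yc] d.volume_form_eq[OF td] w
    unfolding vol_density_def d.vol_density_def b ft det by simp
qed

lemma tb_volume_form: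
  assumes f: "smooth_fun (Bman S) (pts (Bman S)) f"
  shows "y \<in> tdom c \<Longrightarrow> alternating_form (2 * CARD('m))
      (\<lambda>v. exp ((real CARD('m) - 1) * f (base c y)) * wedge_power (omega_l S c y) CARD('m) v)"
    "smooth_on (tdom c) (\<lambda>y. exp ((real CARD('m) - 1) * f (base c y)) * wedge_power (omega_l S c y) CARD('m) v)"
proof -
  show "alternating_form (2 * CARD('m))
      (\<lambda>v. exp ((real CARD('m) - 1) * f (base c y)) * wedge_power (omega_l S c y) CARD('m) v)" if "y \<in> tdom c"
    unfolding volume_form_eq[OF that]
    by (rule alternating_form_scale[OF alternating_form_wedge_power[OF alternating_form_omega0]])
  have "smooth_on (tdom c) (\<lambda>y. vol_density f y * wedge_power omega0 CARD('m) v)"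
    by (rule smooth_on_mult[OF open_tdom vol_density_smooth[OF f] smooth_on_const])
  note * = this
  show "smooth_on (tdom c)
      (\<lambda>y. exp ((real CARD('m) - 1) * f (base c y)) * wedge_power (omega_l S c y) CARD('m) v)"
    by (rule smooth_on_cong[OF open_tdom _ *]) (rule volume_form_eq[symmetric])
qed

lemma volume_form_nonzero:
  assumes "y \<in> tdom c"
  shows "\<exists>v. exp ((real CARD('m) - 1) * f (base c y)) * wedge_power (omega_l S c y) CARD('m) v \<noteq> 0"
proof -
  obtain w :: "nat \<Rightarrow> (real^'m) \<times> (real^'m)" where "wedge_power omega0 CARD('m) w \<noteq> 0"
    using omega0_power_nonzero by blast
  then show ?thesis
    unfolding volume_form_eq[OF assms] using vol_density_nonzero[OF assms] by auto
qed

end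

theorem proposition8:
  fixes S :: "('q, 'g, 'n::finite, 'k::finite, 'm::finite) chaplygin"
    and \<xi> :: "'k \<Rightarrow> 'g tvec"
    and R :: "('q set, real^'m) chart \<Rightarrow> 'm + 'k \<Rightarrow> 'm + 'k \<Rightarrow> 'm + 'k \<Rightarrow> 'q \<Rightarrow> real"
    and \<Gamma> :: "('q set, real^'m) chart \<Rightarrow> (real^'m) \<times> (real^'m) \<Rightarrow> (real^'m) \<times> (real^'m)"
    and f :: "'q set \<Rightarrow> real"
  assumes "chaplygin_system S"
    and "lie_algebra_basis S \<xi>"
    and "\<forall>c\<in>atlas (Bman S). structure_functions S \<xi> c (R c)"
    and "reduced_vector_field S \<xi> R \<Gamma>"
    and "smooth_fun (Bman S) (pts (Bman S)) f"
    and "\<forall>c\<in>atlas (Bman S). condA' S \<xi> c (R c) f"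
  shows "(\<forall>c\<in>atlas (Bman S). \<forall>y\<in>tdom c. \<forall>v.
            exp ((real CARD('m) - 1) * f (base c y)) *
              wedge_power (\<lambda>w. omega_l S c y w - gammaG S \<xi> c (R c) y w) CARD('m) v
            = exp ((real CARD('m) - 1) * f (base c y)) * wedge_power (omega_l S c y) CARD('m) v) \<and>
         invariant_volume_form (Bman S) \<Gamma>
           (\<lambda>c y v. exp ((real CARD('m) - 1) * f (base c y)) * wedge_power (omega_l S c y) CARD('m) v)"
proof -
  let ?\<mu> = "\<lambda>c y v. exp ((real CARD('m) - 1) * f (base c y)) * wedge_power (omega_l S c y) CARD('m) v"
  have chart: "chaplygin_chart S (fst c) (snd c)" if "c \<in> atlas (Bman S)" for c
    using assms(1) that by (simp add: chaplygin_chart_def chaplygin_chart_axioms_def chaplygin_sys_def)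
  have \<Gamma>: "smooth_on (tdom c) (\<Gamma> c)" "\<And>y. y \<in> tdom c \<Longrightarrow> fst (\<Gamma> c y) = snd y"
    "\<And>y v. y \<in> tdom c \<Longrightarrow> interior_prod (\<Gamma> c) (omega_l S c) y v
      = ext_deriv 0 (\<lambda>z _. energy_l S c z) y v + alpha_red S \<xi> c (R c) y v"
    if "c \<in> atlas (Bman S)" for c
    using assms(4) that unfolding reduced_vector_field_def tb_vector_field_def by simp_all
  have 1: "?\<mu> c y v = exp ((real CARD('m) - 1) * f (base c y)) *
      wedge_power (\<lambda>w. omega_l S c y w - gammaG S \<xi> c (R c) y w) CARD('m) v"
    if c: "c \<in> atlas (Bman S)" and y: "y \<in> tdom c" for c y v
    using chaplygin_chart.omega_l_gammaG_power[OF chart[OF c], of y \<xi> "R c" v]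
      chaplygin_chart.omega_l_power[OF chart[OF c], of y v] y by simp
  have 2: "tb_form (Bman S) (2 * CARD('m)) ?\<mu>"
    unfolding tb_form_def
  proof (intro conjI ballI allI)
    fix c y assume c: "c \<in> atlas (Bman S)" and y: "y \<in> tdom c"
    show "alternating_form (2 * CARD('m)) (?\<mu> c y)"
      using chaplygin_chart.tb_volume_form(1)[OF chart[OF c] assms(5), of y] y by simp
  next
    fix c v assume c: "c \<in> atlas (Bman S)"
    show "smooth_on (tdom c) (\<lambda>y. ?\<mu> c y v)"
      using chaplygin_chart.tb_volume_form(2)[OF chart[OF c] assms(5), of v] by simp
  next
    fix c d y v assume c: "c \<in> atlas (Bman S)" and d: "d \<in> atlas (Bman S)" and y: "y \<in> toverlap c d"
    show "?\<mu> c y v = ?\<mu> d (ttrans c d y) (\<lambda>i. frechet_derivative (ttrans c d) (at y) (v i))"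
      using chaplygin_chart.volume_form_change[OF chart[OF c], of "fst d" "snd d" y f v] d y by simp
  qed
  have 3: "\<exists>v. ?\<mu> c y v \<noteq> 0" if c: "c \<in> atlas (Bman S)" and y: "y \<in> tdom c" for c y
    using chaplygin_chart.volume_form_nonzero[OF chart[OF c], of y f] y by simp
  have 4: "lie_deriv (2 * CARD('m)) (\<Gamma> c) (?\<mu> c) y v = 0"
    if c: "c \<in> atlas (Bman S)" and y: "y \<in> tdom c" for c y v
    using chaplygin_chart.lie_deriv_volume_form[OF chart[OF c], of "\<Gamma> c" \<xi> "R c" f y v]
      \<Gamma>[OF c] assms(5,6) c y by simp
  show ?thesis
    using 1 2 3 4 unfolding invariant_volume_form_def by simp
qed

end
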